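(* Let $R$ be a strong Prüfer ring. Then $R$ is a $\mathrm{DW}$ ring. Consequently, $\mathrm{fPD}(R)\leq 1$.
   Context: Rings are commutative with identity. An ideal $I$ of $R$ is dense if $\mathrm{Ann}(I)=\{r\in R\mid Ir=0\}=0$, and semi-regular if it contains a finitely generated dense sub-ideal. $R$ is a strong Prüfer ring if every finitely generated semi-regular ideal of $R$ is locally principal. A finitely generated ideal $J$ of $R$ is a $\mathrm{GV}$-ideal if $\mathrm{Hom}_R(R/J,R)=\mathrm{Ext}_R^1(R/J,R)=0$; $\mathrm{GV}(R)$ is the set of all $\mathrm{GV}$-ideals, and $R$ is a $\mathrm{DW}$ ring if $\mathrm{GV}(R)=\{R\}$. An $R$-module $M$ has a finite projective resolution if there are an integer $m\ge 0$ and an exact sequence $0\to P_m\to\dots\to P_0\to M\to 0$ with each $P_i$ finitely generated projective. The small finitistic dimension $\mathrm{fPD}(R)$ is the supremum of the projective dimensions of all $R$-modules having a finite projective resolution. *)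

theory Defs
  imports "HOL-Algebra.Algebra" "HOL-Library.Extended_Nat"
begin

section \<open>Modules and their homomorphisms\<close>

text \<open>Homomorphisms are taken extensional, so that equality of homomorphisms is equality in HOL.\<close>

definition module_hom ::
    "('a, 'r) ring_scheme \<Rightarrow> ('a, 'm, 'c) module_scheme \<Rightarrow> ('a, 'n, 'd) module_scheme \<Rightarrow> ('m \<Rightarrow> 'n) set"
  where "module_hom R M N =
    {f \<in> carrier M \<rightarrow>\<^sub>E carrier N.
       (\<forall>x\<in>carrier M. \<forall>y\<in>carrier M. f (x \<oplus>\<^bsub>M\<^esub> y) = f x \<oplus>\<^bsub>N\<^esub> f y) \<and>
       (\<forall>a\<in>carrier R. \<forall>x\<in>carrier M. f (a \<odot>\<^bsub>M\<^esub> x) = a \<odot>\<^bsub>N\<^esub> f x)}"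

definition hom_group ::
    "('a, 'r) ring_scheme \<Rightarrow> ('a, 'm, 'c) module_scheme \<Rightarrow> ('a, 'n, 'd) module_scheme \<Rightarrow> ('m \<Rightarrow> 'n) monoid"
  where "hom_group R M N =
    \<lparr>carrier = module_hom R M N,
     monoid.mult = (\<lambda>f g. \<lambda>x\<in>carrier M. f x \<oplus>\<^bsub>N\<^esub> g x),
     one = (\<lambda>x\<in>carrier M. \<zero>\<^bsub>N\<^esub>)\<rparr>"

definition regular_module :: "('a, 'r) ring_scheme \<Rightarrow> ('a, 'a) module"
  where "regular_module R =
    \<lparr>carrier = carrier R, monoid.mult = monoid.mult R, one = \<one>\<^bsub>R\<^esub>,
     ring.zero = \<zero>\<^bsub>R\<^esub>, ring.add = ring.add R, smult = monoid.mult R\<rparr>"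

definition quotient_module :: "('a, 'r) ring_scheme \<Rightarrow> 'a set \<Rightarrow> ('a, 'a set) module"
  where "quotient_module R J =
    ring.extend (R Quot J) \<lparr>smult = (\<lambda>a B. rcoset_mult R J (J +>\<^bsub>R\<^esub> a) B)\<rparr>"

text \<open>The free module on a set \<open>B\<close> (finitely supported functions \<open>B \<Rightarrow> R\<close>, extended by zero), and
  the linear extension of a map \<open>c\<close> defined on \<open>B\<close>. Modules are records extending rings, so the
  ring multiplication and unit have to be given, but they play no role.\<close>

definition free_module :: "('a, 'r) ring_scheme \<Rightarrow> 'x set \<Rightarrow> ('a, 'x \<Rightarrow> 'a) module"
  where "free_module R B =
    \<lparr>carrier = {f. f ` B \<subseteq> carrier R \<and> (\<forall>x. x \<notin> B \<longrightarrow> f x = \<zero>\<^bsub>R\<^esub>) \<and> finite {x. f x \<noteq> \<zero>\<^bsub>R\<^esub>}},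
     monoid.mult = (\<lambda>f g x. f x \<otimes>\<^bsub>R\<^esub> g x), one = (\<lambda>x. \<zero>\<^bsub>R\<^esub>),
     ring.zero = (\<lambda>x. \<zero>\<^bsub>R\<^esub>), ring.add = (\<lambda>f g x. f x \<oplus>\<^bsub>R\<^esub> g x), smult = (\<lambda>a f x. a \<otimes>\<^bsub>R\<^esub> f x)\<rparr>"

definition linear_extension ::
    "('a, 'r) ring_scheme \<Rightarrow> 'x set \<Rightarrow> ('a, 'm, 'c) module_scheme \<Rightarrow> ('x \<Rightarrow> 'm) \<Rightarrow> ('x \<Rightarrow> 'a) \<Rightarrow> 'm"
  where "linear_extension R B M c =
    (\<lambda>f\<in>carrier (free_module R B). \<Oplus>\<^bsub>M\<^esub>x\<in>{x. f x \<noteq> \<zero>\<^bsub>R\<^esub>}. f x \<odot>\<^bsub>M\<^esub> c x)"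

text \<open>\<open>Ext\<^sup>1(M, N)\<close> as the cokernel of \<open>Hom(F, N) \<rightarrow> Hom(K, N)\<close> for a projective presentation
  \<open>0 \<rightarrow> K \<rightarrow> F \<rightarrow> M \<rightarrow> 0\<close>; up to isomorphism it does not depend on the presentation, and the canonical
  one is used, where \<open>F\<close> is free on the set of elements of \<open>M\<close>.\<close>

definition presentation_kernel ::
    "('a, 'r) ring_scheme \<Rightarrow> ('a, 'm, 'c) module_scheme \<Rightarrow> ('a, 'm \<Rightarrow> 'a) module"
  where "presentation_kernel R M =
    (free_module R (carrier M))
      \<lparr>carrier := {f \<in> carrier (free_module R (carrier M)).
         linear_extension R (carrier M) M (\<lambda>x. x) f = \<zero>\<^bsub>M\<^esub>}\<rparr>"

definition Ext1 ::
    "('a, 'r) ring_scheme \<Rightarrow> ('a, 'm, 'c) module_scheme \<Rightarrow> ('a, 'n, 'd) module_scheme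
      \<Rightarrow> (('m \<Rightarrow> 'a) \<Rightarrow> 'n) set monoid"
  where "Ext1 R M N =
    hom_group R (presentation_kernel R M) N Mod
      ((\<lambda>f. restrict f (carrier (presentation_kernel R M))) `
         module_hom R (free_module R (carrier M)) N)"

section \<open>Localization of a ring at a multiplicative subset\<close>

definition fraction :: "('a, 'r) ring_scheme \<Rightarrow> 'a set \<Rightarrow> 'a \<Rightarrow> 'a \<Rightarrow> ('a \<times> 'a) set"
  where "fraction R S r s =
    {(r', s'). r' \<in> carrier R \<and> s' \<in> S \<and> (\<exists>u\<in>S. u \<otimes>\<^bsub>R\<^esub> (r \<otimes>\<^bsub>R\<^esub> s' \<ominus>\<^bsub>R\<^esub> r' \<otimes>\<^bsub>R\<^esub> s) = \<zero>\<^bsub>R\<^esub>)}"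

text \<open>The unions in the operations range over all representatives of the two fractions; they all
  contribute the same class.\<close>

definition localization :: "('a, 'r) ring_scheme \<Rightarrow> 'a set \<Rightarrow> ('a \<times> 'a) set ring"
  where "localization R S =
    \<lparr>carrier = {fraction R S r s | r s. r \<in> carrier R \<and> s \<in> S},
     monoid.mult = (\<lambda>B C. \<Union>(r, s)\<in>B. \<Union>(r', s')\<in>C. fraction R S (r \<otimes>\<^bsub>R\<^esub> r') (s \<otimes>\<^bsub>R\<^esub> s')),
     one = fraction R S \<one>\<^bsub>R\<^esub> \<one>\<^bsub>R\<^esub>,
     ring.zero = fraction R S \<zero>\<^bsub>R\<^esub> \<one>\<^bsub>R\<^esub>,
     ring.add = (\<lambda>B C. \<Union>(r, s)\<in>B. \<Union>(r', s')\<in>C.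
       fraction R S (r \<otimes>\<^bsub>R\<^esub> s' \<oplus>\<^bsub>R\<^esub> r' \<otimes>\<^bsub>R\<^esub> s) (s \<otimes>\<^bsub>R\<^esub> s'))\<rparr>"

definition localized_ideal :: "('a, 'r) ring_scheme \<Rightarrow> 'a set \<Rightarrow> 'a set \<Rightarrow> ('a \<times> 'a) set set"
  where "localized_ideal R S I = {fraction R S a s | a s. a \<in> I \<and> s \<in> S}"

section \<open>Strong Pruefer rings and DW rings\<close>

definition fg_ideal :: "('a, 'r) ring_scheme \<Rightarrow> 'a set \<Rightarrow> bool"
  where "fg_ideal R I \<longleftrightarrow> (\<exists>A. finite A \<and> A \<subseteq> carrier R \<and> I = genideal R A)"

definition annihilator :: "('a, 'r) ring_scheme \<Rightarrow> 'a set \<Rightarrow> 'a set"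
  where "annihilator R I = {r \<in> carrier R. \<forall>x\<in>I. x \<otimes>\<^bsub>R\<^esub> r = \<zero>\<^bsub>R\<^esub>}"

definition dense_ideal :: "('a, 'r) ring_scheme \<Rightarrow> 'a set \<Rightarrow> bool"
  where "dense_ideal R I \<longleftrightarrow> ideal I R \<and> annihilator R I = {\<zero>\<^bsub>R\<^esub>}"

definition semiregular_ideal :: "('a, 'r) ring_scheme \<Rightarrow> 'a set \<Rightarrow> bool"
  where "semiregular_ideal R I \<longleftrightarrow> ideal I R \<and> (\<exists>J\<subseteq>I. fg_ideal R J \<and> dense_ideal R J)"

definition locally_principal :: "('a, 'r) ring_scheme \<Rightarrow> 'a set \<Rightarrow> bool"
  where "locally_principal R I \<longleftrightarrow>
    (\<forall>m. maximalideal m R \<longrightarrow>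
       principalideal (localized_ideal R (carrier R - m) I) (localization R (carrier R - m)))"

definition strong_Prufer_ring :: "('a, 'r) ring_scheme \<Rightarrow> bool"
  where "strong_Prufer_ring R \<longleftrightarrow>
    cring R \<and> (\<forall>I. fg_ideal R I \<and> semiregular_ideal R I \<longrightarrow> locally_principal R I)"

definition GV :: "('a, 'r) ring_scheme \<Rightarrow> 'a set set"
  where "GV R =
    {J. fg_ideal R J \<and>
        (let H = hom_group R (quotient_module R J) (regular_module R);
             E = Ext1 R (quotient_module R J) (regular_module R)
         in carrier H = {\<one>\<^bsub>H\<^esub>} \<and> carrier E = {\<one>\<^bsub>E\<^esub>})}"

definition DW_ring :: "('a, 'r) ring_scheme \<Rightarrow> bool"
  where "DW_ring R \<longleftrightarrow> cring R \<and> GV R = {carrier R}"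

section \<open>Projective modules, projective dimension, small finitistic dimension\<close>

definition lifts_along ::
    "('a, 'r) ring_scheme \<Rightarrow> ('a, 'p, 'c) module_scheme \<Rightarrow>
     ('a, 'm, 'd) module_scheme \<Rightarrow> ('a, 'n, 'e) module_scheme \<Rightarrow> bool"
  where "lifts_along R P M N \<longleftrightarrow>
    (\<forall>g\<in>module_hom R M N. g ` carrier M = carrier N \<longrightarrow>
      (\<forall>f\<in>module_hom R P N. \<exists>h\<in>module_hom R P M. \<forall>x\<in>carrier P. g (h x) = f x))"

text \<open>A definition in HOL cannot quantify over types, so the lifting property is demanded for two
  carrier types that are large enough for the epimorphism onto \<open>P\<close> from the free module on the
  elements of \<open>P\<close>. Lemma \<open>projective_module_lifts\<close> recovers it for arbitrary carrier types.\<close>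

definition projective_module :: "('a, 'r) ring_scheme \<Rightarrow> ('a, 'p) module \<Rightarrow> bool"
  where "projective_module R P \<longleftrightarrow> module R P \<and>
    (\<forall>(M :: ('a, 'p \<Rightarrow> 'a) module) (N :: ('a, 'p) module).
       module R M \<and> module R N \<longrightarrow> lifts_along R P M N)"

lemma module_hom_closed: "f \<in> module_hom R M N \<Longrightarrow> x \<in> carrier M \<Longrightarrow> f x \<in> carrier N"
  by (auto simp: module_hom_def)

lemma module_hom_zero:
  assumes "module R M" "module R N" "f \<in> module_hom R M N"
  shows "f \<zero>\<^bsub>M\<^esub> = \<zero>\<^bsub>N\<^esub>"
proof -
  interpret M: module R M by fact
  interpret N: module R N by fact
  have "f (\<zero>\<^bsub>R\<^esub> \<odot>\<^bsub>M\<^esub> \<zero>\<^bsub>M\<^esub>) = \<zero>\<^bsub>R\<^esub> \<odot>\<^bsub>N\<^esub> f \<zero>\<^bsub>M\<^esub>"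
    using assms(3) M.R.zero_closed M.M.zero_closed unfolding module_hom_def by blast
  moreover have "f \<zero>\<^bsub>M\<^esub> \<in> carrier N" using module_hom_closed[OF assms(3)] by simp
  ultimately show ?thesis by simp
qed

lemma module_hom_finsum:
  assumes "module R M" "module R N" "f \<in> module_hom R M N" "finite A" "c \<in> A \<rightarrow> carrier M"
  shows "f (\<Oplus>\<^bsub>M\<^esub>x\<in>A. c x) = (\<Oplus>\<^bsub>N\<^esub>x\<in>A. f (c x))"
proof -
  interpret M: module R M by fact
  interpret N: module R N by fact
  show ?thesis using assms(4,5)
  proof induction
    case empty
    then show ?case using module_hom_zero[OF assms(1-3)] by simp
  next
    case (insert a A)
    have *: "f (c a \<oplus>\<^bsub>M\<^esub> (\<Oplus>\<^bsub>M\<^esub>x\<in>A. c x)) = f (c a) \<oplus>\<^bsub>N\<^esub> f (\<Oplus>\<^bsub>M\<^esub>x\<in>A. c x)"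
      using insert.prems assms(3) M.finsum_closed[of c A] by (auto simp: module_hom_def Pi_iff)
    have "(\<lambda>x. f (c x)) \<in> A \<rightarrow> carrier N" "f (c a) \<in> carrier N"
      using insert.prems module_hom_closed[OF assms(3)] by auto
    moreover have "c \<in> A \<rightarrow> carrier M" "c a \<in> carrier M" using insert.prems by auto
    ultimately show ?case using insert * by simp
  qed
qed

lemma free_module_module:
  assumes "cring R"
  shows "module R (free_module R B)"
proof -
  interpret cring R by fact
  let ?F = "free_module R B"
  have c: "f x \<in> carrier R" if "f \<in> carrier ?F" for f x
    using that by (cases "x \<in> B") (auto simp: free_module_def)
  have z: "f x = \<zero>\<^bsub>R\<^esub>" if "f \<in> carrier ?F" "x \<notin> B" for f x
    using that by (auto simp: free_module_def)
  have fin: "finite {x. f x \<noteq> \<zero>\<^bsub>R\<^esub>}" if "f \<in> carrier ?F" for f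
    using that by (auto simp: free_module_def)
  have I: "f \<in> carrier ?F" if "\<And>x. f x \<in> carrier R" "\<And>x. x \<notin> B \<Longrightarrow> f x = \<zero>\<^bsub>R\<^esub>" "finite {x. f x \<noteq> \<zero>\<^bsub>R\<^esub>}" for f
    using that by (auto simp: free_module_def)
  have add: "(\<lambda>x. f x \<oplus>\<^bsub>R\<^esub> g x) \<in> carrier ?F" if "f \<in> carrier ?F" "g \<in> carrier ?F" for f g
    by (rule I, use c that z[OF that(1)] z[OF that(2)] in
        \<open>auto intro!: finite_subset[OF _ finite_UnI[OF fin[OF that(1)] fin[OF that(2)]]]\<close>)
  have smult: "(\<lambda>x. a \<otimes>\<^bsub>R\<^esub> f x) \<in> carrier ?F" if "f \<in> carrier ?F" "a \<in> carrier R" for f a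
    by (rule I, use c that z[OF that(1)] in \<open>auto intro!: finite_subset[OF _ fin[OF that(1)]]\<close>)
  have zero: "(\<lambda>x. \<zero>\<^bsub>R\<^esub>) \<in> carrier ?F" by (rule I) auto
  have ops: "f \<oplus>\<^bsub>?F\<^esub> g = (\<lambda>x. f x \<oplus>\<^bsub>R\<^esub> g x)" "a \<odot>\<^bsub>?F\<^esub> f = (\<lambda>x. a \<otimes>\<^bsub>R\<^esub> f x)"
    "\<zero>\<^bsub>?F\<^esub> = (\<lambda>x. \<zero>\<^bsub>R\<^esub>)" for f g a
    by (auto simp: free_module_def)
  have "\<exists>g\<in>carrier ?F. g \<oplus>\<^bsub>?F\<^esub> f = \<zero>\<^bsub>?F\<^esub>" if "f \<in> carrier ?F" for f
    using smult[OF that, of "\<ominus>\<^bsub>R\<^esub> \<one>\<^bsub>R\<^esub>"] c[OF that]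
    by (auto simp: ops l_minus l_neg intro!: bexI[of _ "\<lambda>x. \<ominus>\<^bsub>R\<^esub> \<one>\<^bsub>R\<^esub> \<otimes>\<^bsub>R\<^esub> f x"])
  then have "abelian_group ?F"
    by (intro abelian_groupI) (auto simp: ops add zero c a_ac)
  then show ?thesis
    by (intro moduleI assms) (auto simp: ops smult c l_distr r_distr m_assoc)
qed

lemma linear_extension_finite:
  assumes "module R M" "c \<in> B \<rightarrow> carrier M" "f \<in> carrier (free_module R B)"
    and "finite A" "{x. f x \<noteq> \<zero>\<^bsub>R\<^esub>} \<subseteq> A" "A \<subseteq> B"
  shows "linear_extension R B M c f = (\<Oplus>\<^bsub>M\<^esub>x\<in>A. f x \<odot>\<^bsub>M\<^esub> c x)"
proof -
  interpret module R M by fact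
  have "f x \<odot>\<^bsub>M\<^esub> c x \<in> carrier M" if "x \<in> A" for x
    using assms(2,3,6) that by (intro smult_closed) (auto simp: free_module_def image_subset_iff)
  moreover have "f x \<odot>\<^bsub>M\<^esub> c x = \<zero>\<^bsub>M\<^esub>" if "x \<in> A" "f x = \<zero>\<^bsub>R\<^esub>" for x
    using assms(2,6) that by (simp add: Pi_iff subset_iff)
  ultimately show ?thesis
    unfolding linear_extension_def using assms
    by (auto intro!: M.add.finprod_mono_neutral_cong_left)
qed

lemma linear_extension_hom:
  assumes "module R M" "c \<in> B \<rightarrow> carrier M"
  shows "linear_extension R B M c \<in> module_hom R (free_module R B) M"
proof -
  interpret M: module R M by fact
  let ?F = "free_module R B"
  interpret F: module R ?F using free_module_module M.R.is_cring by blast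
  let ?s = "\<lambda>f. {x. f x \<noteq> \<zero>\<^bsub>R\<^esub>}"
  have s: "finite (?s f)" "?s f \<subseteq> B" "\<And>x. f x \<in> carrier R" if "f \<in> carrier ?F" for f
  proof -
    show "f x \<in> carrier R" for x using that by (cases "x \<in> B") (auto simp: free_module_def)
  qed (use that in \<open>auto simp: free_module_def\<close>)
  have cl: "(\<lambda>x. f x \<odot>\<^bsub>M\<^esub> c x) \<in> A \<rightarrow> carrier M" if "f \<in> carrier ?F" "A \<subseteq> B" for f A
    using that s(3)[OF that(1)] assms(2) by (fastforce simp: Pi_iff)
  have ops: "f \<oplus>\<^bsub>?F\<^esub> g = (\<lambda>x. f x \<oplus>\<^bsub>R\<^esub> g x)" "a \<odot>\<^bsub>?F\<^esub> f = (\<lambda>x. a \<otimes>\<^bsub>R\<^esub> f x)" for f g a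
    by (auto simp: free_module_def)
  have cA: "\<And>x. x \<in> A \<Longrightarrow> c x \<in> carrier M" if "A \<subseteq> B" for A
    using that assms(2) by auto
  have "linear_extension R B M c (f \<oplus>\<^bsub>?F\<^esub> g) = linear_extension R B M c f \<oplus>\<^bsub>M\<^esub> linear_extension R B M c g"
    if fg: "f \<in> carrier ?F" "g \<in> carrier ?F" for f g
  proof -
    let ?A = "?s f \<union> ?s g"
    have A: "finite ?A" "?A \<subseteq> B" using s fg by auto
    have "linear_extension R B M c (f \<oplus>\<^bsub>?F\<^esub> g) = (\<Oplus>\<^bsub>M\<^esub>x\<in>?A. (f \<oplus>\<^bsub>?F\<^esub> g) x \<odot>\<^bsub>M\<^esub> c x)"
      by (rule linear_extension_finite[OF assms]) (use fg A F.M.a_closed[OF fg] in \<open>auto simp: ops(1)[of f g]\<close>)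
    also have "\<dots> = (\<Oplus>\<^bsub>M\<^esub>x\<in>?A. f x \<odot>\<^bsub>M\<^esub> c x \<oplus>\<^bsub>M\<^esub> g x \<odot>\<^bsub>M\<^esub> c x)"
      by (rule M.finsum_cong') (use fg s cA[OF A(2)] in \<open>auto simp: ops M.smult_l_distr\<close>)
    also have "\<dots> = (\<Oplus>\<^bsub>M\<^esub>x\<in>?A. f x \<odot>\<^bsub>M\<^esub> c x) \<oplus>\<^bsub>M\<^esub> (\<Oplus>\<^bsub>M\<^esub>x\<in>?A. g x \<odot>\<^bsub>M\<^esub> c x)"
      by (rule M.finsum_addf) (use fg A(2) cl in blast)+
    also have "(\<Oplus>\<^bsub>M\<^esub>x\<in>?A. f x \<odot>\<^bsub>M\<^esub> c x) = linear_extension R B M c f"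
      by (rule linear_extension_finite[OF assms, symmetric]) (use fg A in auto)
    also have "(\<Oplus>\<^bsub>M\<^esub>x\<in>?A. g x \<odot>\<^bsub>M\<^esub> c x) = linear_extension R B M c g"
      by (rule linear_extension_finite[OF assms, symmetric]) (use fg A in auto)
    finally show ?thesis .
  qed
  moreover have "linear_extension R B M c (a \<odot>\<^bsub>?F\<^esub> f) = a \<odot>\<^bsub>M\<^esub> linear_extension R B M c f"
    if f: "f \<in> carrier ?F" "a \<in> carrier R" for f a
  proof -
    note A = s(1,2)[OF f(1)]
    have "linear_extension R B M c (a \<odot>\<^bsub>?F\<^esub> f) = (\<Oplus>\<^bsub>M\<^esub>x\<in>?s f. (a \<odot>\<^bsub>?F\<^esub> f) x \<odot>\<^bsub>M\<^esub> c x)"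
      by (rule linear_extension_finite[OF assms]) (use f A F.smult_closed[OF f(2,1)] in \<open>auto simp: ops(2)[of a f]\<close>)
    also have "\<dots> = (\<Oplus>\<^bsub>M\<^esub>x\<in>?s f. a \<odot>\<^bsub>M\<^esub> (f x \<odot>\<^bsub>M\<^esub> c x))"
      by (rule M.finsum_cong') (use f s cA[OF A(2)] in \<open>auto simp: ops M.smult_assoc1\<close>)
    also have "\<dots> = a \<odot>\<^bsub>M\<^esub> (\<Oplus>\<^bsub>M\<^esub>x\<in>?s f. f x \<odot>\<^bsub>M\<^esub> c x)"
      using M.finsum_smult_ldistr[OF A(1) f(2) cl[OF f(1) A(2)]] by simp
    finally show ?thesis
      using linear_extension_finite[OF assms f(1) A(1) _ A(2)] by simp
  qed
  moreover have "linear_extension R B M c f \<in> carrier M" if "f \<in> carrier ?F" for f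
    using linear_extension_finite[OF assms that s(1)[OF that] _ s(2)[OF that]]
      M.finsum_closed[OF cl[OF that s(2)[OF that]]] by simp
  ultimately show ?thesis
    by (auto simp: module_hom_def linear_extension_def)
qed

lemma projective_module_lifts:
  assumes "projective_module R P" "module R M" "module R N"
  shows "lifts_along R P M N"
  unfolding lifts_along_def
proof (intro ballI impI)
  interpret P: module R P using assms(1) by (auto simp: projective_module_def)
  interpret M: module R M by fact
  interpret N: module R N by fact
  let ?B = "carrier P"
  let ?F = "free_module R ?B"
  let ?e = "linear_extension R ?B P (\<lambda>x. x)"
  fix g f assume g: "g \<in> module_hom R M N" "g ` carrier M = carrier N" and f: "f \<in> module_hom R P N"
  have F: "module R ?F" using free_module_module P.R.is_cring by blast
  have P: "module R P" by unfold_locales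
  have e: "?e \<in> module_hom R ?F P" by (rule linear_extension_hom[OF P]) auto
  have surj: "?e ` carrier ?F = ?B"
  proof
    show "?e ` carrier ?F \<subseteq> ?B" using module_hom_closed[OF e] by auto
    show "?B \<subseteq> ?e ` carrier ?F"
    proof
      fix x assume x: "x \<in> ?B"
      let ?d = "\<lambda>y. if y = x then \<one>\<^bsub>R\<^esub> else \<zero>\<^bsub>R\<^esub>"
      have "{y. ?d y \<noteq> \<zero>\<^bsub>R\<^esub>} \<subseteq> {x}" by auto
      then have d: "?d \<in> carrier ?F" using x finite_subset
        by (auto simp: free_module_def split: if_splits)
      have "?e ?d = (\<Oplus>\<^bsub>P\<^esub>y\<in>{x}. ?d y \<odot>\<^bsub>P\<^esub> y)"
        by (rule linear_extension_finite[OF P _ d]) (use x in \<open>auto\<close>)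
      then have "?e ?d = x" using x by simp
      then show "x \<in> ?e ` carrier ?F" using d by (metis imageI)
    qed
  qed
  have id: "(\<lambda>x\<in>?B. x) \<in> module_hom R P P" by (auto simp: module_hom_def)
  have "lifts_along R P ?F P" using assms(1) F P by (auto simp: projective_module_def)
  then obtain s where s: "s \<in> module_hom R P ?F" "\<And>x. x \<in> ?B \<Longrightarrow> ?e (s x) = x"
    using e surj id unfolding lifts_along_def by fastforce
  have "\<exists>c. \<forall>x\<in>?B. c x \<in> carrier M \<and> g (c x) = f x"
    using g(2) module_hom_closed[OF f] by (intro bchoice) (metis imageE)
  then obtain c where c: "\<And>x. x \<in> ?B \<Longrightarrow> c x \<in> carrier M" "\<And>x. x \<in> ?B \<Longrightarrow> g (c x) = f x" by auto
  let ?l = "linear_extension R ?B M c"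
  have l: "?l \<in> module_hom R ?F M" by (rule linear_extension_hom) (use assms c in auto)
  define h where "h = (\<lambda>x\<in>?B. ?l (s x))"
  have "h \<in> module_hom R P M"
    using l s(1) by (auto simp: h_def module_hom_def PiE_iff)
  moreover have "g (h x) = f x" if x: "x \<in> ?B" for x
  proof -
    have sx: "s x \<in> carrier ?F" using s(1) x module_hom_closed by metis
    let ?A = "{y. s x y \<noteq> \<zero>\<^bsub>R\<^esub>}"
    have A: "finite ?A" "?A \<subseteq> ?B" using sx by (auto simp: free_module_def)
    have sc: "s x y \<in> carrier R" if "y \<in> ?A" for y
      using sx A that by (auto simp: free_module_def)
    have "g (h x) = g (\<Oplus>\<^bsub>M\<^esub>y\<in>?A. s x y \<odot>\<^bsub>M\<^esub> c y)"
      using x sx by (simp add: h_def linear_extension_def)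
    also have "\<dots> = (\<Oplus>\<^bsub>N\<^esub>y\<in>?A. g (s x y \<odot>\<^bsub>M\<^esub> c y))"
      by (rule module_hom_finsum[OF assms(2,3) g(1) A(1)]) (use sc c A in auto)
    also have "\<dots> = (\<Oplus>\<^bsub>N\<^esub>y\<in>?A. f (s x y \<odot>\<^bsub>P\<^esub> y))"
    proof (rule N.finsum_cong')
      fix y assume y: "y \<in> ?A"
      then have y': "y \<in> ?B" using A by auto
      have "g (s x y \<odot>\<^bsub>M\<^esub> c y) = s x y \<odot>\<^bsub>N\<^esub> g (c y)"
        using g(1) sc[OF y] c(1)[OF y'] by (auto simp: module_hom_def)
      also have "\<dots> = f (s x y \<odot>\<^bsub>P\<^esub> y)"
        using f sc[OF y] y' c(2)[OF y'] by (auto simp: module_hom_def)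
      finally show "g (s x y \<odot>\<^bsub>M\<^esub> c y) = f (s x y \<odot>\<^bsub>P\<^esub> y)" .
    qed (use sc A module_hom_closed[OF f] in auto)
    also have "\<dots> = f (\<Oplus>\<^bsub>P\<^esub>y\<in>?A. s x y \<odot>\<^bsub>P\<^esub> y)"
      by (rule module_hom_finsum[OF P assms(3) f A(1), symmetric]) (use sc A in auto)
    also have "(\<Oplus>\<^bsub>P\<^esub>y\<in>?A. s x y \<odot>\<^bsub>P\<^esub> y) = ?e (s x)"
      using sx by (simp add: linear_extension_def)
    finally show ?thesis using s(2)[OF x] by simp
  qed
  ultimately show "\<exists>h\<in>module_hom R P M. \<forall>x\<in>?B. g (h x) = f x" by blast
qed

definition fg_module :: "('a, 'r) ring_scheme \<Rightarrow> ('a, 'm, 'c) module_scheme \<Rightarrow> bool"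
  where "fg_module R M \<longleftrightarrow> module R M \<and>
    (\<exists>A. finite A \<and> A \<subseteq> carrier M \<and> (\<forall>N. submodule N R M \<and> A \<subseteq> N \<longrightarrow> N = carrier M))"

text \<open>Exactness of \<open>0 \<rightarrow> P n \<rightarrow> \<dots> \<rightarrow> P 0 \<rightarrow> M \<rightarrow> 0\<close> with differentials \<open>d i : P (i + 1) \<rightarrow> P i\<close> and
  augmentation \<open>e : P 0 \<rightarrow> M\<close>. Here \<open>resolution_kernel\<close> is the kernel of the map leaving \<open>P i\<close>.\<close>

definition resolution_kernel ::
    "('a, 'm, 'c) module_scheme \<Rightarrow> (nat \<Rightarrow> ('a, 'p) module) \<Rightarrow> (nat \<Rightarrow> 'p \<Rightarrow> 'p) \<Rightarrow> ('p \<Rightarrow> 'm) \<Rightarrow> nat \<Rightarrow> 'p set"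
  where "resolution_kernel M P d e i =
    (case i of
       0 \<Rightarrow> {x \<in> carrier (P 0). e x = \<zero>\<^bsub>M\<^esub>}
     | Suc j \<Rightarrow> {x \<in> carrier (P (Suc j)). d j x = \<zero>\<^bsub>P j\<^esub>})"

definition projective_resolution ::
    "('a, 'r) ring_scheme \<Rightarrow> ('a, 'm, 'c) module_scheme \<Rightarrow> nat \<Rightarrow>
     (nat \<Rightarrow> ('a, 'p) module) \<Rightarrow> (nat \<Rightarrow> 'p \<Rightarrow> 'p) \<Rightarrow> ('p \<Rightarrow> 'm) \<Rightarrow> bool"
  where "projective_resolution R M n P d e \<longleftrightarrow>
    (\<forall>i\<le>n. projective_module R (P i)) \<and>
    e \<in> module_hom R (P 0) M \<and> (\<forall>i<n. d i \<in> module_hom R (P (Suc i)) (P i)) \<and>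
    e ` carrier (P 0) = carrier M \<and>
    (\<forall>i<n. d i ` carrier (P (Suc i)) = resolution_kernel M P d e i) \<and>
    resolution_kernel M P d e n = {\<zero>\<^bsub>P n\<^esub>}"

text \<open>The modules in a resolution are taken with elements in the type \<open>('a + 'm) list\<close>. It is infinite
  and at least as large as \<open>R\<close> and \<open>M\<close>, hence it accommodates, up to isomorphism, all free modules
  and syzygies in the canonical free resolution of \<open>M\<close>, and all finitely generated modules. So both
  notions below are the same as with resolutions by arbitrary modules. The
  zero module has projective dimension \<open>0\<close>, and the infimum of the empty set is \<open>\<infinity>\<close>.\<close>

definition has_finite_projective_resolution :: "('a, 'r) ring_scheme \<Rightarrow> ('a, 'm) module \<Rightarrow> bool"
  where "has_finite_projective_resolution R M \<longleftrightarrow> module R M \<and>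
    (\<exists>n (P :: nat \<Rightarrow> ('a, ('a + 'm) list) module) d e.
       projective_resolution R M n P d e \<and> (\<forall>i\<le>n. fg_module R (P i)))"

definition projective_dimension :: "('a, 'r) ring_scheme \<Rightarrow> ('a, 'm) module \<Rightarrow> enat"
  where "projective_dimension R M =
    Inf {enat n | n. \<exists>(P :: nat \<Rightarrow> ('a, ('a + 'm) list) module) d e. projective_resolution R M n P d e}"

text \<open>The type argument is the type of elements of the modules over which the supremum is taken.
  \<open>TYPE('a list)\<close> already gives the supremum over all modules, since modules with a finite projective
  resolution are finitely generated; a bound for every type covers all modules literally.\<close>

definition fPD :: "'m itself \<Rightarrow> ('a, 'r) ring_scheme \<Rightarrow> enat"
  where "fPD (_ :: 'm itself) R =
    Sup (projective_dimension R ` {M :: ('a, 'm) module. has_finite_projective_resolution R M})"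

end

theory Submission
  imports Defs
begin

text \<open>Everything rests on one observation (\<open>strong_Prufer_local_generator\<close>). Let \<open>J\<close> be a finitely
  generated dense ideal of a strong Pruefer ring and \<open>m\<close> a maximal ideal. Then \<open>J\<close> is generated at \<open>m\<close>
  by a single \<open>a \<in> J\<close>, with one common denominator \<open>s\<close> outside \<open>m\<close>: every \<open>x \<in> J\<close> satisfies
  \<open>s x = t a\<close> for some \<open>t\<close>. As \<open>J\<close> is dense, \<open>a\<close> is regular at \<open>m\<close>: \<open>r a = 0\<close> implies \<open>r s = 0\<close>.
  This is used as a statement about elements of \<open>R\<close>, so that no localized modules are needed.

  \<^emph>\<open>The ring is DW.\<close> Let \<open>J\<close> be a GV-ideal. Vanishing of \<open>Hom(R/J, R)\<close> says that \<open>J\<close> is dense, and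
  vanishing of \<open>Ext\<^sup>1(R/J, R)\<close> says that every linear map \<open>J \<rightarrow> R\<close> is multiplication by an element of
  \<open>R\<close>. Suppose \<open>J \<subseteq> m\<close>. Division by \<open>a\<close> is well defined after multiplication by powers of \<open>s\<close>, and
  \<open>y \<mapsto> s\<^sup>2 y / a\<close> is a linear map \<open>J \<rightarrow> R\<close> with value \<open>s\<^sup>2\<close> at \<open>a\<close>. If it is multiplication by \<open>r\<close>,
  then \<open>s\<^sup>2 = a r \<in> m\<close>, a contradiction.

  \<^emph>\<open>Finitistic dimension.\<close> It suffices that in an exact sequence \<open>0 \<rightarrow> K \<rightarrow> B \<rightarrow> C\<close> of finitely
  generated projective modules the submodule \<open>K\<close> is a direct summand of \<open>B\<close>: then a finite resolution
  can be shortened from the left until its length is at most one. Let first \<open>K\<close> be free and \<open>v\<close> a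
  vector of a basis of \<open>K\<close>. The values at \<open>v\<close> of the functionals on \<open>B\<close> form a finitely generated dense
  ideal. If it were contained in \<open>m\<close>, then with \<open>a\<close> and \<open>s\<close> as above all coordinates of \<open>s v\<close> are
  multiples of \<open>a\<close>, say \<open>s v = a w\<close> with \<open>w \<in> B\<close>. The image of \<open>w\<close> in \<open>C\<close> is killed by \<open>a\<close>, hence by
  \<open>s\<close>, so \<open>s w \<in> K\<close>; comparing the coordinates at \<open>v\<close> in \<open>a (s w) = s\<^sup>2 v\<close> gives \<open>s\<^sup>2 \<in> a R \<subseteq> m\<close>, a
  contradiction. So some functional on \<open>B\<close> takes the value \<open>1\<close> at \<open>v\<close>
  (\<open>strong_Prufer_unimodular\<close>), which splits off the summand generated by \<open>v\<close>, and induction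
  on the rank splits off \<open>K\<close> (\<open>strong_Prufer_free_retract\<close>). A projective \<open>K\<close> is reduced to this
  case by adding a complement of \<open>K\<close> to both \<open>K\<close> and \<open>B\<close>
  (\<open>strong_Prufer_projective_retract\<close>).

  Finitely generated projective modules enter only through finite dual bases: finitely many elements
  \<open>b i\<close> and functionals \<open>f i\<close> with \<open>x = (\<Sum>i. f i x b i)\<close> for all \<open>x\<close>.\<close>

section \<open>Local generators of dense ideals\<close>

lemma (in cring) exists_maximal_ideal_above:
  assumes I: "ideal I R" and proper: "\<one> \<notin> I"
  shows "\<exists>m. maximalideal m R \<and> I \<subseteq> m"
proof -
  let ?S = "{J. ideal J R \<and> I \<subseteq> J \<and> \<one> \<notin> J}"
  have "\<exists>m\<in>?S. \<forall>J\<in>?S. m \<subseteq> J \<longrightarrow> J = m"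
  proof (rule subset_Zorn)
    fix C assume C: "subset.chain ?S C"
    show "\<exists>U\<in>?S. \<forall>J\<in>C. J \<subseteq> U"
    proof (cases "C = {}")
      case True
      then show ?thesis using I proper by auto
    next
      case False
      have "subset.chain {J. ideal J R} C" using C unfolding pred_on.chain_def by auto
      then have "ideal (\<Union>C) R" using chain_Union_is_ideal[of C] False by simp
      then have "\<Union>C \<in> ?S" using C False unfolding pred_on.chain_def by blast
      then show ?thesis by blast
    qed
  qed
  then obtain m where m: "ideal m R" "I \<subseteq> m" "\<one> \<notin> m"
    and max: "\<forall>J\<in>?S. m \<subseteq> J \<longrightarrow> J = m" by auto
  have "maximalideal m R"
  proof (rule maximalidealI[OF m(1)])
    show "carrier R \<noteq> m" using m(3) by auto
    show "J = m \<or> J = carrier R" if "ideal J R" "m \<subseteq> J" "J \<subseteq> carrier R" for J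
    proof (cases "\<one> \<in> J")
      case True
      then show ?thesis using ideal.one_imp_carrier[OF that(1)] by simp
    next
      case False
      then have "J \<in> ?S" using that m(2) by auto
      then show ?thesis using max that(2) by simp
    qed
  qed
  then show ?thesis using m(2) by blast
qed

lemma (in cring) mult_minus_eq_zeroD:
  assumes "u \<otimes> (x \<ominus> y) = \<zero>" "u \<in> carrier R" "x \<in> carrier R" "y \<in> carrier R"
  shows "u \<otimes> x = u \<otimes> y"
proof -
  have "u \<otimes> x \<ominus> u \<otimes> y = \<zero>" using assms by (simp add: minus_eq r_distr r_minus)
  then show ?thesis using assms by simp
qed

lemma (in cring) fraction_iff:
  "(r', s') \<in> fraction R S r s \<longleftrightarrow>
    r' \<in> carrier R \<and> s' \<in> S \<and> (\<exists>u\<in>S. u \<otimes> (r \<otimes> s' \<ominus> r' \<otimes> s) = \<zero>)"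
  by (simp add: fraction_def)

lemma (in cring) fraction_self:
  assumes "r \<in> carrier R" "s \<in> S" "S \<subseteq> carrier R" "S \<noteq> {}"
  shows "(r, s) \<in> fraction R S r s"
proof -
  have "r \<otimes> s \<ominus> r \<otimes> s = \<zero>" using assms by (auto simp: r_neg minus_eq)
  then show ?thesis using assms by (fastforce simp: fraction_iff)
qed

text \<open>Commutativity makes an ideal of the localization that is generated by one element the set of multiples
  of this element. The product is a union over all pairs of representatives, so exchanging the factors
  only exchanges the order of the unions.\<close>

lemma (in cring) localization_mult_comm:
  assumes "S \<subseteq> carrier R" "B \<in> carrier (localization R S)" "C \<in> carrier (localization R S)"
  shows "B \<otimes>\<^bsub>localization R S\<^esub> C = C \<otimes>\<^bsub>localization R S\<^esub> B"
proof -
  have *: "r \<in> carrier R \<and> s \<in> carrier R" if "(r, s) \<in> B \<or> (r, s) \<in> C" for r s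
    using assms that by (auto simp: localization_def fraction_iff)
  have "B \<otimes>\<^bsub>localization R S\<^esub> C =
      (\<Union>(r, s)\<in>B. \<Union>(r', s')\<in>C. fraction R S (r' \<otimes> r) (s' \<otimes> s))"
    unfolding localization_def using *
    by (auto intro!: SUP_cong arg_cong2[where f = "fraction R S"] m_comm)
  also have "\<dots> = C \<otimes>\<^bsub>localization R S\<^esub> B"
    by (auto simp: localization_def)
  finally show ?thesis .
qed

text \<open>A generator of the localized ideal may be taken to be the numerator \<open>a\<close> of a fraction. Writing the
  image of \<open>x\<close> as a multiple of this fraction and clearing denominators gives the relation between
  \<open>x\<close> and \<open>a\<close> in \<open>R\<close> itself; here \<open>s\<close> and \<open>t\<close> still depend on \<open>x\<close>.\<close>

lemma (in cring) principal_localized_ideal_generator: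
  assumes S: "S \<subseteq> carrier R" "\<one> \<in> S" "\<And>s t. s \<in> S \<Longrightarrow> t \<in> S \<Longrightarrow> s \<otimes> t \<in> S"
    and J: "J \<subseteq> carrier R"
    and princ: "principalideal (localized_ideal R S J) (localization R S)"
  shows "\<exists>a\<in>J. \<forall>x\<in>J. \<exists>s\<in>S. \<exists>t\<in>carrier R. s \<otimes> x = t \<otimes> a"
proof -
  let ?L = "localization R S"
  interpret L: principalideal "localized_ideal R S J" ?L by fact
  have "cring ?L"
    by (intro cring.intro L.ring_axioms comm_monoid.intro comm_monoid_axioms.intro
        L.monoid_axioms localization_mult_comm S)
  then obtain g where g: "g \<in> localized_ideal R S J" "localized_ideal R S J = carrier ?L #>\<^bsub>?L\<^esub> g"
    using L.rcos_generate by blast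
  then obtain a u where a: "a \<in> J" and u: "u \<in> S" and g_eq: "g = fraction R S a u"
    by (auto simp: localized_ideal_def)
  have "\<exists>s\<in>S. \<exists>t\<in>carrier R. s \<otimes> x = t \<otimes> a" if x: "x \<in> J" for x
  proof -
    have "fraction R S x \<one> \<in> carrier ?L #>\<^bsub>?L\<^esub> g"
      using g(2) x S(2) by (auto simp: localized_ideal_def)
    then obtain c where c: "c \<in> carrier ?L" "fraction R S x \<one> = c \<otimes>\<^bsub>?L\<^esub> g"
      by (auto simp: r_coset_def)
    have "(x, \<one>) \<in> fraction R S x \<one>" 
      by (rule fraction_self) (use S x J in auto)
    then have "(x, \<one>) \<in> c \<otimes>\<^bsub>?L\<^esub> g" using c by simp
    then obtain r s r' s' where rs: "(r, s) \<in> c" "(r', s') \<in> g"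
      and "(x, \<one>) \<in> fraction R S (r \<otimes> r') (s \<otimes> s')"
      by (auto simp: localization_def)
    then obtain w where w: "w \<in> S" "w \<otimes> (r \<otimes> r' \<otimes> \<one> \<ominus> x \<otimes> (s \<otimes> s')) = \<zero>"
      by (auto simp: fraction_iff)
    obtain v where v: "v \<in> S" "v \<otimes> (a \<otimes> s' \<ominus> r' \<otimes> u) = \<zero>" and r's': "r' \<in> carrier R" "s' \<in> S"
      using rs(2) by (auto simp: g_eq fraction_iff)
    have "r \<in> carrier R" "s \<in> S" using c(1) rs(1) by (auto simp: localization_def fraction_iff)
    note cl = this r's' v(1) w(1) u
    note cR = cl(1,3) set_mp[OF S(1) cl(2)] set_mp[OF S(1) cl(4)] set_mp[OF S(1) cl(5)]
      set_mp[OF S(1) cl(6)] set_mp[OF S(1) cl(7)] set_mp[OF J x] set_mp[OF J a]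
    have 1: "w \<otimes> (r \<otimes> r') = w \<otimes> (x \<otimes> (s \<otimes> s'))"
      using mult_minus_eq_zeroD[OF w(2)] cR by simp
    have 2: "v \<otimes> (r' \<otimes> u) = v \<otimes> (a \<otimes> s')"
      using mult_minus_eq_zeroD[OF v(2)] cR by simp
    have "(v \<otimes> u \<otimes> w \<otimes> s \<otimes> s') \<otimes> x = v \<otimes> u \<otimes> (w \<otimes> (x \<otimes> (s \<otimes> s')))"
      using cR by (simp add: m_ac)
    also have "\<dots> = v \<otimes> u \<otimes> (w \<otimes> (r \<otimes> r'))" by (simp only: 1)
    also have "\<dots> = w \<otimes> r \<otimes> (v \<otimes> (r' \<otimes> u))" using cR by (simp add: m_ac)
    also have "\<dots> = w \<otimes> r \<otimes> (v \<otimes> (a \<otimes> s'))" by (simp only: 2)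
    also have "\<dots> = (w \<otimes> r \<otimes> v \<otimes> s') \<otimes> a" using cR by (simp add: m_ac)
    finally have "(v \<otimes> u \<otimes> w \<otimes> s \<otimes> s') \<otimes> x = (w \<otimes> r \<otimes> v \<otimes> s') \<otimes> a" .
    moreover have "v \<otimes> u \<otimes> w \<otimes> s \<otimes> s' \<in> S" by (intro S(3) cl)
    moreover have "w \<otimes> r \<otimes> v \<otimes> s' \<in> carrier R" using cR by simp
    ultimately show ?thesis by blast
  qed
  then show ?thesis using a by blast
qed

text \<open>Being an ideal, this set is all of \<open>J\<close> as soon as it contains generators of \<open>J\<close>. So one denominator
  \<open>s\<close> that serves finitely many generators serves every element of \<open>J\<close>.\<close>

lemma (in cring) multiplier_ideal:
  assumes "ideal J R" "a \<in> carrier R" "s \<in> carrier R"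
  shows "ideal {x \<in> J. \<exists>t\<in>carrier R. s \<otimes> x = t \<otimes> a} R"
proof -
  interpret J: ideal J R by fact
  show ?thesis
  proof (rule idealI[OF ring_axioms])
    show "subgroup {x \<in> J. \<exists>t\<in>carrier R. s \<otimes> x = t \<otimes> a} (add_monoid R)"
    proof (rule add.subgroupI)
      show "{x \<in> J. \<exists>t\<in>carrier R. s \<otimes> x = t \<otimes> a} \<noteq> {}"
        using assms J.zero_closed by (auto intro!: exI[of _ "\<zero>"] bexI[of _ "\<zero>"])
    next
      fix x assume "x \<in> {x \<in> J. \<exists>t\<in>carrier R. s \<otimes> x = t \<otimes> a}"
      then obtain t where "x \<in> J" "t \<in> carrier R" "s \<otimes> x = t \<otimes> a" by blast
      then show "\<ominus> x \<in> {x \<in> J. \<exists>t\<in>carrier R. s \<otimes> x = t \<otimes> a}"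
        using assms J.Icarr by (auto intro!: bexI[of _ "\<ominus> t"] simp: r_minus l_minus)
    next
      fix x y assume "x \<in> {x \<in> J. \<exists>t\<in>carrier R. s \<otimes> x = t \<otimes> a}" "y \<in> {x \<in> J. \<exists>t\<in>carrier R. s \<otimes> x = t \<otimes> a}"
      then obtain t t' where "x \<in> J" "t \<in> carrier R" "s \<otimes> x = t \<otimes> a"
        "y \<in> J" "t' \<in> carrier R" "s \<otimes> y = t' \<otimes> a" by blast
      then show "x \<oplus> y \<in> {x \<in> J. \<exists>t\<in>carrier R. s \<otimes> x = t \<otimes> a}"
        using assms J.Icarr by (auto intro!: bexI[of _ "t \<oplus> t'"] simp: r_distr l_distr)
    qed (use J.Icarr in auto)
  next
    fix x r assume "x \<in> {x \<in> J. \<exists>t\<in>carrier R. s \<otimes> x = t \<otimes> a}" and r: "r \<in> carrier R"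
    then obtain t where t: "x \<in> J" "t \<in> carrier R" "s \<otimes> x = t \<otimes> a" by blast
    have "s \<otimes> (r \<otimes> x) = r \<otimes> (s \<otimes> x)" using assms r t J.Icarr by (simp add: m_ac)
    also have "\<dots> = (r \<otimes> t) \<otimes> a" using assms r t by (simp add: m_ac)
    finally show *: "r \<otimes> x \<in> {x \<in> J. \<exists>t\<in>carrier R. s \<otimes> x = t \<otimes> a}"
      using assms r t J.I_l_closed by blast
    then show "x \<otimes> r \<in> {x \<in> J. \<exists>t\<in>carrier R. s \<otimes> x = t \<otimes> a}"
      using r t J.Icarr by (simp add: m_comm)
  qed
qed

text \<open>The last conclusion holds because \<open>r a = 0\<close> gives \<open>(r s) x = r t a = 0\<close> for all \<open>x \<in> J\<close>, and \<open>J\<close> is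
  dense.\<close>

lemma strong_Prufer_local_generator:
  fixes R (structure)
  assumes SP: "strong_Prufer_ring R" and fg: "fg_ideal R J" and dense: "dense_ideal R J"
    and m: "maximalideal m R"
  obtains a s where "a \<in> J" "s \<in> carrier R - m"
    "\<And>x. x \<in> J \<Longrightarrow> \<exists>t\<in>carrier R. s \<otimes> x = t \<otimes> a"
    "\<And>r. r \<in> carrier R \<Longrightarrow> r \<otimes> a = \<zero> \<Longrightarrow> r \<otimes> s = \<zero>"
proof -
  interpret cring R using SP by (simp add: strong_Prufer_ring_def)
  interpret m: primeideal m R using maximalideal_prime[OF m] .
  let ?S = "carrier R - m"
  have idJ: "ideal J R" using dense by (simp add: dense_ideal_def)
  interpret J: ideal J R by fact
  have "locally_principal R J"
    using SP fg dense by (auto simp: strong_Prufer_ring_def semiregular_ideal_def dense_ideal_def)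
  then have princ: "principalideal (localized_ideal R ?S J) (localization R ?S)"
    using m by (simp add: locally_principal_def)
  have one: "\<one> \<in> ?S" using m.one_imp_carrier m.I_notcarr by auto
  have mult: "s \<otimes> t \<in> ?S" if "s \<in> ?S" "t \<in> ?S" for s t
    using that m.I_prime[of s t] by auto
  obtain a where a: "a \<in> J" "\<And>x. x \<in> J \<Longrightarrow> \<exists>s\<in>?S. \<exists>t\<in>carrier R. s \<otimes> x = t \<otimes> a"
    using principal_localized_ideal_generator[OF _ one mult J.a_subset princ] by blast
  obtain A where A: "finite A" "A \<subseteq> carrier R" "J = Idl A" using fg by (auto simp: fg_ideal_def)
  \<comment> \<open>a common denominator for finitely many elements: the product of the individual ones\<close>
  have "B \<subseteq> J \<Longrightarrow> \<exists>s\<in>?S. \<forall>x\<in>B. \<exists>t\<in>carrier R. s \<otimes> x = t \<otimes> a" if "finite B" for B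
    using that
  proof induction
    case empty
    then show ?case using one by blast
  next
    case (insert y B)
    then obtain s where s: "s \<in> ?S" "\<And>x. x \<in> B \<Longrightarrow> \<exists>t\<in>carrier R. s \<otimes> x = t \<otimes> a" by auto
    obtain s' where s': "s' \<in> ?S" "\<exists>t\<in>carrier R. s' \<otimes> y = t \<otimes> a"
      using a(2)[of y] insert.prems by blast
    have *: "\<exists>t\<in>carrier R. (p \<otimes> q) \<otimes> x = t \<otimes> a" if pqx: "p \<in> carrier R" "q \<in> carrier R" "x \<in> J"
      "\<exists>t\<in>carrier R. q \<otimes> x = t \<otimes> a" for p q x
    proof -
      obtain t where t: "t \<in> carrier R" "q \<otimes> x = t \<otimes> a" using pqx(4) by blast
      have "(p \<otimes> q) \<otimes> x = p \<otimes> (t \<otimes> a)"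
        using pqx(1,2) J.Icarr[OF pqx(3)] by (simp add: m_assoc t(2))
      then show ?thesis
        using pqx(1) t(1) J.Icarr[OF a(1)] by (intro bexI[of _ "p \<otimes> t"]) (simp_all add: m_assoc)
    qed
    have "\<exists>t\<in>carrier R. (s \<otimes> s') \<otimes> x = t \<otimes> a" if "x \<in> insert y B" for x
    proof (cases "x = y")
      case True
      have "y \<in> J" using insert.prems by simp
      then show ?thesis unfolding True using s(1) s' by (intro *[of s s' y]) simp_all
    next
      case False
      then have x: "x \<in> B" "x \<in> J" using that insert.prems by auto
      have "\<exists>t\<in>carrier R. (s' \<otimes> s) \<otimes> x = t \<otimes> a"
        using s(1) s(2)[OF x(1)] s'(1) x(2) by (intro *[of s' s x]) simp_all
      then show ?thesis using m_comm[of s s'] s(1) s'(1) by simp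
    qed
    then show ?case using mult s(1) s'(1) by blast
  qed
  then obtain s where s: "s \<in> ?S" "\<forall>x\<in>A. \<exists>t\<in>carrier R. s \<otimes> x = t \<otimes> a"
    using A(1,3) genideal_self[OF A(2)] by blast
  let ?T = "{x \<in> J. \<exists>t\<in>carrier R. s \<otimes> x = t \<otimes> a}"
  have "J \<subseteq> ?T" unfolding A(3)
    by (rule genideal_minimal)
      (use multiplier_ideal[OF idJ] a(1) s J.Icarr A genideal_self[OF A(2)] in auto)
  then have sJ: "\<exists>t\<in>carrier R. s \<otimes> x = t \<otimes> a" if "x \<in> J" for x using that by blast
  have regular: "r \<otimes> s = \<zero>" if r: "r \<in> carrier R" "r \<otimes> a = \<zero>" for r
  proof -
    have "x \<otimes> (r \<otimes> s) = \<zero>" if x: "x \<in> J" for x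
    proof -
      obtain t where t: "t \<in> carrier R" "s \<otimes> x = t \<otimes> a" using sJ[OF x] by blast
      have "x \<otimes> (r \<otimes> s) = r \<otimes> (s \<otimes> x)" using r s(1) x J.Icarr by (simp add: m_ac)
      also have "\<dots> = r \<otimes> (t \<otimes> a)" by (simp only: t(2))
      also have "\<dots> = t \<otimes> (r \<otimes> a)" using r(1) t(1) J.Icarr[OF a(1)] by (simp add: m_lcomm)
      finally show ?thesis using r t by simp
    qed
    then have "r \<otimes> s \<in> annihilator R J" using r s(1) by (auto simp: annihilator_def)
    then show ?thesis using dense by (simp add: dense_ideal_def)
  qed
  show thesis by (rule that[OF a(1) s(1) sJ regular])
qed


section \<open>Linear maps, functionals and dual bases\<close>

lemma regular_module_simps [simp]:
  "carrier (regular_module R) = carrier R"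
  "\<zero>\<^bsub>regular_module R\<^esub> = \<zero>\<^bsub>R\<^esub>"
  "x \<oplus>\<^bsub>regular_module R\<^esub> y = x \<oplus>\<^bsub>R\<^esub> y"
  "x \<odot>\<^bsub>regular_module R\<^esub> y = x \<otimes>\<^bsub>R\<^esub> y"
  by (simp_all add: regular_module_def)

lemma (in cring) regular_module_module: "module R (regular_module R)"
proof -
  have "abelian_group (regular_module R)"
    by (rule abelian_groupI) (auto simp: a_ac intro!: bexI[where x = "\<ominus> x" for x] l_neg)
  then show ?thesis
    by (intro moduleI is_cring) (auto simp: l_distr r_distr m_assoc)
qed

lemma (in cring) finsum_regular_module:
  assumes "f \<in> A \<rightarrow> carrier R"
  shows "finsum (regular_module R) f A = finsum R f A"
proof -
  interpret S: module R "regular_module R" by (rule regular_module_module)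
  show ?thesis using assms
    by (induction A rule: infinite_finite_induct) (simp_all add: S.M.finsum_infinite)
qed

text \<open>In contrast to \<^const>\<open>module_hom\<close>, the maps are not required to be extensional, so that sums, multiples
  and compositions can be formed directly. The domain is a subset \<open>K\<close> of the module \<open>M\<close>; for a
  submodule this replaces a record with a smaller carrier.\<close>

definition linear_on ::
    "('a, 'r) ring_scheme \<Rightarrow> ('a, 'm, 'c) module_scheme \<Rightarrow> 'm set \<Rightarrow> ('a, 'n, 'd) module_scheme
      \<Rightarrow> ('m \<Rightarrow> 'n) \<Rightarrow> bool"
  where "linear_on R M K N f \<longleftrightarrow>
    (\<forall>x\<in>K. f x \<in> carrier N) \<and>
    (\<forall>x\<in>K. \<forall>y\<in>K. f (x \<oplus>\<^bsub>M\<^esub> y) = f x \<oplus>\<^bsub>N\<^esub> f y) \<and>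
    (\<forall>a\<in>carrier R. \<forall>x\<in>K. f (a \<odot>\<^bsub>M\<^esub> x) = a \<odot>\<^bsub>N\<^esub> f x)"

abbreviation functional_on ::
    "('a, 'r) ring_scheme \<Rightarrow> ('a, 'm, 'c) module_scheme \<Rightarrow> 'm set \<Rightarrow> ('m \<Rightarrow> 'a) \<Rightarrow> bool"
  where "functional_on R M K f \<equiv> linear_on R M K (regular_module R) f"

lemma linear_onI:
  assumes "\<And>x. x \<in> K \<Longrightarrow> f x \<in> carrier N"
    and "\<And>x y. x \<in> K \<Longrightarrow> y \<in> K \<Longrightarrow> f (x \<oplus>\<^bsub>M\<^esub> y) = f x \<oplus>\<^bsub>N\<^esub> f y"
    and "\<And>a x. a \<in> carrier R \<Longrightarrow> x \<in> K \<Longrightarrow> f (a \<odot>\<^bsub>M\<^esub> x) = a \<odot>\<^bsub>N\<^esub> f x"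
  shows "linear_on R M K N f"
  using assms by (simp add: linear_on_def)

lemma linear_on_closed: "linear_on R M K N f \<Longrightarrow> x \<in> K \<Longrightarrow> f x \<in> carrier N"
  and linear_on_add: "linear_on R M K N f \<Longrightarrow> x \<in> K \<Longrightarrow> y \<in> K \<Longrightarrow> f (x \<oplus>\<^bsub>M\<^esub> y) = f x \<oplus>\<^bsub>N\<^esub> f y"
  and linear_on_smult: "linear_on R M K N f \<Longrightarrow> a \<in> carrier R \<Longrightarrow> x \<in> K \<Longrightarrow> f (a \<odot>\<^bsub>M\<^esub> x) = a \<odot>\<^bsub>N\<^esub> f x"
  by (simp_all add: linear_on_def)

lemma module_hom_linear_on: "f \<in> module_hom R M N \<Longrightarrow> linear_on R M (carrier M) N f"
  by (auto simp: module_hom_def linear_on_def)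

lemma linear_on_subset: "linear_on R M K N f \<Longrightarrow> K' \<subseteq> K \<Longrightarrow> linear_on R M K' N f"
  unfolding linear_on_def by blast

lemma linear_on_module_hom:
  assumes "module R M" "linear_on R M (carrier M) N f"
  shows "restrict f (carrier M) \<in> module_hom R M N"
proof -
  interpret module R M by fact
  show ?thesis using assms(2) by (simp add: module_hom_def linear_on_def)
qed

lemma linear_on_zero:
  assumes "module R M" "module R N" "submodule K R M" "linear_on R M K N f"
  shows "f \<zero>\<^bsub>M\<^esub> = \<zero>\<^bsub>N\<^esub>"
proof -
  interpret M: module R M by fact
  interpret N: module R N by fact
  interpret K: submodule K R M by fact
  have z: "\<zero>\<^bsub>M\<^esub> \<in> K" using K.one_closed by simp
  have "f (\<zero>\<^bsub>R\<^esub> \<odot>\<^bsub>M\<^esub> \<zero>\<^bsub>M\<^esub>) = \<zero>\<^bsub>R\<^esub> \<odot>\<^bsub>N\<^esub> f \<zero>\<^bsub>M\<^esub>"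
    using linear_on_smult[OF assms(4) _ z] by simp
  then show ?thesis using linear_on_closed[OF assms(4) z] by simp
qed

lemma submodule_zero: "submodule K R M \<Longrightarrow> \<zero>\<^bsub>M\<^esub> \<in> K"
  using subgroup.one_closed[OF submodule.axioms(1)] by fastforce

lemma submodule_add: "submodule K R M \<Longrightarrow> x \<in> K \<Longrightarrow> y \<in> K \<Longrightarrow> x \<oplus>\<^bsub>M\<^esub> y \<in> K"
  using subgroup.m_closed[OF submodule.axioms(1)] by fastforce

lemma submodule_smult: "submodule K R M \<Longrightarrow> a \<in> carrier R \<Longrightarrow> x \<in> K \<Longrightarrow> a \<odot>\<^bsub>M\<^esub> x \<in> K"
  by (rule submodule.smult_closed)

lemma submodule_subset: "submodule K R M \<Longrightarrow> K \<subseteq> carrier M"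
  using subgroup.subset[OF submodule.axioms(1)] by fastforce

lemma (in module) submodule_finsum:
  assumes "submodule K R M" "finite A" "c \<in> A \<rightarrow> K"
  shows "(\<Oplus>\<^bsub>M\<^esub>i\<in>A. c i) \<in> K"
  using assms(2,3)
proof induction
  case (insert a A)
  then have "c \<in> A \<rightarrow> carrier M" "c a \<in> carrier M" using submodule_subset[OF assms(1)] by auto
  then show ?case using insert submodule_add[OF assms(1)] by simp
qed (simp add: submodule_zero[OF assms(1)])

lemma linear_on_finsum:
  assumes "module R M" "module R N" "submodule K R M" "linear_on R M K N f" "finite A" "c \<in> A \<rightarrow> K"
  shows "f (\<Oplus>\<^bsub>M\<^esub>i\<in>A. c i) = (\<Oplus>\<^bsub>N\<^esub>i\<in>A. f (c i))"
proof -
  interpret M: module R M by fact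
  interpret N: module R N by fact
  show ?thesis using assms(5,6)
  proof induction
    case empty
    then show ?case using linear_on_zero[OF assms(1-4)] by simp
  next
    case (insert a A)
    have c: "c \<in> A \<rightarrow> K" "c a \<in> K" using insert.prems by auto
    then have cM: "c \<in> A \<rightarrow> carrier M" "c a \<in> carrier M" using submodule_subset[OF assms(3)] by auto
    have "(\<Oplus>\<^bsub>M\<^esub>i\<in>A. c i) \<in> K" using M.submodule_finsum[OF assms(3) insert.hyps(1) c(1)] .
    then have "f (c a \<oplus>\<^bsub>M\<^esub> (\<Oplus>\<^bsub>M\<^esub>i\<in>A. c i)) = f (c a) \<oplus>\<^bsub>N\<^esub> f (\<Oplus>\<^bsub>M\<^esub>i\<in>A. c i)"
      using linear_on_add[OF assms(4) c(2)] by blast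
    moreover have "(\<lambda>i. f (c i)) \<in> A \<rightarrow> carrier N" "f (c a) \<in> carrier N"
      using c linear_on_closed[OF assms(4)] by auto
    ultimately show ?case using insert.hyps insert.IH[OF c(1)] cM by simp
  qed
qed

lemma linear_on_comp:
  assumes "linear_on R M K N f" "\<And>x. x \<in> K \<Longrightarrow> f x \<in> L" "linear_on R N L Q g"
  shows "linear_on R M K Q (\<lambda>x. g (f x))"
  using assms unfolding linear_on_def by simp

lemma linear_on_plus:
  assumes "module R N" "linear_on R M K N f" "linear_on R M K N g"
  shows "linear_on R M K N (\<lambda>x. f x \<oplus>\<^bsub>N\<^esub> g x)"
proof -
  interpret N: module R N by fact
  show ?thesis using assms(2,3) by (simp add: linear_on_def N.M.a_ac N.smult_r_distr)
qed

lemma linear_on_scale: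
  assumes "module R N" "linear_on R M K N f" "a \<in> carrier R"
  shows "linear_on R M K N (\<lambda>x. a \<odot>\<^bsub>N\<^esub> f x)"
proof -
  interpret N: module R N by fact
  have "a \<odot>\<^bsub>N\<^esub> (b \<odot>\<^bsub>N\<^esub> f x) = b \<odot>\<^bsub>N\<^esub> (a \<odot>\<^bsub>N\<^esub> f x)" if "b \<in> carrier R" "x \<in> K" for b x
    using that assms(3) linear_on_closed[OF assms(2)] N.smult_assoc1[symmetric]
    by (simp add: N.R.m_comm)
  then show ?thesis using assms(2,3) by (simp add: linear_on_def N.smult_r_distr)
qed

lemma linear_on_functional_smult:
  assumes "module R N" "functional_on R M K h" "v \<in> carrier N"
  shows "linear_on R M K N (\<lambda>x. h x \<odot>\<^bsub>N\<^esub> v)"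
proof -
  interpret N: module R N by fact
  show ?thesis using assms(2,3) by (simp add: linear_on_def N.smult_l_distr N.smult_assoc1)
qed

lemma linear_on_zero_map:
  assumes "module R N"
  shows "linear_on R M K N (\<lambda>x. \<zero>\<^bsub>N\<^esub>)"
proof -
  interpret N: module R N by fact
  show ?thesis by (simp add: linear_on_def)
qed

lemma linear_on_sum:
  assumes "module R N" "finite I" "\<And>i. i \<in> I \<Longrightarrow> linear_on R M K N (f i)"
  shows "linear_on R M K N (\<lambda>x. \<Oplus>\<^bsub>N\<^esub>i\<in>I. f i x)"
proof -
  interpret N: module R N by fact
  have cl: "(\<lambda>i. f i x) \<in> I \<rightarrow> carrier N" if "x \<in> K" for x
    using linear_on_closed[OF assms(3) that] by simp
  show ?thesis
  proof (rule linear_onI)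
    show "(\<Oplus>\<^bsub>N\<^esub>i\<in>I. f i x) \<in> carrier N" if "x \<in> K" for x
      using cl[OF that] by (rule N.finsum_closed)
    show "(\<Oplus>\<^bsub>N\<^esub>i\<in>I. f i (x \<oplus>\<^bsub>M\<^esub> y)) = (\<Oplus>\<^bsub>N\<^esub>i\<in>I. f i x) \<oplus>\<^bsub>N\<^esub> (\<Oplus>\<^bsub>N\<^esub>i\<in>I. f i y)"
      if "x \<in> K" "y \<in> K" for x y
    proof -
      have "(\<Oplus>\<^bsub>N\<^esub>i\<in>I. f i (x \<oplus>\<^bsub>M\<^esub> y)) = (\<Oplus>\<^bsub>N\<^esub>i\<in>I. f i x \<oplus>\<^bsub>N\<^esub> f i y)"
        using that cl assms(3) by (intro N.finsum_cong') (auto simp: linear_on_def)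
      then show ?thesis using N.finsum_addf[OF cl[OF that(1)] cl[OF that(2)]] by simp
    qed
    show "(\<Oplus>\<^bsub>N\<^esub>i\<in>I. f i (a \<odot>\<^bsub>M\<^esub> x)) = a \<odot>\<^bsub>N\<^esub> (\<Oplus>\<^bsub>N\<^esub>i\<in>I. f i x)"
      if "a \<in> carrier R" "x \<in> K" for a x
    proof -
      have "(\<Oplus>\<^bsub>N\<^esub>i\<in>I. f i (a \<odot>\<^bsub>M\<^esub> x)) = (\<Oplus>\<^bsub>N\<^esub>i\<in>I. a \<odot>\<^bsub>N\<^esub> f i x)"
        using that cl assms(3) by (intro N.finsum_cong') (auto simp: linear_on_def)
      then show ?thesis using N.finsum_smult_ldistr[OF assms(2) that(1) cl[OF that(2)]] by simp
    qed
  qed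
qed

text \<open>The kernel of a linear map into a finitely generated projective module is a common kernel of
  functionals. In this form the target of the map can be forgotten, and cutting down the kernel by one
  more functional is again a common kernel.\<close>

definition common_kernel ::
    "('a, 'r) ring_scheme \<Rightarrow> ('a, 'm, 'c) module_scheme \<Rightarrow> ('m \<Rightarrow> 'a) set \<Rightarrow> 'm set"
  where "common_kernel R M H = {x \<in> carrier M. \<forall>h\<in>H. h x = \<zero>\<^bsub>R\<^esub>}"

lemma linear_kernel_submodule:
  assumes "module R M" "module R N" "linear_on R M (carrier M) N f"
  shows "submodule {x \<in> carrier M. f x = \<zero>\<^bsub>N\<^esub>} R M"
proof -
  interpret M: module R M by fact
  interpret N: module R N by fact
  show ?thesis
  proof (rule M.submoduleI)
    show "\<zero>\<^bsub>M\<^esub> \<in> {x \<in> carrier M. f x = \<zero>\<^bsub>N\<^esub>}"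
      using linear_on_zero[OF assms(1,2) M.carrier_is_submodule assms(3)] by simp
    show "\<ominus>\<^bsub>M\<^esub> a \<in> {x \<in> carrier M. f x = \<zero>\<^bsub>N\<^esub>}" if a: "a \<in> {x \<in> carrier M. f x = \<zero>\<^bsub>N\<^esub>}" for a
    proof -
      have "f ((\<ominus>\<^bsub>R\<^esub> \<one>\<^bsub>R\<^esub>) \<odot>\<^bsub>M\<^esub> a) = (\<ominus>\<^bsub>R\<^esub> \<one>\<^bsub>R\<^esub>) \<odot>\<^bsub>N\<^esub> f a"
        using a linear_on_smult[OF assms(3)] by simp
      then show ?thesis using a by (simp add: M.smult_l_minus)
    qed
  qed (use assms(3) in \<open>auto simp: linear_on_def\<close>)
qed

lemma common_kernel_submodule:
  assumes "module R M" "\<And>h. h \<in> H \<Longrightarrow> functional_on R M (carrier M) h"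
  shows "submodule (common_kernel R M H) R M"
proof -
  interpret M: module R M by fact
  have ker: "submodule {x \<in> carrier M. h x = \<zero>\<^bsub>R\<^esub>} R M" if "h \<in> H" for h
    using linear_kernel_submodule[OF assms(1) M.R.regular_module_module assms(2)[OF that]] by simp
  have mem: "x \<in> {x \<in> carrier M. h x = \<zero>\<^bsub>R\<^esub>}" if "x \<in> common_kernel R M H" "h \<in> H" for x h
    using that by (simp add: common_kernel_def)
  show ?thesis
  proof (rule M.submoduleI)
    show "common_kernel R M H \<subseteq> carrier M" by (auto simp: common_kernel_def)
    show "\<zero>\<^bsub>M\<^esub> \<in> common_kernel R M H"
      using submodule_zero[OF ker] by (simp add: common_kernel_def)
    show "\<ominus>\<^bsub>M\<^esub> x \<in> common_kernel R M H" if "x \<in> common_kernel R M H" for x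
      using M.submoduleE(3)[OF ker mem[OF that]] that by (simp add: common_kernel_def)
    show "x \<oplus>\<^bsub>M\<^esub> y \<in> common_kernel R M H"
      if "x \<in> common_kernel R M H" "y \<in> common_kernel R M H" for x y
      using submodule_add[OF ker mem[OF that(1)] mem[OF that(2)]] that by (simp add: common_kernel_def)
    show "a \<odot>\<^bsub>M\<^esub> x \<in> common_kernel R M H" if "a \<in> carrier R" "x \<in> common_kernel R M H" for a x
      using submodule_smult[OF ker that(1) mem[OF that(2)]] that by (simp add: common_kernel_def)
  qed
qed

text \<open>A submodule with a finite dual basis is a finitely generated projective module.\<close>

definition dual_basis ::
    "('a, 'r) ring_scheme \<Rightarrow> ('a, 'm, 'c) module_scheme \<Rightarrow> 'm set \<Rightarrow> 'i set \<Rightarrow> ('i \<Rightarrow> 'm) \<Rightarrow> ('i \<Rightarrow> 'm \<Rightarrow> 'a) \<Rightarrow> bool"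
  where "dual_basis R M K I b f \<longleftrightarrow> finite I \<and>
    (\<forall>i\<in>I. b i \<in> K \<and> functional_on R M K (f i)) \<and>
    (\<forall>x\<in>K. x = (\<Oplus>\<^bsub>M\<^esub>i\<in>I. f i x \<odot>\<^bsub>M\<^esub> b i))"

lemma dual_basisD:
  assumes "dual_basis R M K I b f"
  shows "finite I" "i \<in> I \<Longrightarrow> b i \<in> K" "i \<in> I \<Longrightarrow> functional_on R M K (f i)"
    "x \<in> K \<Longrightarrow> (\<Oplus>\<^bsub>M\<^esub>i\<in>I. f i x \<odot>\<^bsub>M\<^esub> b i) = x"
  using assms by (auto simp: dual_basis_def)


section \<open>Unimodular elements\<close>

lemma (in cring) functional_values_ideal:
  assumes "module R V" and v: "v \<in> carrier V"
  shows "ideal {h v | h. functional_on R V (carrier V) h} R" (is "ideal ?J R")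
proof (rule idealI[OF ring_axioms])
  note reg = regular_module_module
  have J: "h v \<in> ?J" if "functional_on R V (carrier V) h" for h using that by blast
  have cl: "h v \<in> carrier R" if "functional_on R V (carrier V) h" for h
    using linear_on_closed[OF that v] by simp
  have scale: "a \<otimes> h v \<in> ?J" if "functional_on R V (carrier V) h" "a \<in> carrier R" for a h
    using J[OF linear_on_scale[OF reg that]] by simp
  show "subgroup ?J (add_monoid R)"
  proof (rule add.subgroupI)
    show "?J \<subseteq> carrier R" using cl by blast
    show "?J \<noteq> {}" using J[OF linear_on_zero_map[OF reg]] by blast
  next
    fix x assume "x \<in> ?J"
    then obtain h where h: "functional_on R V (carrier V) h" "x = h v" by blast
    have "(\<ominus> \<one>) \<otimes> h v \<in> ?J" using scale[OF h(1)] by simp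
    then show "\<ominus> x \<in> ?J" using cl[OF h(1)] by (simp add: h(2) l_minus)
  next
    fix x y assume "x \<in> ?J" "y \<in> ?J"
    then obtain h k where h: "functional_on R V (carrier V) h" "x = h v"
      and k: "functional_on R V (carrier V) k" "y = k v" by blast
    show "x \<oplus> y \<in> ?J" using J[OF linear_on_plus[OF reg h(1) k(1)]] by (simp add: h(2) k(2))
  qed
  show "a \<otimes> x \<in> ?J" if x: "x \<in> ?J" and a: "a \<in> carrier R" for a x
  proof -
    obtain h where h: "functional_on R V (carrier V) h" "x = h v" using x by blast
    show ?thesis using scale[OF h(1) a] by (simp add: h(2))
  qed
  then show "x \<otimes> a \<in> ?J" if x: "x \<in> ?J" and a: "a \<in> carrier R" for a x
  proof -
    obtain h where h: "functional_on R V (carrier V) h" "x = h v" using x by blast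
    show ?thesis using scale[OF h(1) a] cl[OF h(1)] a by (simp add: h(2) m_comm)
  qed
qed

text \<open>A functional \<open>h\<close> takes at \<open>v = (\<Sum>i. g i v b i)\<close> the value \<open>(\<Sum>i. g i v h (b i))\<close>, so the values of the
  coordinate functionals generate.\<close>

lemma (in cring) functional_values_genideal:
  assumes "module R V" "dual_basis R V (carrier V) I b g" "v \<in> carrier V"
  shows "{h v | h. functional_on R V (carrier V) h} = Idl ((\<lambda>i. g i v) ` I)" (is "?J = Idl ?A")
proof
  note D = dual_basisD[OF assms(2)]
  interpret V: module R V by fact
  have gv: "g i v \<in> carrier R" if "i \<in> I" for i
    using linear_on_closed[OF D(3)[OF that] assms(3)] by simp
  have A: "?A \<subseteq> carrier R" using gv by auto
  interpret A: ideal "Idl ?A" R by (rule genideal_ideal[OF A])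
  show "Idl ?A \<subseteq> ?J"
    by (rule genideal_minimal[OF functional_values_ideal[OF assms(1,3)]]) (use D(3) in blast)
  show "?J \<subseteq> Idl ?A"
  proof
    fix x assume "x \<in> ?J"
    then obtain h where h: "functional_on R V (carrier V) h" "x = h v" by blast
    have hb: "h (b i) \<in> carrier R" if "i \<in> I" for i
      using linear_on_closed[OF h(1) D(2)[OF that]] by simp
    have "h (\<Oplus>\<^bsub>V\<^esub>i\<in>I. g i v \<odot>\<^bsub>V\<^esub> b i) = (\<Oplus>\<^bsub>regular_module R\<^esub>i\<in>I. h (g i v \<odot>\<^bsub>V\<^esub> b i))"
      by (rule linear_on_finsum[OF assms(1) regular_module_module V.carrier_is_submodule h(1) D(1)])
        (use gv D(2) in auto)
    then have "x = (\<Oplus>\<^bsub>regular_module R\<^esub>i\<in>I. h (g i v \<odot>\<^bsub>V\<^esub> b i))"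
      using D(4)[OF assms(3)] h(2) by simp
    moreover have "submodule (Idl ?A) R (regular_module R)"
    proof (rule module.submoduleI[OF regular_module_module])
      fix x assume x: "x \<in> Idl ?A"
      have "\<ominus>\<^bsub>regular_module R\<^esub> x = \<ominus> x"
        using module.smult_l_minus[OF regular_module_module, of \<one> x] A.Icarr[OF x]
          module.smult_one[OF regular_module_module, of x] by (simp add: l_minus)
      then show "\<ominus>\<^bsub>regular_module R\<^esub> x \<in> Idl ?A" using A.a_inv_closed[OF x] by simp
    qed (use A.a_subset A.zero_closed A.a_closed A.I_l_closed in auto)
    moreover have "h (g i v \<odot>\<^bsub>V\<^esub> b i) \<in> Idl ?A" if "i \<in> I" for i
    proof -
      have "h (g i v \<odot>\<^bsub>V\<^esub> b i) = g i v \<otimes> h (b i)"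
        using linear_on_smult[OF h(1) gv[OF that] D(2)[OF that]] by simp
      moreover have "g i v \<in> Idl ?A" using genideal_self[OF A] that by blast
      ultimately show ?thesis using A.I_r_closed hb[OF that] by simp
    qed
    ultimately show "x \<in> Idl ?A"
      using module.submodule_finsum[OF regular_module_module _ D(1)] by simp
  qed
qed

text \<open>The hypotheses are what remains of \<open>v\<close> being a member of a basis of the kernel of the functionals in
  \<open>H\<close>: \<open>faithful\<close> is linear independence, and \<open>coordinate\<close> compares the coordinates at \<open>v\<close> on both sides
  of \<open>a w = r v\<close>.\<close>

lemma strong_Prufer_unimodular:
  fixes R (structure)
  assumes SP: "strong_Prufer_ring R" and V: "module R V"
    and dual: "dual_basis R V (carrier V) I b g"
    and H: "\<And>h. h \<in> H \<Longrightarrow> functional_on R V (carrier V) h"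
    and faithful: "\<And>r. r \<in> carrier R \<Longrightarrow> r \<odot>\<^bsub>V\<^esub> v = \<zero>\<^bsub>V\<^esub> \<Longrightarrow> r = \<zero>"
    and vH: "v \<in> common_kernel R V H"
    and coordinate: "\<And>w a r. w \<in> common_kernel R V H \<Longrightarrow> a \<in> carrier R \<Longrightarrow> r \<in> carrier R \<Longrightarrow>
      a \<odot>\<^bsub>V\<^esub> w = r \<odot>\<^bsub>V\<^esub> v \<Longrightarrow> \<exists>u\<in>carrier R. a \<otimes> u = r"
  shows "\<exists>h. functional_on R V (carrier V) h \<and> h v = \<one>"
proof (rule ccontr)
  assume no: "\<not> ?thesis"
  interpret V: module R V by fact
  have v: "v \<in> carrier V" using vH by (simp add: common_kernel_def)
  note D = dual_basisD[OF dual]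
  note reg = V.R.regular_module_module
  let ?J = "{h v | h. functional_on R V (carrier V) h}"
  have gv: "g i v \<in> carrier R" if "i \<in> I" for i
    using linear_on_closed[OF D(3)[OF that] v] by simp
  have idJ: "ideal ?J R" by (rule V.R.functional_values_ideal[OF V v])
  interpret J: ideal ?J R by (rule idJ)
  have fg: "fg_ideal R ?J"
    unfolding fg_ideal_def V.R.functional_values_genideal[OF V dual v]
    using D(1) gv by (intro exI[of _ "(\<lambda>i. g i v) ` I"]) auto
  have dense: "dense_ideal R ?J"
  proof -
    have "r = \<zero>" if r: "r \<in> annihilator R ?J" for r
    proof -
      have rc: "r \<in> carrier R" using r by (simp add: annihilator_def)
      have gr: "r \<otimes> g i v = \<zero>" if "i \<in> I" for i
      proof -
        have "g i v \<in> ?J" using D(3)[OF that] by blast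
        then have "g i v \<otimes> r = \<zero>" using r unfolding annihilator_def by blast
        then show ?thesis using V.R.m_comm[OF rc gv[OF that]] by simp
      qed
      have "r \<odot>\<^bsub>V\<^esub> v = r \<odot>\<^bsub>V\<^esub> (\<Oplus>\<^bsub>V\<^esub>i\<in>I. g i v \<odot>\<^bsub>V\<^esub> b i)" using D(4)[OF v] by simp
      also have "\<dots> = (\<Oplus>\<^bsub>V\<^esub>i\<in>I. r \<odot>\<^bsub>V\<^esub> (g i v \<odot>\<^bsub>V\<^esub> b i))"
        by (rule V.finsum_smult_ldistr[OF D(1) rc]) (use gv D(2) in auto)
      also have "\<dots> = (\<Oplus>\<^bsub>V\<^esub>i\<in>I. \<zero>\<^bsub>V\<^esub>)"
        by (rule V.M.finsum_cong')
          (use gv D(2) rc gr in \<open>auto simp: V.smult_assoc1[symmetric]\<close>)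
      finally show "r = \<zero>" using faithful[OF rc] by simp
    qed
    moreover have "\<zero> \<in> annihilator R ?J"
      using J.Icarr by (simp add: annihilator_def)
    ultimately have "annihilator R ?J = {\<zero>}" by blast
    then show ?thesis using idJ by (simp add: dense_ideal_def)
  qed
  have "\<one> \<notin> ?J" using no by auto
  then obtain m where m: "maximalideal m R" "?J \<subseteq> m"
    using V.R.exists_maximal_ideal_above[OF idJ] by blast
  obtain a s where a: "a \<in> ?J" and s: "s \<in> carrier R - m"
    and sJ: "\<And>x. x \<in> ?J \<Longrightarrow> \<exists>t\<in>carrier R. s \<otimes> x = t \<otimes> a"
    and reg_a: "\<And>r. r \<in> carrier R \<Longrightarrow> r \<otimes> a = \<zero> \<Longrightarrow> r \<otimes> s = \<zero>"
    by (rule strong_Prufer_local_generator[OF SP fg dense m(1)]) (rule that)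
  interpret m: primeideal m R using V.R.maximalideal_prime[OF m(1)] .
  have ac: "a \<in> carrier R" and sc: "s \<in> carrier R" using J.Icarr[OF a] s by auto
  have "\<exists>t\<in>carrier R. s \<otimes> g i v = t \<otimes> a" if "i \<in> I" for i
    by (rule sJ) (use D(3)[OF that] in blast)
  then obtain t where t: "\<And>i. i \<in> I \<Longrightarrow> t i \<in> carrier R" "\<And>i. i \<in> I \<Longrightarrow> s \<otimes> g i v = t i \<otimes> a"
    by metis
  \<comment> \<open>dividing the coordinates of s v by a\<close>
  define w where "w = (\<Oplus>\<^bsub>V\<^esub>i\<in>I. t i \<odot>\<^bsub>V\<^esub> b i)"
  have tb: "(\<lambda>i. t i \<odot>\<^bsub>V\<^esub> b i) \<in> I \<rightarrow> carrier V" using t D(2) by auto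
  have w: "w \<in> carrier V" unfolding w_def by (rule V.M.finsum_closed[OF tb])
  have "a \<odot>\<^bsub>V\<^esub> w = (\<Oplus>\<^bsub>V\<^esub>i\<in>I. a \<odot>\<^bsub>V\<^esub> (t i \<odot>\<^bsub>V\<^esub> b i))"
    unfolding w_def by (rule V.finsum_smult_ldistr[OF D(1) ac tb])
  also have "\<dots> = (\<Oplus>\<^bsub>V\<^esub>i\<in>I. s \<odot>\<^bsub>V\<^esub> (g i v \<odot>\<^bsub>V\<^esub> b i))"
  proof (rule V.M.finsum_cong')
    show "a \<odot>\<^bsub>V\<^esub> (t i \<odot>\<^bsub>V\<^esub> b i) = s \<odot>\<^bsub>V\<^esub> (g i v \<odot>\<^bsub>V\<^esub> b i)" if i: "i \<in> I" for i
      using V.smult_assoc1[OF ac t(1)[OF i] D(2)[OF i]] V.smult_assoc1[OF sc gv[OF i] D(2)[OF i]]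
        t(2)[OF i] V.R.m_comm[OF ac t(1)[OF i]] by simp
  qed (use sc gv D(2) in auto)
  also have "\<dots> = s \<odot>\<^bsub>V\<^esub> (\<Oplus>\<^bsub>V\<^esub>i\<in>I. g i v \<odot>\<^bsub>V\<^esub> b i)"
    by (rule V.finsum_smult_ldistr[OF D(1) sc, symmetric]) (use gv D(2) in auto)
  also have "\<dots> = s \<odot>\<^bsub>V\<^esub> v" using D(4)[OF v] by simp
  finally have aw: "a \<odot>\<^bsub>V\<^esub> w = s \<odot>\<^bsub>V\<^esub> v" .
  \<comment> \<open>a h(w) = s h(v) = 0, and a is regular up to s\<close>
  have sw: "s \<odot>\<^bsub>V\<^esub> w \<in> common_kernel R V H"
  proof -
    have "h (s \<odot>\<^bsub>V\<^esub> w) = \<zero>" if h: "h \<in> H" for h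
    proof -
      note hl = H[OF h]
      have hw: "h w \<in> carrier R" using linear_on_closed[OF hl w] by simp
      have "a \<otimes> h w = s \<otimes> h v"
        using linear_on_smult[OF hl ac w] linear_on_smult[OF hl sc v] aw by simp
      also have "h v = \<zero>" using vH h unfolding common_kernel_def by blast
      also have "s \<otimes> \<zero> = \<zero>" using sc by simp
      finally have "h w \<otimes> s = \<zero>" using reg_a[OF hw] V.R.m_comm[OF hw ac] by simp
      then show ?thesis using linear_on_smult[OF hl sc w] V.R.m_comm[OF hw sc] by simp
    qed
    then show ?thesis using sc w by (simp add: common_kernel_def)
  qed
  have "a \<odot>\<^bsub>V\<^esub> (s \<odot>\<^bsub>V\<^esub> w) = s \<odot>\<^bsub>V\<^esub> (a \<odot>\<^bsub>V\<^esub> w)"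
    using V.smult_assoc1[OF ac sc w] V.smult_assoc1[OF sc ac w] V.R.m_comm[OF ac sc] by simp
  also have "\<dots> = (s \<otimes> s) \<odot>\<^bsub>V\<^esub> v" using aw V.smult_assoc1[OF sc sc v] by simp
  finally obtain u where "u \<in> carrier R" "a \<otimes> u = s \<otimes> s"
    using coordinate[OF sw ac V.R.m_closed[OF sc sc]] by blast
  moreover have "a \<in> m" using a m(2) by blast
  ultimately have "s \<otimes> s \<in> m" using m.I_r_closed[of a u] by simp
  then show False using m.I_prime[OF sc sc] s by blast
qed


section \<open>Free kernels are direct summands\<close>

lemma (in module) eq_if_diff_zero:
  assumes "x \<in> carrier M" "y \<in> carrier M" "x \<oplus>\<^bsub>M\<^esub> (\<ominus> \<one>) \<odot>\<^bsub>M\<^esub> y = \<zero>\<^bsub>M\<^esub>"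
  shows "x = y"
proof -
  have "x = (x \<oplus>\<^bsub>M\<^esub> (\<ominus> \<one>) \<odot>\<^bsub>M\<^esub> y) \<oplus>\<^bsub>M\<^esub> y"
    using assms(1,2) by (simp add: smult_l_minus M.a_assoc M.l_neg)
  then show ?thesis using assms(2,3) by simp
qed

lemma linear_on_diff:
  assumes "module R M" "linear_on R M (carrier M) N f" "x \<in> carrier M" "y \<in> carrier M"
  shows "f (x \<oplus>\<^bsub>M\<^esub> (\<ominus>\<^bsub>R\<^esub> \<one>\<^bsub>R\<^esub>) \<odot>\<^bsub>M\<^esub> y) = f x \<oplus>\<^bsub>N\<^esub> (\<ominus>\<^bsub>R\<^esub> \<one>\<^bsub>R\<^esub>) \<odot>\<^bsub>N\<^esub> f y"
proof -
  interpret M: module R M by fact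
  show ?thesis
    using linear_on_add[OF assms(2,3)] linear_on_smult[OF assms(2) _ assms(4)] assms(4) by simp
qed

lemma linear_on_inj:
  assumes "module R M" "module R N" "linear_on R M (carrier M) N f"
    and "\<forall>x\<in>carrier M. f x = \<zero>\<^bsub>N\<^esub> \<longrightarrow> x = \<zero>\<^bsub>M\<^esub>"
    and x: "x \<in> carrier M" and y: "y \<in> carrier M" and eq: "f x = f y"
  shows "x = y"
proof -
  interpret M: module R M by fact
  interpret N: module R N by fact
  have "f (x \<oplus>\<^bsub>M\<^esub> (\<ominus>\<^bsub>R\<^esub> \<one>\<^bsub>R\<^esub>) \<odot>\<^bsub>M\<^esub> y) = \<zero>\<^bsub>N\<^esub>"
    using linear_on_diff[OF assms(1,3) x y] linear_on_closed[OF assms(3) y]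
    by (simp add: eq N.smult_l_minus N.M.r_neg)
  then show ?thesis using M.eq_if_diff_zero[OF x y] assms(4) x y by simp
qed

definition unit_vector :: "('a, 'r) ring_scheme \<Rightarrow> 'x \<Rightarrow> 'x \<Rightarrow> 'a"
  where "unit_vector R l = (\<lambda>x. if x = l then \<one>\<^bsub>R\<^esub> else \<zero>\<^bsub>R\<^esub>)"

lemma free_module_simps [simp]:
  "u \<oplus>\<^bsub>free_module R L\<^esub> w = (\<lambda>x. u x \<oplus>\<^bsub>R\<^esub> w x)"
  "a \<odot>\<^bsub>free_module R L\<^esub> u = (\<lambda>x. a \<otimes>\<^bsub>R\<^esub> u x)"
  "\<zero>\<^bsub>free_module R L\<^esub> = (\<lambda>x. \<zero>\<^bsub>R\<^esub>)"
  by (simp_all add: free_module_def)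

lemma free_module_memD:
  assumes "u \<in> carrier (free_module R L)"
  shows "x \<in> L \<Longrightarrow> u x \<in> carrier R" "x \<notin> L \<Longrightarrow> u x = \<zero>\<^bsub>R\<^esub>" "finite {x. u x \<noteq> \<zero>\<^bsub>R\<^esub>}"
  using assms by (auto simp: free_module_def)

lemma (in ring) free_module_closed: "u \<in> carrier (free_module R L) \<Longrightarrow> u x \<in> carrier R"
  using free_module_memD(1,2)[of u R L x] by (cases "x \<in> L") simp_all

lemma free_module_memI:
  assumes "finite L" "\<And>x. x \<in> L \<Longrightarrow> u x \<in> carrier R" "\<And>x. x \<notin> L \<Longrightarrow> u x = \<zero>\<^bsub>R\<^esub>"
  shows "u \<in> carrier (free_module R L)"
proof -
  have "finite {x. u x \<noteq> \<zero>\<^bsub>R\<^esub>}"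
    by (rule finite_subset[OF _ assms(1)]) (use assms(3) in auto)
  then show ?thesis using assms(2,3) by (simp add: free_module_def image_subset_iff)
qed

lemma (in ring) unit_vector_mem: "l \<in> L \<Longrightarrow> unit_vector R l \<in> carrier (free_module R L)"
proof -
  assume "l \<in> L"
  moreover have "finite {x. unit_vector R l x \<noteq> \<zero>}"
    by (rule finite_subset[of _ "{l}"]) (auto simp: unit_vector_def)
  ultimately show ?thesis by (simp add: free_module_def) (auto simp: unit_vector_def)
qed

lemma (in ring) free_module_mono:
  assumes "L \<subseteq> L'"
  shows "carrier (free_module R L) \<subseteq> carrier (free_module R L')"
proof
  fix u assume u: "u \<in> carrier (free_module R L)"
  have "u x = \<zero>" if "x \<notin> L'" for x
    by (rule free_module_memD(2)[OF u]) (use assms that in blast)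
  moreover have "u ` L' \<subseteq> carrier R" using free_module_closed[OF u] by blast
  ultimately show "u \<in> carrier (free_module R L')"
    using free_module_memD(3)[OF u] by (simp add: free_module_def)
qed

lemma linear_on_free_module_cong:
  "linear_on R (free_module R L) K N f \<Longrightarrow> linear_on R (free_module R L') K N f"
  unfolding linear_on_def free_module_simps .

lemma (in cring) coordinate_functional:
  "functional_on R (free_module R L) (carrier (free_module R L)) (\<lambda>u. u x)"
  by (rule linear_onI) (simp_all add: free_module_closed[where L = L])

lemma (in cring) free_module_dual_basis:
  assumes L: "finite L"
  shows "dual_basis R (free_module R L) (carrier (free_module R L)) L (unit_vector R) (\<lambda>l u. u l)"
    (is "dual_basis R ?F _ _ _ _")
proof -
  interpret F: module R ?F by (rule free_module_module[OF is_cring])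
  have "u = (\<Oplus>\<^bsub>?F\<^esub>l\<in>L. u l \<odot>\<^bsub>?F\<^esub> unit_vector R l)" if u: "u \<in> carrier ?F" for u
  proof
    fix x
    let ?t = "\<lambda>l. u l \<odot>\<^bsub>?F\<^esub> unit_vector R l"
    have t: "?t \<in> L \<rightarrow> carrier ?F"
      by (rule Pi_I) (rule F.smult_closed[OF free_module_closed[OF u] unit_vector_mem])
    have tx: "(\<lambda>l. ?t l x) \<in> L \<rightarrow> carrier R"
      using free_module_closed[OF u] by (auto simp: unit_vector_def)
    have "(\<Oplus>\<^bsub>?F\<^esub>l\<in>L. ?t l) x = (\<Oplus>\<^bsub>regular_module R\<^esub>l\<in>L. ?t l x)"
      by (rule linear_on_finsum[OF F.module_axioms regular_module_module F.carrier_is_submodule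
          coordinate_functional L t])
    also have "\<dots> = (\<Oplus>l\<in>L. ?t l x)" by (rule finsum_regular_module[OF tx])
    also have "\<dots> = u x"
    proof (cases "x \<in> L")
      case True
      have "(\<Oplus>l\<in>L. ?t l x) = (\<Oplus>l\<in>L. if x = l then u l else \<zero>)"
        by (rule finsum_cong') (use free_module_closed[OF u] in \<open>auto simp: unit_vector_def\<close>)
      then show ?thesis using finsum_singleton[OF True L, of u] free_module_closed[OF u] by simp
    next
      case False
      have "(\<Oplus>l\<in>L. ?t l x) = (\<Oplus>l\<in>L. \<zero>)"
        by (rule finsum_cong') (use False free_module_closed[OF u] in \<open>auto simp: unit_vector_def\<close>)
      then show ?thesis using free_module_memD(2)[OF u False] by simp
    qed
    finally show "u x = (\<Oplus>\<^bsub>?F\<^esub>l\<in>L. ?t l) x" by simp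
  qed
  moreover have "\<forall>l\<in>L. unit_vector R l \<in> carrier ?F \<and>
      functional_on R ?F (carrier ?F) (\<lambda>u. u l)"
    by (intro ballI conjI unit_vector_mem coordinate_functional)
  ultimately show ?thesis unfolding dual_basis_def using L by (intro conjI ballI) simp_all
qed

text \<open>Induction on the rank. The image \<open>v\<close> of the basis vector \<open>e\<close> at \<open>l\<close> is unimodular, say \<open>g v = 1\<close>, so
  \<open>V\<close> is the direct sum of \<open>R v\<close> and the kernel of \<open>g\<close>, with projection \<open>T\<close> onto the latter. Adding \<open>g\<close> to
  \<open>H\<close> replaces the common kernel by its image under \<open>T\<close>, which is free on the images of the
  remaining basis vectors; a retraction onto it, together with the component along \<open>v\<close>, is a retraction onto the
  original kernel.\<close>

lemma strong_Prufer_free_retract: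
  fixes R (structure)
  assumes SP: "strong_Prufer_ring R" and V: "module R V"
    and dual: "dual_basis R V (carrier V) I b g" and L: "finite L"
    and H: "\<And>h. h \<in> H \<Longrightarrow> functional_on R V (carrier V) h"
    and \<phi>: "linear_on R (free_module R L) (carrier (free_module R L)) V \<phi>"
    and inj: "\<And>u. u \<in> carrier (free_module R L) \<Longrightarrow> \<phi> u = \<zero>\<^bsub>V\<^esub> \<Longrightarrow> u = (\<lambda>x. \<zero>)"
    and img: "\<phi> ` carrier (free_module R L) = common_kernel R V H"
  shows "\<exists>\<rho>. linear_on R V (carrier V) V \<rho> \<and> (\<forall>x\<in>carrier V. \<rho> x \<in> common_kernel R V H) \<and>
    (\<forall>x\<in>common_kernel R V H. \<rho> x = x)"
  using L H \<phi> inj img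
proof (induction L arbitrary: \<phi> H rule: finite_induct)
  case empty
  interpret V: module R V by fact
  have F: "carrier (free_module R {}) = {\<lambda>x. \<zero>}" by (auto simp: free_module_def)
  have "common_kernel R V H = {\<phi> (\<lambda>x. \<zero>)}" 
    unfolding empty.prems(4)[symmetric] F by simp
  moreover have "\<zero>\<^bsub>V\<^esub> \<in> common_kernel R V H"
    using submodule_zero[OF common_kernel_submodule[OF V empty.prems(1)]] by blast
  ultimately have "common_kernel R V H = {\<zero>\<^bsub>V\<^esub>}" by simp
  then show ?case using linear_on_zero_map[OF V] by (intro exI[of _ "\<lambda>x. \<zero>\<^bsub>V\<^esub>"]) simp
next
  case (insert l L)
  interpret V: module R V by fact
  let ?F = "free_module R (insert l L)" and ?G = "free_module R L"
  interpret F: module R ?F by (rule free_module_module[OF V.R.is_cring])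
  note H = insert.prems(1) and \<phi> = insert.prems(2) and img = insert.prems(4)
  have ker: "\<forall>u\<in>carrier ?F. \<phi> u = \<zero>\<^bsub>V\<^esub> \<longrightarrow> u = \<zero>\<^bsub>?F\<^esub>"
    using insert.prems(3) by simp
  note inj = linear_on_inj[OF F.module_axioms V \<phi> ker]
  have sub: "submodule (common_kernel R V H) R V" by (rule common_kernel_submodule[OF V H])
  define e where "e = unit_vector R l"
  have e: "e \<in> carrier ?F" unfolding e_def by (rule V.R.unit_vector_mem) simp
  have el: "e l = \<one>" "\<And>x. x \<noteq> l \<Longrightarrow> e x = \<zero>" by (simp_all add: e_def unit_vector_def)
  define v where "v = \<phi> e"
  have vH: "v \<in> common_kernel R V H" using img e by (auto simp: v_def)
  have v: "v \<in> carrier V" using vH submodule_subset[OF sub] by blast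
  have re: "\<phi> (r \<odot>\<^bsub>?F\<^esub> e) = r \<odot>\<^bsub>V\<^esub> v" if "r \<in> carrier R" for r
    unfolding v_def by (rule linear_on_smult[OF \<phi> that e])
  have "\<exists>h. functional_on R V (carrier V) h \<and> h v = \<one>"
  proof (rule strong_Prufer_unimodular[OF SP V dual H _ vH])
    fix r assume r: "r \<in> carrier R" "r \<odot>\<^bsub>V\<^esub> v = \<zero>\<^bsub>V\<^esub>"
    have "r \<odot>\<^bsub>?F\<^esub> e = (\<lambda>x. \<zero>)"
      using insert.prems(3)[OF F.smult_closed[OF r(1) e]] re[OF r(1)] r(2) by simp
    then have "(r \<odot>\<^bsub>?F\<^esub> e) l = \<zero>" by simp
    then show "r = \<zero>" using r(1) el(1) by simp
  next
    fix w a r assume w: "w \<in> common_kernel R V H" and a: "a \<in> carrier R" and r: "r \<in> carrier R"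
      and eq: "a \<odot>\<^bsub>V\<^esub> w = r \<odot>\<^bsub>V\<^esub> v"
    obtain u where u: "u \<in> carrier ?F" "w = \<phi> u" using w img by blast
    have "\<phi> (a \<odot>\<^bsub>?F\<^esub> u) = \<phi> (r \<odot>\<^bsub>?F\<^esub> e)"
      using linear_on_smult[OF \<phi> a u(1)] re[OF r] eq u(2) by simp
    then have "a \<odot>\<^bsub>?F\<^esub> u = r \<odot>\<^bsub>?F\<^esub> e"
      by (rule inj[OF F.smult_closed[OF a u(1)] F.smult_closed[OF r e]])
    then have "(a \<odot>\<^bsub>?F\<^esub> u) l = (r \<odot>\<^bsub>?F\<^esub> e) l" by (rule fun_cong)
    then have "a \<otimes> u l = r" using r el(1) by simp
    then show "\<exists>u\<in>carrier R. a \<otimes> u = r" using V.R.free_module_closed[OF u(1)] by blast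
  qed
  then obtain g where g: "functional_on R V (carrier V) g" "g v = \<one>" by blast
  have gc: "g x \<in> carrier R" if "x \<in> carrier V" for x using linear_on_closed[OF g(1) that] by simp
  \<comment> \<open>the projection along v onto the kernel of g\<close>
  define T where "T x = x \<oplus>\<^bsub>V\<^esub> (\<ominus> g x) \<odot>\<^bsub>V\<^esub> v" for x
  have "functional_on R V (carrier V) (\<lambda>x. \<ominus> g x)"
  proof (rule linear_onI)
    show "\<ominus> g (x \<oplus>\<^bsub>V\<^esub> y) = \<ominus> g x \<oplus>\<^bsub>regular_module R\<^esub> \<ominus> g y" if "x \<in> carrier V" "y \<in> carrier V" for x y
      using linear_on_add[OF g(1) that] gc that by (simp add: V.R.minus_add)
    show "\<ominus> g (a \<odot>\<^bsub>V\<^esub> x) = a \<odot>\<^bsub>regular_module R\<^esub> \<ominus> g x" if "a \<in> carrier R" "x \<in> carrier V" for a x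
      using linear_on_smult[OF g(1) that] gc that by (simp add: V.R.r_minus)
  qed (use gc in simp)
  then have T: "linear_on R V (carrier V) V T"
    unfolding T_def
    by (intro linear_on_plus[OF V] linear_on_functional_smult[OF V _ v])
      (simp_all add: linear_on_def)
  have Tc: "T x \<in> carrier V" if "x \<in> carrier V" for x using linear_on_closed[OF T that] .
  have gT: "g (T x) = \<zero>" if x: "x \<in> carrier V" for x
    using linear_on_add[OF g(1) x] linear_on_smult[OF g(1) _ v] g(2) x v gc[OF x]
    by (simp add: T_def V.R.r_neg)
  have Tx: "T x \<oplus>\<^bsub>V\<^esub> g x \<odot>\<^bsub>V\<^esub> v = x" if x: "x \<in> carrier V" for x
    using x v gc[OF x] by (simp add: T_def V.M.a_assoc V.smult_l_minus V.M.l_neg)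
  have CK: "common_kernel R V (insert g H) = {x \<in> common_kernel R V H. g x = \<zero>}"
    by (auto simp: common_kernel_def)
  have TH: "T x \<in> common_kernel R V (insert g H)" if x: "x \<in> common_kernel R V H" for x
  proof -
    have xV: "x \<in> carrier V" using x submodule_subset[OF sub] by blast
    then have "T x \<in> common_kernel R V H"
      unfolding T_def using submodule_add[OF sub x submodule_smult[OF sub _ vH]] gc by simp
    then show ?thesis using gT[OF xV] CK by simp
  qed
  have GF: "carrier ?G \<subseteq> carrier ?F" by (rule V.R.free_module_mono) blast
  define \<psi> where "\<psi> u = T (\<phi> u)" for u
  have \<phi>V: "\<phi> u \<in> carrier V" if "u \<in> carrier ?F" for u using linear_on_closed[OF \<phi> that] .
  have \<psi>_eq: "\<psi> u = \<phi> (u \<oplus>\<^bsub>?F\<^esub> (\<ominus> g (\<phi> u)) \<odot>\<^bsub>?F\<^esub> e)" if u: "u \<in> carrier ?F" for u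
  proof -
    have c: "\<ominus> g (\<phi> u) \<in> carrier R" using gc \<phi>V[OF u] by simp
    show ?thesis
      using linear_on_add[OF \<phi> u F.smult_closed[OF c e]] re[OF c] by (simp add: \<psi>_def T_def)
  qed
  have "\<exists>\<rho>. linear_on R V (carrier V) V \<rho> \<and>
      (\<forall>x\<in>carrier V. \<rho> x \<in> common_kernel R V (insert g H)) \<and>
      (\<forall>x\<in>common_kernel R V (insert g H). \<rho> x = x)"
  proof (rule insert.IH)
    show "functional_on R V (carrier V) h" if "h \<in> insert g H" for h
      using that H g(1) by blast
    show "linear_on R ?G (carrier ?G) V \<psi>"
    proof (rule linear_on_free_module_cong[of _ "insert l L"])
      show "linear_on R ?F (carrier ?G) V \<psi>"
        unfolding \<psi>_def
        by (rule linear_on_comp[OF linear_on_subset[OF \<phi> GF] _ T]) (use \<phi>V GF in blast)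
    qed
    show "u = (\<lambda>x. \<zero>)" if u: "u \<in> carrier ?G" "\<psi> u = \<zero>\<^bsub>V\<^esub>" for u
    proof
      fix x
      have uF: "u \<in> carrier ?F" using u(1) GF by blast
      have c: "\<ominus> g (\<phi> u) \<in> carrier R" using gc \<phi>V[OF uF] by simp
      let ?w = "u \<oplus>\<^bsub>?F\<^esub> (\<ominus> g (\<phi> u)) \<odot>\<^bsub>?F\<^esub> e"
      have "?w = (\<lambda>x. \<zero>)"
        using insert.prems(3)[OF F.M.a_closed[OF uF F.smult_closed[OF c e]]] \<psi>_eq[OF uF] u(2) by simp
      then have w: "?w x = \<zero>" by simp
      show "u x = \<zero>"
      proof (cases "x = l")
        case True
        then show ?thesis using free_module_memD(2)[OF u(1)] insert.hyps(2) by simp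
      next
        case False
        then show ?thesis using w c V.R.free_module_closed[OF uF] el(2)[OF False] by simp
      qed
    qed
    show "\<psi> ` carrier ?G = common_kernel R V (insert g H)"
    proof
      show "\<psi> ` carrier ?G \<subseteq> common_kernel R V (insert g H)"
        using TH img GF unfolding \<psi>_def by blast
      show "common_kernel R V (insert g H) \<subseteq> \<psi> ` carrier ?G"
      proof
        fix y assume "y \<in> common_kernel R V (insert g H)"
        then have yH: "y \<in> common_kernel R V H" and gy: "g y = \<zero>" using CK by simp_all
        then obtain u where u: "u \<in> carrier ?F" "y = \<phi> u" using img by blast
        \<comment> \<open>the preimage without its component at l; the projection T removes the difference\<close>
        let ?w = "u(l := \<zero>)"
        have w: "?w \<in> carrier ?G"
          by (rule free_module_memI) (use insert.hyps u free_module_memD[OF u(1)] in auto)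
        then have wF: "?w \<in> carrier ?F" using GF by blast
        have ul: "u l \<in> carrier R" using V.R.free_module_closed[OF u(1)] .
        have "u = ?w \<oplus>\<^bsub>?F\<^esub> u l \<odot>\<^bsub>?F\<^esub> e"
          using V.R.free_module_closed[OF u(1)] el by (auto simp: fun_eq_iff)
        then have y: "y = \<phi> ?w \<oplus>\<^bsub>V\<^esub> u l \<odot>\<^bsub>V\<^esub> v"
          using linear_on_add[OF \<phi> wF F.smult_closed[OF ul e]] re[OF ul] u(2) by argo
        have "T y = T (\<phi> ?w) \<oplus>\<^bsub>V\<^esub> u l \<odot>\<^bsub>V\<^esub> T v"
          unfolding y using linear_on_add[OF T \<phi>V[OF wF]] linear_on_smult[OF T ul v] ul v by simp
        moreover have "T v = \<zero>\<^bsub>V\<^esub>" using v by (simp add: T_def g(2) V.smult_l_minus V.M.r_neg)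
        moreover have "T y = y"
          using Tx[of y] gy yH submodule_subset[OF sub] v Tc[of y] by auto
        ultimately have "y = \<psi> ?w" using ul Tc[OF \<phi>V[OF wF]] by (simp add: \<psi>_def)
        then show "y \<in> \<psi> ` carrier ?G" using w by blast
      qed
    qed
  qed
  then obtain \<rho> where \<rho>: "linear_on R V (carrier V) V \<rho>"
    "\<And>x. x \<in> carrier V \<Longrightarrow> \<rho> x \<in> common_kernel R V (insert g H)"
    "\<And>x. x \<in> common_kernel R V (insert g H) \<Longrightarrow> \<rho> x = x" by blast
  let ?\<sigma> = "\<lambda>x. \<rho> (T x) \<oplus>\<^bsub>V\<^esub> g x \<odot>\<^bsub>V\<^esub> v"
  have "linear_on R V (carrier V) V ?\<sigma>"
    by (intro linear_on_plus[OF V] linear_on_functional_smult[OF V g(1) v]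
        linear_on_comp[OF T Tc \<rho>(1)])
  moreover have "?\<sigma> x \<in> common_kernel R V H" if x: "x \<in> carrier V" for x
  proof -
    have "\<rho> (T x) \<in> common_kernel R V H" using \<rho>(2)[OF Tc[OF x]] CK by blast
    then show ?thesis using submodule_add[OF sub _ submodule_smult[OF sub gc[OF x] vH]] by blast
  qed
  moreover have "?\<sigma> x = x" if x: "x \<in> common_kernel R V H" for x
    using \<rho>(3)[OF TH[OF x]] Tx x submodule_subset[OF sub] by auto
  ultimately show ?case by blast
qed


section \<open>Projective kernels are direct summands\<close>

definition direct_sum ::
    "('a, 'm, 'c) module_scheme \<Rightarrow> ('a, 'n, 'd) module_scheme \<Rightarrow> ('a, 'm \<times> 'n) module"
  where "direct_sum M N =
    \<lparr>carrier = carrier M \<times> carrier N,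
     monoid.mult = (\<lambda>p q. (\<zero>\<^bsub>M\<^esub>, \<zero>\<^bsub>N\<^esub>)), one = (\<zero>\<^bsub>M\<^esub>, \<zero>\<^bsub>N\<^esub>), ring.zero = (\<zero>\<^bsub>M\<^esub>, \<zero>\<^bsub>N\<^esub>),
     ring.add = (\<lambda>p q. (fst p \<oplus>\<^bsub>M\<^esub> fst q, snd p \<oplus>\<^bsub>N\<^esub> snd q)),
     smult = (\<lambda>a p. (a \<odot>\<^bsub>M\<^esub> fst p, a \<odot>\<^bsub>N\<^esub> snd p))\<rparr>"

lemma direct_sum_simps [simp]:
  "carrier (direct_sum M N) = carrier M \<times> carrier N"
  "\<zero>\<^bsub>direct_sum M N\<^esub> = (\<zero>\<^bsub>M\<^esub>, \<zero>\<^bsub>N\<^esub>)"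
  "p \<oplus>\<^bsub>direct_sum M N\<^esub> q = (fst p \<oplus>\<^bsub>M\<^esub> fst q, snd p \<oplus>\<^bsub>N\<^esub> snd q)"
  "a \<odot>\<^bsub>direct_sum M N\<^esub> p = (a \<odot>\<^bsub>M\<^esub> fst p, a \<odot>\<^bsub>N\<^esub> snd p)"
  by (simp_all add: direct_sum_def)

lemma direct_sum_module:
  assumes "module R M" "module R N"
  shows "module R (direct_sum M N)"
proof -
  interpret M: module R M by fact
  interpret N: module R N by fact
  have "abelian_group (direct_sum M N)"
  proof (rule abelian_groupI)
    fix p assume "p \<in> carrier (direct_sum M N)"
    then show "\<exists>q\<in>carrier (direct_sum M N). q \<oplus>\<^bsub>direct_sum M N\<^esub> p = \<zero>\<^bsub>direct_sum M N\<^esub>"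
      by (intro bexI[of _ "(\<ominus>\<^bsub>M\<^esub> fst p, \<ominus>\<^bsub>N\<^esub> snd p)"]) (auto simp: M.M.l_neg N.M.l_neg)
  qed (auto simp: M.M.a_ac N.M.a_ac)
  then show ?thesis
    by (intro moduleI M.R.is_cring)
      (auto simp: M.smult_l_distr M.smult_r_distr M.smult_assoc1
        N.smult_l_distr N.smult_r_distr N.smult_assoc1)
qed

lemma linear_on_fst: "linear_on R (direct_sum M N) (carrier (direct_sum M N)) M fst"
  and linear_on_snd: "linear_on R (direct_sum M N) (carrier (direct_sum M N)) N snd"
  by (auto simp: linear_on_def)

lemma (in abelian_monoid) finsum_Plus:
  assumes "finite A" "finite B" "t \<in> A <+> B \<rightarrow> carrier G"
  shows "finsum G t (A <+> B) = (\<Oplus>i\<in>A. t (Inl i)) \<oplus> (\<Oplus>l\<in>B. t (Inr l))"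
proof -
  have t: "t \<in> Inl ` A \<rightarrow> carrier G" "t \<in> Inr ` B \<rightarrow> carrier G" using assms(3) by auto
  have "finsum G t (A <+> B) = finsum G t (Inl ` A) \<oplus> finsum G t (Inr ` B)"
    unfolding Plus_def by (rule finsum_Un_disjoint) (use assms(1,2) t in auto)
  also have "finsum G t (Inl ` A) = (\<Oplus>i\<in>A. t (Inl i))"
    by (rule finsum_reindex[OF t(1)]) simp
  also have "finsum G t (Inr ` B) = (\<Oplus>l\<in>B. t (Inr l))"
    by (rule finsum_reindex[OF t(2)]) simp
  finally show ?thesis .
qed

lemma direct_sum_dual_basis:
  assumes M: "module R M" and N: "module R N"
    and DM: "dual_basis R M (carrier M) I b f" and DN: "dual_basis R N (carrier N) L c g"
  shows "dual_basis R (direct_sum M N) (carrier (direct_sum M N)) (I <+> L)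
    (case_sum (\<lambda>i. (b i, \<zero>\<^bsub>N\<^esub>)) (\<lambda>l. (\<zero>\<^bsub>M\<^esub>, c l)))
    (case_sum (\<lambda>i p. f i (fst p)) (\<lambda>l p. g l (snd p)))"
    (is "dual_basis R ?S _ _ ?b ?f")
proof -
  interpret M: module R M by fact
  interpret N: module R N by fact
  interpret S: module R ?S by (rule direct_sum_module[OF M N])
  note DM = dual_basisD[OF DM] and DN = dual_basisD[OF DN]
  have fin: "finite (I <+> L)" using DM(1) DN(1) by simp
  have b: "?b j \<in> carrier ?S" if "j \<in> I <+> L" for j using that DM(2) DN(2) by auto
  have f: "functional_on R ?S (carrier ?S) (?f j)" if "j \<in> I <+> L" for j
  proof (cases j)
    case (Inl i)
    have "functional_on R ?S (carrier ?S) (\<lambda>p. f i (fst p))"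
      by (rule linear_on_comp[OF linear_on_fst _ DM(3)]) (use that Inl in auto)
    then show ?thesis using Inl by simp
  next
    case (Inr l)
    have "functional_on R ?S (carrier ?S) (\<lambda>p. g l (snd p))"
      by (rule linear_on_comp[OF linear_on_snd _ DN(3)]) (use that Inr in auto)
    then show ?thesis using Inr by simp
  qed
  have "p = (\<Oplus>\<^bsub>?S\<^esub>j\<in>I <+> L. ?f j p \<odot>\<^bsub>?S\<^esub> ?b j)" if p: "p \<in> carrier ?S" for p
  proof -
    let ?t = "\<lambda>j. ?f j p \<odot>\<^bsub>?S\<^esub> ?b j"
    have fp: "?f j p \<in> carrier R" if "j \<in> I <+> L" for j
      using linear_on_closed[OF f[OF that] p] by simp
    have t: "?t \<in> I <+> L \<rightarrow> carrier ?S"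
      by (rule Pi_I) (rule S.smult_closed[OF fp b])
    have p1: "fst p \<in> carrier M" "snd p \<in> carrier N" using p by auto
    have f1: "f i (fst p) \<in> carrier R" if "i \<in> I" for i
      using linear_on_closed[OF DM(3)[OF that] p1(1)] by simp
    have g1: "g l (snd p) \<in> carrier R" if "l \<in> L" for l
      using linear_on_closed[OF DN(3)[OF that] p1(2)] by simp
    have "fst (finsum ?S ?t (I <+> L)) = (\<Oplus>\<^bsub>M\<^esub>j\<in>I <+> L. fst (?t j))"
      by (rule linear_on_finsum[OF S.module_axioms M S.carrier_is_submodule linear_on_fst fin t])
    also have "\<dots> = (\<Oplus>\<^bsub>M\<^esub>i\<in>I. fst (?t (Inl i))) \<oplus>\<^bsub>M\<^esub> (\<Oplus>\<^bsub>M\<^esub>l\<in>L. fst (?t (Inr l)))"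
      by (rule M.M.finsum_Plus[OF DM(1) DN(1)]) (use t in auto)
    also have "(\<Oplus>\<^bsub>M\<^esub>l\<in>L. fst (?t (Inr l))) = (\<Oplus>\<^bsub>M\<^esub>l\<in>L. \<zero>\<^bsub>M\<^esub>)"
      by (rule M.M.finsum_cong') (use g1 in auto)
    also have "(\<Oplus>\<^bsub>M\<^esub>i\<in>I. fst (?t (Inl i))) = fst p" using DM(4)[OF p1(1)] by simp
    finally have 1: "fst (finsum ?S ?t (I <+> L)) = fst p" using p1 by simp
    have "snd (finsum ?S ?t (I <+> L)) = (\<Oplus>\<^bsub>N\<^esub>j\<in>I <+> L. snd (?t j))"
      by (rule linear_on_finsum[OF S.module_axioms N S.carrier_is_submodule linear_on_snd fin t])
    also have "\<dots> = (\<Oplus>\<^bsub>N\<^esub>i\<in>I. snd (?t (Inl i))) \<oplus>\<^bsub>N\<^esub> (\<Oplus>\<^bsub>N\<^esub>l\<in>L. snd (?t (Inr l)))"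
      by (rule N.M.finsum_Plus[OF DM(1) DN(1)]) (use t in auto)
    also have "(\<Oplus>\<^bsub>N\<^esub>i\<in>I. snd (?t (Inl i))) = (\<Oplus>\<^bsub>N\<^esub>i\<in>I. \<zero>\<^bsub>N\<^esub>)"
      by (rule N.M.finsum_cong') (use f1 in auto)
    also have "(\<Oplus>\<^bsub>N\<^esub>l\<in>L. snd (?t (Inr l))) = snd p" using DN(4)[OF p1(2)] by simp
    finally have 2: "snd (finsum ?S ?t (I <+> L)) = snd p" using p1 by simp
    show ?thesis using 1 2 by (simp add: prod_eq_iff)
  qed
  then show ?thesis unfolding dual_basis_def using fin b f by (intro conjI ballI) simp_all
qed

text \<open>Let \<open>\<kappa>\<close> be the projection of the free module \<open>F\<close> on \<open>L\<close> onto \<open>K\<close> and \<open>\<sigma>\<close> its section, both given by the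
  dual basis of \<open>K\<close>. Then \<open>K\<close> together with the complement \<open>ker \<kappa>\<close> is a free submodule of \<open>B \<oplus> F\<close>, namely
  the image of \<open>F\<close> under \<open>u \<mapsto> (\<kappa> u, u - \<sigma> (\<kappa> u))\<close>. It is the common kernel of the functionals of \<open>H\<close>
  applied to the first component and of the functionals \<open>f l\<close> applied to the image under \<open>\<kappa>\<close> of the
  second. A retraction onto it, restricted to \<open>B\<close> and projected to \<open>B\<close>, is a retraction onto \<open>K\<close>.\<close>

lemma strong_Prufer_projective_retract:
  fixes R (structure)
  assumes SP: "strong_Prufer_ring R" and B: "module R B"
    and DB: "dual_basis R B (carrier B) I b g"
    and H: "\<And>h. h \<in> H \<Longrightarrow> functional_on R B (carrier B) h"
    and DK: "dual_basis R B (common_kernel R B H) L k f"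
  shows "\<exists>\<rho>. linear_on R B (carrier B) B \<rho> \<and> (\<forall>x\<in>carrier B. \<rho> x \<in> common_kernel R B H) \<and>
    (\<forall>x\<in>common_kernel R B H. \<rho> x = x)"
proof -
  interpret B: module R B by fact
  let ?K = "common_kernel R B H" and ?F = "free_module R L"
  let ?V = "direct_sum B ?F"
  have F: "module R ?F" by (rule free_module_module[OF B.R.is_cring])
  interpret F: module R ?F by (rule F)
  have V: "module R ?V" by (rule direct_sum_module[OF B F])
  note DK = dual_basisD[OF DK]
  note reg = B.R.regular_module_module
  have K: "submodule ?K R B" by (rule common_kernel_submodule[OF B H])
  have KB: "?K \<subseteq> carrier B" by (rule submodule_subset[OF K])
  have kB: "k l \<in> carrier B" if "l \<in> L" for l using DK(2)[OF that] KB by blast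
  have Fc: "u x \<in> carrier R" if "u \<in> carrier ?F" for u x
    by (rule B.R.free_module_closed[OF that])
  have fc: "f l x \<in> carrier R" if "l \<in> L" "x \<in> ?K" for l x
    using linear_on_closed[OF DK(3)[OF that(1)] that(2)] by simp

  define \<kappa> where "\<kappa> u = (\<Oplus>\<^bsub>B\<^esub>l\<in>L. u l \<odot>\<^bsub>B\<^esub> k l)" for u
  have \<kappa>: "linear_on R ?F (carrier ?F) B \<kappa>"
    unfolding \<kappa>_def
    by (rule linear_on_sum[OF B DK(1)])
      (rule linear_on_functional_smult[OF B B.R.coordinate_functional], use kB in blast)
  have \<kappa>K: "\<kappa> u \<in> ?K" if "u \<in> carrier ?F" for u
    unfolding \<kappa>_def
    by (rule B.submodule_finsum[OF K DK(1)]) (use submodule_smult[OF K Fc[OF that] DK(2)] in auto)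

  define \<sigma> where "\<sigma> x = (\<lambda>l. if l \<in> L then f l x else \<zero>)" for x
  have \<sigma>F: "\<sigma> x \<in> carrier ?F" if "x \<in> ?K" for x
    by (rule free_module_memI[OF DK(1)]) (use fc that in \<open>auto simp: \<sigma>_def\<close>)
  have \<sigma>: "linear_on R B ?K ?F \<sigma>"
  proof (rule linear_onI[OF \<sigma>F])
    show "\<sigma> (x \<oplus>\<^bsub>B\<^esub> y) = \<sigma> x \<oplus>\<^bsub>?F\<^esub> \<sigma> y" if "x \<in> ?K" "y \<in> ?K" for x y
      using linear_on_add[OF DK(3) that] by (auto simp: \<sigma>_def)
    show "\<sigma> (a \<odot>\<^bsub>B\<^esub> x) = a \<odot>\<^bsub>?F\<^esub> \<sigma> x" if "a \<in> carrier R" "x \<in> ?K" for a x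
      using linear_on_smult[OF DK(3) that] that(1) by (auto simp: \<sigma>_def)
  qed
  have \<kappa>\<sigma>: "\<kappa> (\<sigma> x) = x" if x: "x \<in> ?K" for x
  proof -
    have "\<kappa> (\<sigma> x) = (\<Oplus>\<^bsub>B\<^esub>l\<in>L. f l x \<odot>\<^bsub>B\<^esub> k l)"
      unfolding \<kappa>_def
      by (rule B.M.finsum_cong') (use fc[OF _ x] kB in \<open>auto simp: \<sigma>_def\<close>)
    then show ?thesis using DK(4)[OF x] by simp
  qed

  define \<phi> where "\<phi> u = (\<kappa> u, u \<oplus>\<^bsub>?F\<^esub> (\<ominus> \<one>) \<odot>\<^bsub>?F\<^esub> \<sigma> (\<kappa> u))" for u
  have pair: "linear_on R ?F (carrier ?F) ?V (\<lambda>u. (p u, q u))"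
    if "linear_on R ?F (carrier ?F) B p" "linear_on R ?F (carrier ?F) ?F q" for p q
    using that unfolding linear_on_def by simp
  have id: "linear_on R ?F (carrier ?F) ?F (\<lambda>u. u)"
    by (rule linear_onI) simp_all
  have \<phi>: "linear_on R ?F (carrier ?F) ?V \<phi>"
    unfolding \<phi>_def
    by (intro pair \<kappa> linear_on_plus[OF F] linear_on_scale[OF F] id linear_on_comp[OF \<kappa> \<kappa>K \<sigma>])
      simp_all
  define H' where "H' = (\<lambda>h p. h (fst p)) ` H \<union> (\<lambda>l p. f l (\<kappa> (snd p))) ` L"
  have H': "functional_on R ?V (carrier ?V) h" if "h \<in> H'" for h
  proof -
    consider h' where "h' \<in> H" "h = (\<lambda>p. h' (fst p))"
      | l where "l \<in> L" "h = (\<lambda>p. f l (\<kappa> (snd p)))"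
      using \<open>h \<in> H'\<close> unfolding H'_def by blast
    then show ?thesis
    proof cases
      case 1
      show ?thesis unfolding 1(2) by (rule linear_on_comp[OF linear_on_fst _ H[OF 1(1)]]) auto
    next
      case 2
      have "functional_on R ?F (carrier ?F) (\<lambda>u. f l (\<kappa> u))"
        by (rule linear_on_comp[OF \<kappa> \<kappa>K DK(3)[OF 2(1)]])
      then show ?thesis unfolding 2(2) by (rule linear_on_comp[OF linear_on_snd, rotated]) auto
    qed
  qed
  have CK: "p \<in> common_kernel R ?V H' \<longleftrightarrow> fst p \<in> ?K \<and> snd p \<in> carrier ?F \<and> \<kappa> (snd p) = \<zero>\<^bsub>B\<^esub>" for p
  proof -
    have "(\<forall>l\<in>L. f l (\<kappa> u) = \<zero>) \<longleftrightarrow> \<kappa> u = \<zero>\<^bsub>B\<^esub>" if u: "u \<in> carrier ?F" for u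
    proof
      assume 0: "\<forall>l\<in>L. f l (\<kappa> u) = \<zero>"
      have "\<kappa> u = (\<Oplus>\<^bsub>B\<^esub>l\<in>L. f l (\<kappa> u) \<odot>\<^bsub>B\<^esub> k l)" using DK(4)[OF \<kappa>K[OF u]] by simp
      also have "\<dots> = (\<Oplus>\<^bsub>B\<^esub>l\<in>L. \<zero>\<^bsub>B\<^esub>)"
        by (rule B.M.finsum_cong') (use 0 kB in auto)
      finally show "\<kappa> u = \<zero>\<^bsub>B\<^esub>" by simp
    next
      assume "\<kappa> u = \<zero>\<^bsub>B\<^esub>"
      then show "\<forall>l\<in>L. f l (\<kappa> u) = \<zero>" using linear_on_zero[OF B reg K DK(3)] by simp
    qed
    moreover have "p \<in> common_kernel R ?V H' \<longleftrightarrow>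
        fst p \<in> ?K \<and> snd p \<in> carrier ?F \<and> (\<forall>l\<in>L. f l (\<kappa> (snd p)) = \<zero>)"
      by (cases p) (auto simp: common_kernel_def H'_def ball_Un)
    ultimately show ?thesis by blast
  qed
  have "\<exists>\<rho>. linear_on R ?V (carrier ?V) ?V \<rho> \<and> (\<forall>x\<in>carrier ?V. \<rho> x \<in> common_kernel R ?V H') \<and>
    (\<forall>x\<in>common_kernel R ?V H'. \<rho> x = x)"
  proof (rule strong_Prufer_free_retract[OF SP V
        direct_sum_dual_basis[OF B F DB B.R.free_module_dual_basis[OF DK(1)]] DK(1) H' \<phi>])
    show "u = (\<lambda>x. \<zero>)" if u: "u \<in> carrier ?F" "\<phi> u = \<zero>\<^bsub>?V\<^esub>" for u
    proof -
      have "\<kappa> u = \<zero>\<^bsub>B\<^esub>" and *: "u \<oplus>\<^bsub>?F\<^esub> (\<ominus> \<one>) \<odot>\<^bsub>?F\<^esub> \<sigma> (\<kappa> u) = \<zero>\<^bsub>?F\<^esub>"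
        using u(2) unfolding \<phi>_def direct_sum_simps prod.inject by blast+
      then have "\<sigma> (\<kappa> u) = (\<lambda>x. \<zero>)"
        using linear_on_zero[OF B F K \<sigma>] by simp
      then show ?thesis using * Fc[OF u(1)] by (simp add: fun_eq_iff)
    qed
    show "\<phi> ` carrier ?F = common_kernel R ?V H'"
    proof
      show "\<phi> ` carrier ?F \<subseteq> common_kernel R ?V H'"
      proof
        fix p assume "p \<in> \<phi> ` carrier ?F"
        then obtain u where u: "u \<in> carrier ?F" "p = \<phi> u" by blast
        have s: "\<sigma> (\<kappa> u) \<in> carrier ?F" by (rule \<sigma>F[OF \<kappa>K[OF u(1)]])
        then have ms: "(\<ominus> \<one>) \<odot>\<^bsub>?F\<^esub> \<sigma> (\<kappa> u) \<in> carrier ?F" by (rule F.smult_closed[rotated]) simp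
        have "\<kappa> (snd p) = \<kappa> u \<oplus>\<^bsub>B\<^esub> (\<ominus> \<one>) \<odot>\<^bsub>B\<^esub> \<kappa> (\<sigma> (\<kappa> u))"
          using linear_on_add[OF \<kappa> u(1) ms] linear_on_smult[OF \<kappa> _ s, of "\<ominus> \<one>"]
          by (simp add: u(2) \<phi>_def)
        also have "\<dots> = \<zero>\<^bsub>B\<^esub>"
          using \<kappa>\<sigma>[OF \<kappa>K[OF u(1)]] linear_on_closed[OF \<kappa> u(1)] by (simp add: B.smult_l_minus B.M.r_neg)
        finally have "\<kappa> (snd p) = \<zero>\<^bsub>B\<^esub>" .
        moreover have "fst p \<in> ?K" using \<kappa>K[OF u(1)] by (simp add: u(2) \<phi>_def)
        moreover have "snd p \<in> carrier ?F"
          using F.M.a_closed[OF u(1) ms] by (simp add: u(2) \<phi>_def)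
        ultimately show "p \<in> common_kernel R ?V H'" using CK by blast
      qed
      show "common_kernel R ?V H' \<subseteq> \<phi> ` carrier ?F"
      proof
        fix p assume "p \<in> common_kernel R ?V H'"
        then have p: "fst p \<in> ?K" "snd p \<in> carrier ?F" "\<kappa> (snd p) = \<zero>\<^bsub>B\<^esub>" using CK by blast+
        \<comment> \<open>adding \<open>\<sigma> (fst p)\<close> undoes the subtraction in \<open>\<phi>\<close>\<close>
        let ?w = "\<sigma> (fst p) \<oplus>\<^bsub>?F\<^esub> snd p"
        have s: "\<sigma> (fst p) \<in> carrier ?F" by (rule \<sigma>F[OF p(1)])
        have w: "?w \<in> carrier ?F" by (rule F.M.a_closed[OF s p(2)])
        have "\<kappa> ?w = \<kappa> (\<sigma> (fst p)) \<oplus>\<^bsub>B\<^esub> \<kappa> (snd p)" by (rule linear_on_add[OF \<kappa> s p(2)])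
        then have \<kappa>w: "\<kappa> ?w = fst p" using \<kappa>\<sigma>[OF p(1)] p(1,3) KB by auto
        have "(?w \<oplus>\<^bsub>?F\<^esub> (\<ominus> \<one>) \<odot>\<^bsub>?F\<^esub> \<sigma> (fst p)) x = snd p x" for x
          using Fc[OF s, of x] Fc[OF p(2), of x]
          by (simp add: B.R.l_minus B.R.a_ac B.R.r_neg1 B.R.r_neg2 B.R.r_neg)
        then have "\<phi> ?w = p"
          unfolding \<phi>_def \<kappa>w by (simp only: prod_eq_iff fst_conv snd_conv) (simp add: fun_eq_iff)
        then show "p \<in> \<phi> ` carrier ?F" using w by (metis imageI)
      qed
    qed
  qed
  then obtain \<rho> where \<rho>: "linear_on R ?V (carrier ?V) ?V \<rho>"
    "\<And>p. p \<in> carrier ?V \<Longrightarrow> \<rho> p \<in> common_kernel R ?V H'"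
    "\<And>p. p \<in> common_kernel R ?V H' \<Longrightarrow> \<rho> p = p" by blast
  let ?i = "\<lambda>x. (x, \<zero>\<^bsub>?F\<^esub>)"
  have i: "linear_on R B (carrier B) ?V ?i"
    using F.M.zero_closed by (simp add: linear_on_def)
  have iV: "?i x \<in> carrier ?V" if "x \<in> carrier B" for x
    by (rule linear_on_closed[OF i that])
  have \<rho>i: "linear_on R B (carrier B) ?V (\<lambda>x. \<rho> (?i x))"
    by (rule linear_on_comp[OF i iV \<rho>(1)])
  have "linear_on R B (carrier B) B (\<lambda>x. fst (\<rho> (?i x)))"
    by (rule linear_on_comp[OF \<rho>i linear_on_closed[OF \<rho>i] linear_on_fst])
  moreover have "fst (\<rho> (?i x)) \<in> ?K" if "x \<in> carrier B" for x
    using \<rho>(2)[OF iV[OF that]] CK by blast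
  moreover have "fst (\<rho> (?i x)) = x" if x: "x \<in> ?K" for x
  proof -
    have "?i x \<in> common_kernel R ?V H'"
      unfolding CK using x F.M.zero_closed linear_on_zero[OF F B F.carrier_is_submodule \<kappa>] by simp
    then show ?thesis using \<rho>(3) by simp
  qed
  ultimately show ?thesis by (intro exI[of _ "\<lambda>x. fst (\<rho> (?i x))"]) simp
qed


section \<open>Projective modules and dual bases\<close>

lemma linear_image_submodule:
  assumes "module R M" "module R N" "linear_on R M (carrier M) N f"
  shows "submodule (f ` carrier M) R N"
proof -
  interpret M: module R M by fact
  interpret N: module R N by fact
  note closed = linear_on_closed[OF assms(3)]
  have smult: "a \<odot>\<^bsub>N\<^esub> y \<in> f ` carrier M" if a: "a \<in> carrier R" and y: "y \<in> f ` carrier M" for a y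
  proof -
    obtain x where x: "x \<in> carrier M" "y = f x" using y by blast
    have "a \<odot>\<^bsub>N\<^esub> y = f (a \<odot>\<^bsub>M\<^esub> x)" using linear_on_smult[OF assms(3) a x(1)] x(2) by simp
    then show ?thesis using M.smult_closed[OF a x(1)] by simp
  qed
  show ?thesis
  proof (rule N.submoduleI)
    show "f ` carrier M \<subseteq> carrier N" using closed by blast
    have "f \<zero>\<^bsub>M\<^esub> = \<zero>\<^bsub>N\<^esub>" by (rule linear_on_zero[OF assms(1,2) M.carrier_is_submodule assms(3)])
    then show "\<zero>\<^bsub>N\<^esub> \<in> f ` carrier M" by (metis M.zero_closed imageI)
    show "\<ominus>\<^bsub>N\<^esub> y \<in> f ` carrier M" if "y \<in> f ` carrier M" for y
    proof -
      have "y \<in> carrier N" using that closed by blast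
      then show ?thesis using smult[OF _ that, of "\<ominus>\<^bsub>R\<^esub> \<one>\<^bsub>R\<^esub>"] by (simp add: N.smult_l_minus)
    qed
    show "y \<oplus>\<^bsub>N\<^esub> z \<in> f ` carrier M" if yz: "y \<in> f ` carrier M" "z \<in> f ` carrier M" for y z
    proof -
      obtain u w where uw: "u \<in> carrier M" "y = f u" "w \<in> carrier M" "z = f w" using yz by blast
      have "y \<oplus>\<^bsub>N\<^esub> z = f (u \<oplus>\<^bsub>M\<^esub> w)" using linear_on_add[OF assms(3) uw(1,3)] uw by simp
      then show ?thesis using M.M.a_closed[OF uw(1,3)] by simp
    qed
  qed (rule smult)
qed

text \<open>A section of the projection from the free module on a finite generating set expresses each element
  through the generators, with coefficients that are functionals.\<close>

lemma fg_projective_dual_basis: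
  fixes P :: "('a, 'p) module"
  assumes proj: "projective_module R P" and fg: "fg_module R P"
  obtains I :: "'p set" and b f where "dual_basis R P (carrier P) I b f"
proof -
  have P: "module R P" using fg by (simp add: fg_module_def)
  interpret P: module R P by (rule P)
  obtain A where A: "finite A" "A \<subseteq> carrier P"
    and gen: "\<And>N. submodule N R P \<Longrightarrow> A \<subseteq> N \<Longrightarrow> N = carrier P"
    using fg unfolding fg_module_def by metis
  let ?F = "free_module R A" and ?\<epsilon> = "linear_extension R A P (\<lambda>x. x)"
  have F: "module R ?F" by (rule free_module_module[OF P.R.is_cring])
  have incl: "(\<lambda>x. x) \<in> A \<rightarrow> carrier P" using A(2) by blast
  have \<epsilon>: "?\<epsilon> \<in> module_hom R ?F P" by (rule linear_extension_hom[OF P incl])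
  have \<epsilon>_sum: "?\<epsilon> u = (\<Oplus>\<^bsub>P\<^esub>a\<in>A. u a \<odot>\<^bsub>P\<^esub> a)" if u: "u \<in> carrier ?F" for u
    by (rule linear_extension_finite[OF P incl u A(1)]) (use free_module_memD(2)[OF u] in auto)
  have "A \<subseteq> ?\<epsilon> ` carrier ?F"
  proof
    fix a assume a: "a \<in> A"
    have aP: "x \<in> carrier P" if "x \<in> A" for x using that A(2) by blast
    have "?\<epsilon> (unit_vector R a) = (\<Oplus>\<^bsub>P\<^esub>x\<in>A. if a = x then x else \<zero>\<^bsub>P\<^esub>)"
      unfolding \<epsilon>_sum[OF P.R.unit_vector_mem[OF a]]
      by (rule P.M.finsum_cong') (use aP in \<open>auto simp: unit_vector_def\<close>)
    also have "\<dots> = a" by (rule P.M.finsum_singleton[OF a A(1)]) (rule incl)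
    finally show "a \<in> ?\<epsilon> ` carrier ?F" using P.R.unit_vector_mem[OF a] by (metis imageI)
  qed
  then have surj: "?\<epsilon> ` carrier ?F = carrier P"
    by (rule gen[OF linear_image_submodule[OF F P module_hom_linear_on[OF \<epsilon>]]])
  have "lifts_along R P ?F P" by (rule projective_module_lifts[OF proj F P])
  moreover have "(\<lambda>x\<in>carrier P. x) \<in> module_hom R P P" by (auto simp: module_hom_def)
  ultimately obtain s where s: "s \<in> module_hom R P ?F"
    and \<epsilon>s: "\<forall>x\<in>carrier P. ?\<epsilon> (s x) = (\<lambda>x\<in>carrier P. x) x"
    using \<epsilon> surj unfolding lifts_along_def by blast
  have sF: "s x \<in> carrier ?F" if "x \<in> carrier P" for x by (rule module_hom_closed[OF s that])
  have "dual_basis R P (carrier P) A (\<lambda>a. a) (\<lambda>a x. s x a)"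
    unfolding dual_basis_def
  proof (intro conjI ballI A(1))
    show "a \<in> carrier P" if "a \<in> A" for a using that A(2) by blast
    show "functional_on R P (carrier P) (\<lambda>x. s x a)" for a
      by (rule linear_on_comp[OF module_hom_linear_on[OF s] sF P.R.coordinate_functional])
    show "x = (\<Oplus>\<^bsub>P\<^esub>a\<in>A. s x a \<odot>\<^bsub>P\<^esub> a)" if "x \<in> carrier P" for x
      using \<epsilon>s \<epsilon>_sum[OF sF[OF that]] that by simp
  qed
  then show thesis by (rule that)
qed

text \<open>Only the elements of the dual basis need to be lifted; the functionals extend the lift linearly.\<close>

lemma dual_basis_lifts:
  assumes Q: "module R Q" and D: "dual_basis R Q (carrier Q) I b f"
    and M: "module R M" and N: "module R N"
  shows "lifts_along R Q M N"
proof -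
  interpret Q: module R Q by fact
  note D = dual_basisD[OF D]
  show ?thesis
    unfolding lifts_along_def
  proof (intro ballI impI)
    interpret M: module R M by (rule M)
    interpret N: module R N by (rule N)
    fix g \<phi> assume g: "g \<in> module_hom R M N" "g ` carrier M = carrier N" and \<phi>: "\<phi> \<in> module_hom R Q N"
    note gl = module_hom_linear_on[OF g(1)] and \<phi>l = module_hom_linear_on[OF \<phi>]
    have "\<exists>c. \<forall>i\<in>I. c i \<in> carrier M \<and> g (c i) = \<phi> (b i)"
    proof (rule bchoice, rule ballI)
      fix i assume "i \<in> I"
      then have "\<phi> (b i) \<in> g ` carrier M" using module_hom_closed[OF \<phi> D(2)] g(2) by simp
      then show "\<exists>y. y \<in> carrier M \<and> g y = \<phi> (b i)" by (metis imageE)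
    qed
    then obtain c where c: "\<And>i. i \<in> I \<Longrightarrow> c i \<in> carrier M" "\<And>i. i \<in> I \<Longrightarrow> g (c i) = \<phi> (b i)" by metis
    define h where "h x = (\<Oplus>\<^bsub>M\<^esub>i\<in>I. f i x \<odot>\<^bsub>M\<^esub> c i)" for x
    have h: "linear_on R Q (carrier Q) M h"
      unfolding h_def by (rule linear_on_sum[OF M D(1)])
        (rule linear_on_functional_smult[OF M D(3) c(1)])
    have "g (h x) = \<phi> x" if x: "x \<in> carrier Q" for x
    proof -
      have fx: "f i x \<in> carrier R" if "i \<in> I" for i
        using linear_on_closed[OF D(3)[OF that] x] by simp
      have "g (h x) = (\<Oplus>\<^bsub>N\<^esub>i\<in>I. g (f i x \<odot>\<^bsub>M\<^esub> c i))"
        unfolding h_def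
        by (rule linear_on_finsum[OF M N M.carrier_is_submodule gl D(1)]) (use fx c(1) in auto)
      also have "\<dots> = (\<Oplus>\<^bsub>N\<^esub>i\<in>I. \<phi> (f i x \<odot>\<^bsub>Q\<^esub> b i))"
      proof (rule N.M.finsum_cong')
        show "g (f i x \<odot>\<^bsub>M\<^esub> c i) = \<phi> (f i x \<odot>\<^bsub>Q\<^esub> b i)" if "i \<in> I" for i
          using linear_on_smult[OF gl fx[OF that] c(1)[OF that]]
            linear_on_smult[OF \<phi>l fx[OF that] D(2)[OF that]] c(2)[OF that] by simp
      qed (use fx D(2) linear_on_closed[OF \<phi>l] in auto)
      also have "\<dots> = \<phi> (\<Oplus>\<^bsub>Q\<^esub>i\<in>I. f i x \<odot>\<^bsub>Q\<^esub> b i)"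
        by (rule linear_on_finsum[OF Q N Q.carrier_is_submodule \<phi>l D(1), symmetric])
          (use fx D(2) in auto)
      finally show ?thesis using D(4)[OF x] by simp
    qed
    then show "\<exists>h\<in>module_hom R Q M. \<forall>x\<in>carrier Q. g (h x) = \<phi> x"
      using linear_on_module_hom[OF Q h] by (intro bexI[of _ "restrict h (carrier Q)"]) simp_all
  qed
qed

lemma dual_basis_projective:
  assumes "module R Q" and "dual_basis R Q (carrier Q) I b f"
  shows "projective_module R Q"
  unfolding projective_module_def using assms(1) dual_basis_lifts[OF assms] by blast

lemma dual_basis_submodule:
  assumes M: "module R M" and K: "submodule K R M" and D: "dual_basis R M K I b f"
  shows "dual_basis R (M\<lparr>carrier := K\<rparr>) K I b f"
proof -
  let ?Q = "M\<lparr>carrier := K\<rparr>"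
  interpret M: module R M by fact
  note D = dual_basisD[OF D]
  have Q: "module R ?Q" by (rule submodule.submodule_is_module[OF K M])
  interpret Q: module R ?Q by (rule Q)
  have incl: "linear_on R ?Q (carrier ?Q) M (\<lambda>x. x)"
    using submodule_subset[OF K] by (auto simp: linear_on_def)
  have "x = (\<Oplus>\<^bsub>?Q\<^esub>i\<in>I. f i x \<odot>\<^bsub>?Q\<^esub> b i)" if x: "x \<in> K" for x
  proof -
    have fx: "f i x \<in> carrier R" if "i \<in> I" for i
      using linear_on_closed[OF D(3)[OF that] x] by simp
    have "(\<Oplus>\<^bsub>?Q\<^esub>i\<in>I. f i x \<odot>\<^bsub>?Q\<^esub> b i) = (\<Oplus>\<^bsub>M\<^esub>i\<in>I. f i x \<odot>\<^bsub>?Q\<^esub> b i)"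
      by (rule linear_on_finsum[OF Q M Q.carrier_is_submodule incl D(1)])
        (use fx D(2) submodule_smult[OF K] in auto)
    then show ?thesis using D(4)[OF x] by simp
  qed
  moreover have "functional_on R ?Q K (f i)" if "i \<in> I" for i
    using D(3)[OF that] by (simp add: linear_on_def)
  ultimately show ?thesis unfolding dual_basis_def using D(1,2) by (intro conjI ballI) simp_all
qed

text \<open>If \<open>\<rho>\<close> is a retraction onto the kernel of \<open>d\<close>, then \<open>x \<mapsto> x - \<rho> x\<close> depends only on \<open>d x\<close>. The resulting map \<open>s\<close>
  is a section of \<open>d\<close>, and it transports the dual basis to the image.\<close>

lemma image_dual_basis:
  fixes R (structure)
  assumes M: "module R M" and N: "module R N" and d: "linear_on R M (carrier M) N d"
    and D: "dual_basis R M (carrier M) I b f"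
    and \<rho>: "linear_on R M (carrier M) M \<rho>"
    and \<rho>_ker: "\<And>x. x \<in> carrier M \<Longrightarrow> d (\<rho> x) = \<zero>\<^bsub>N\<^esub>"
    and \<rho>_id: "\<And>x. x \<in> carrier M \<Longrightarrow> d x = \<zero>\<^bsub>N\<^esub> \<Longrightarrow> \<rho> x = x"
  shows "\<exists>f'. dual_basis R N (d ` carrier M) I (\<lambda>i. d (b i)) f'"
proof -
  interpret M: module R M by fact
  interpret N: module R N by fact
  note D = dual_basisD[OF D]
  define c where "c x = x \<oplus>\<^bsub>M\<^esub> (\<ominus> \<one>) \<odot>\<^bsub>M\<^esub> \<rho> x" for x
  have id: "linear_on R M (carrier M) M (\<lambda>x. x)" by (rule linear_onI) simp_all
  have c: "linear_on R M (carrier M) M c"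
    unfolding c_def by (intro linear_on_plus[OF M] linear_on_scale[OF M] id \<rho>) simp
  have cM: "c x \<in> carrier M" and \<rho>M: "\<rho> x \<in> carrier M" if "x \<in> carrier M" for x
    using linear_on_closed[OF c that] linear_on_closed[OF \<rho> that] by simp_all
  have dc: "d (c x) = d x" if x: "x \<in> carrier M" for x
    using linear_on_diff[OF M d x \<rho>M[OF x]] \<rho>_ker[OF x] linear_on_closed[OF d x] by (simp add: c_def)
  have c_cong: "c x = c y" if x: "x \<in> carrier M" and y: "y \<in> carrier M" and eq: "d x = d y" for x y
  proof (rule M.eq_if_diff_zero[OF cM[OF x] cM[OF y]])
    let ?z = "x \<oplus>\<^bsub>M\<^esub> (\<ominus> \<one>) \<odot>\<^bsub>M\<^esub> y"
    have z: "?z \<in> carrier M" using x y by simp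
    have "d ?z = \<zero>\<^bsub>N\<^esub>"
      using linear_on_diff[OF M d x y] linear_on_closed[OF d y]
      by (simp add: eq N.smult_l_minus N.M.r_neg)
    then have "\<rho> ?z = ?z" by (rule \<rho>_id[OF z])
    then have "c ?z = \<zero>\<^bsub>M\<^esub>" unfolding c_def[of ?z] using z by (simp add: M.smult_l_minus M.M.r_neg)
    then show "c x \<oplus>\<^bsub>M\<^esub> (\<ominus> \<one>) \<odot>\<^bsub>M\<^esub> c y = \<zero>\<^bsub>M\<^esub>" using linear_on_diff[OF M c x y] by simp
  qed
  define s where "s y = c (SOME x. x \<in> carrier M \<and> d x = y)" for y
  have s: "s (d x) = c x" if x: "x \<in> carrier M" for x
  proof -
    let ?x = "SOME u. u \<in> carrier M \<and> d u = d x"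
    have "?x \<in> carrier M \<and> d ?x = d x" by (rule someI[of _ x]) (use x in simp)
    then show ?thesis unfolding s_def using c_cong[OF _ x] by blast
  qed
  have sl: "linear_on R N (d ` carrier M) M s"
  proof (rule linear_onI)
    show "s y \<in> carrier M" if "y \<in> d ` carrier M" for y using that s cM by auto
    show "s (y \<oplus>\<^bsub>N\<^esub> z) = s y \<oplus>\<^bsub>M\<^esub> s z" if yz: "y \<in> d ` carrier M" "z \<in> d ` carrier M" for y z
    proof -
      obtain u w where uw: "u \<in> carrier M" "y = d u" "w \<in> carrier M" "z = d w" using yz by blast
      have "y \<oplus>\<^bsub>N\<^esub> z = d (u \<oplus>\<^bsub>M\<^esub> w)" using linear_on_add[OF d uw(1,3)] uw by simp
      then show ?thesis
        using s[OF M.M.a_closed[OF uw(1,3)]] s[OF uw(1)] s[OF uw(3)] linear_on_add[OF c uw(1,3)] uw by simp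
    qed
    show "s (a \<odot>\<^bsub>N\<^esub> y) = a \<odot>\<^bsub>M\<^esub> s y" if a: "a \<in> carrier R" and y: "y \<in> d ` carrier M" for a y
    proof -
      obtain u where u: "u \<in> carrier M" "y = d u" using y by blast
      have "a \<odot>\<^bsub>N\<^esub> y = d (a \<odot>\<^bsub>M\<^esub> u)" using linear_on_smult[OF d a u(1)] u by simp
      then show ?thesis
        using s[OF M.smult_closed[OF a u(1)]] s[OF u(1)] linear_on_smult[OF c a u(1)] u by simp
    qed
  qed
  have "dual_basis R N (d ` carrier M) I (\<lambda>i. d (b i)) (\<lambda>i y. f i (s y))"
    unfolding dual_basis_def
  proof (intro conjI ballI D(1))
    show "d (b i) \<in> d ` carrier M" if "i \<in> I" for i using D(2)[OF that] by (rule imageI)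
    show "functional_on R N (d ` carrier M) (\<lambda>y. f i (s y))" if "i \<in> I" for i
      by (rule linear_on_comp[OF sl linear_on_closed[OF sl] D(3)[OF that]])
    show "y = (\<Oplus>\<^bsub>N\<^esub>i\<in>I. f i (s y) \<odot>\<^bsub>N\<^esub> d (b i))" if y: "y \<in> d ` carrier M" for y
    proof -
      obtain x where x: "x \<in> carrier M" "y = d x" using y by blast
      have fx: "f i (c x) \<in> carrier R" if "i \<in> I" for i
        using linear_on_closed[OF D(3)[OF that] cM[OF x(1)]] by simp
      have "(\<Oplus>\<^bsub>N\<^esub>i\<in>I. f i (s y) \<odot>\<^bsub>N\<^esub> d (b i)) = (\<Oplus>\<^bsub>N\<^esub>i\<in>I. d (f i (c x) \<odot>\<^bsub>M\<^esub> b i))"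
      proof (rule N.M.finsum_cong')
        show "f i (s y) \<odot>\<^bsub>N\<^esub> d (b i) = d (f i (c x) \<odot>\<^bsub>M\<^esub> b i)" if "i \<in> I" for i
          using linear_on_smult[OF d fx[OF that] D(2)[OF that]] s[OF x(1)] x(2) by simp
      qed (use fx D(2) linear_on_closed[OF d] in auto)
      also have "\<dots> = d (\<Oplus>\<^bsub>M\<^esub>i\<in>I. f i (c x) \<odot>\<^bsub>M\<^esub> b i)"
        by (rule linear_on_finsum[OF M N M.carrier_is_submodule d D(1), symmetric])
          (use fx D(2) in auto)
      also have "\<dots> = y" using D(4)[OF cM[OF x(1)]] dc[OF x(1)] x(2) by simp
      finally show ?thesis by simp
    qed
  qed
  then show ?thesis by blast
qed


section \<open>Shortening projective resolutions\<close>

lemma dual_basis_kernel_common_kernel: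
  assumes N: "module R N" and D: "dual_basis R N (carrier N) J c g"
    and d: "linear_on R M (carrier M) N d"
  shows "common_kernel R M ((\<lambda>j x. g j (d x)) ` J) = {x \<in> carrier M. d x = \<zero>\<^bsub>N\<^esub>}"
proof -
  interpret N: module R N by fact
  note D = dual_basisD[OF D]
  have "(\<forall>j\<in>J. g j y = \<zero>\<^bsub>R\<^esub>) \<longleftrightarrow> y = \<zero>\<^bsub>N\<^esub>" if y: "y \<in> carrier N" for y
  proof
    assume 0: "\<forall>j\<in>J. g j y = \<zero>\<^bsub>R\<^esub>"
    have "y = (\<Oplus>\<^bsub>N\<^esub>j\<in>J. g j y \<odot>\<^bsub>N\<^esub> c j)" using D(4)[OF y] by simp
    also have "\<dots> = (\<Oplus>\<^bsub>N\<^esub>j\<in>J. \<zero>\<^bsub>N\<^esub>)"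
      by (rule N.M.finsum_cong') (use 0 D(2) in auto)
    finally show "y = \<zero>\<^bsub>N\<^esub>" by simp
  next
    assume "y = \<zero>\<^bsub>N\<^esub>"
    then show "\<forall>j\<in>J. g j y = \<zero>\<^bsub>R\<^esub>"
      using linear_on_zero[OF N N.R.regular_module_module N.carrier_is_submodule D(3)] by simp
  qed
  then show ?thesis
    using linear_on_closed[OF d] by (auto simp: common_kernel_def)
qed

text \<open>The functionals of a dual basis of \<open>N\<close>, composed with \<open>d\<close>, cut out the kernel of \<open>d\<close>. This is the
  splitting by which resolutions are shortened.\<close>

lemma strong_Prufer_kernel_retract:
  assumes SP: "strong_Prufer_ring R" and M: "module R M" and N: "module R N"
    and DM: "dual_basis R M (carrier M) I b f" and DN: "dual_basis R N (carrier N) J c g"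
    and d: "linear_on R M (carrier M) N d"
    and DK: "dual_basis R M {x \<in> carrier M. d x = \<zero>\<^bsub>N\<^esub>} L k h"
  shows "\<exists>\<rho>. linear_on R M (carrier M) M \<rho> \<and> (\<forall>x\<in>carrier M. d (\<rho> x) = \<zero>\<^bsub>N\<^esub>) \<and>
    (\<forall>x\<in>carrier M. d x = \<zero>\<^bsub>N\<^esub> \<longrightarrow> \<rho> x = x)"
proof -
  let ?H = "(\<lambda>j x. g j (d x)) ` J"
  have CK: "common_kernel R M ?H = {x \<in> carrier M. d x = \<zero>\<^bsub>N\<^esub>}"
    by (rule dual_basis_kernel_common_kernel[OF N DN d])
  have H: "functional_on R M (carrier M) h" if h: "h \<in> ?H" for h
  proof -
    obtain j where j: "j \<in> J" "h = (\<lambda>x. g j (d x))" using h by blast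
    show ?thesis unfolding j(2)
      by (rule linear_on_comp[OF d linear_on_closed[OF d] dual_basisD(3)[OF DN j(1)]])
  qed
  have "\<exists>\<rho>. linear_on R M (carrier M) M \<rho> \<and> (\<forall>x\<in>carrier M. \<rho> x \<in> common_kernel R M ?H) \<and>
    (\<forall>x\<in>common_kernel R M ?H. \<rho> x = x)"
    by (rule strong_Prufer_projective_retract[OF SP M DM H DK[folded CK]])
  then show ?thesis unfolding CK by blast
qed

text \<open>Going down from the left end of the resolution, the kernel in each \<open>P (m + 1)\<close> is a direct summand, and
  so its image in \<open>P m\<close>, which is the next kernel, is again finitely generated projective. The last of
  these steps ends with the kernel of the augmentation.\<close>

lemma strong_Prufer_first_syzygy_dual_basis:
  fixes P :: "nat \<Rightarrow> ('a, 'p) module"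
  assumes SP: "strong_Prufer_ring R" and res: "projective_resolution R M n P d e"
    and fg: "\<And>i. i \<le> n \<Longrightarrow> fg_module R (P i)" and n: "1 \<le> n"
  shows "\<exists>(I :: 'p set) b f. dual_basis R (P 0) (resolution_kernel M P d e 0) I b f"
proof -
  have P: "module R (P i)" if "i \<le> n" for i using fg[OF that] by (simp add: fg_module_def)
  have proj: "projective_module R (P i)" if "i \<le> n" for i
    using res that by (simp add: projective_resolution_def)
  have dl: "linear_on R (P (Suc i)) (carrier (P (Suc i))) (P i) (d i)" if "i < n" for i
    by (rule module_hom_linear_on) (use res that in \<open>simp add: projective_resolution_def\<close>)
  have exact: "d i ` carrier (P (Suc i)) = resolution_kernel M P d e i" if "i < n" for i
    using res that by (simp add: projective_resolution_def)
  \<comment> \<open>a split kernel in P (m + 1) makes the next kernel, in P m, projective\<close>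
  have syzygy: "\<exists>(I :: 'p set) b f. dual_basis R (P m) (resolution_kernel M P d e m) I b f"
    if m: "m < n" and ret: "\<exists>\<rho>. linear_on R (P (Suc m)) (carrier (P (Suc m))) (P (Suc m)) \<rho> \<and>
        (\<forall>x\<in>carrier (P (Suc m)). d m (\<rho> x) = \<zero>\<^bsub>P m\<^esub>) \<and>
        (\<forall>x\<in>carrier (P (Suc m)). d m x = \<zero>\<^bsub>P m\<^esub> \<longrightarrow> \<rho> x = x)" for m
  proof -
    have le: "Suc m \<le> n" "m \<le> n" using m by simp_all
    obtain I :: "'p set" and b f where D: "dual_basis R (P (Suc m)) (carrier (P (Suc m))) I b f"
      by (rule fg_projective_dual_basis[OF proj[OF le(1)] fg[OF le(1)]])
    obtain \<rho> where \<rho>: "linear_on R (P (Suc m)) (carrier (P (Suc m))) (P (Suc m)) \<rho>"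
      "\<And>x. x \<in> carrier (P (Suc m)) \<Longrightarrow> d m (\<rho> x) = \<zero>\<^bsub>P m\<^esub>"
      "\<And>x. x \<in> carrier (P (Suc m)) \<Longrightarrow> d m x = \<zero>\<^bsub>P m\<^esub> \<Longrightarrow> \<rho> x = x"
      using ret by auto
    show ?thesis
      using image_dual_basis[OF P[OF le(1)] P[OF le(2)] dl[OF m] D \<rho>] unfolding exact[OF m] by blast
  qed
  have "\<exists>\<rho>. linear_on R (P (Suc 0)) (carrier (P (Suc 0))) (P (Suc 0)) \<rho> \<and>
        (\<forall>x\<in>carrier (P (Suc 0)). d 0 (\<rho> x) = \<zero>\<^bsub>P 0\<^esub>) \<and>
        (\<forall>x\<in>carrier (P (Suc 0)). d 0 x = \<zero>\<^bsub>P 0\<^esub> \<longrightarrow> \<rho> x = x)"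
  proof -
    obtain n' where n': "n = Suc n'" using n by (cases n) auto
    have "0 \<le> n'" by simp
    then show ?thesis
    proof (induction rule: inc_induct)
      case base
      interpret Q: module R "P (Suc n')" by (rule P) (simp add: n')
      interpret N: module R "P n'" by (rule P) (simp add: n')
      have "resolution_kernel M P d e n = {\<zero>\<^bsub>P n\<^esub>}"
        using res by (simp add: projective_resolution_def)
      then have ker: "{x \<in> carrier (P (Suc n')). d n' x = \<zero>\<^bsub>P n'\<^esub>} = {\<zero>\<^bsub>P (Suc n')\<^esub>}"
        by (simp add: n' resolution_kernel_def)
      have 0: "x = \<zero>\<^bsub>P (Suc n')\<^esub>" if "x \<in> carrier (P (Suc n'))" "d n' x = \<zero>\<^bsub>P n'\<^esub>" for x
      proof -
        have "x \<in> {x \<in> carrier (P (Suc n')). d n' x = \<zero>\<^bsub>P n'\<^esub>}" using that by simp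
        then show ?thesis unfolding ker by simp
      qed
      have "d n' \<zero>\<^bsub>P (Suc n')\<^esub> = \<zero>\<^bsub>P n'\<^esub>"
        by (rule linear_on_zero[OF Q.module_axioms N.module_axioms Q.carrier_is_submodule dl])
          (simp add: n')
      then show ?case
        using linear_on_zero_map[OF Q.module_axioms] 0
        by (intro exI[of _ "\<lambda>x. \<zero>\<^bsub>P (Suc n')\<^esub>"]) (simp add: eq_commute)
    next
      case (step m)
      have m: "Suc m < n" "m < n" "Suc m \<le> n" "m \<le> n" using step.hyps by (simp_all add: n')
      obtain L :: "'p set" and k h where DK:
        "dual_basis R (P (Suc m)) {x \<in> carrier (P (Suc m)). d m x = \<zero>\<^bsub>P m\<^esub>} L k h"
        using syzygy[OF m(1) step.IH] by (auto simp: resolution_kernel_def)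
      obtain I :: "'p set" and b f where DM: "dual_basis R (P (Suc m)) (carrier (P (Suc m))) I b f"
        by (rule fg_projective_dual_basis[OF proj[OF m(3)] fg[OF m(3)]])
      obtain J :: "'p set" and c g where DN: "dual_basis R (P m) (carrier (P m)) J c g"
        by (rule fg_projective_dual_basis[OF proj[OF m(4)] fg[OF m(4)]])
      show ?case
        by (rule strong_Prufer_kernel_retract[OF SP P[OF m(3)] P[OF m(4)] DM DN dl[OF m(2)] DK])
    qed
  qed
  moreover have "0 < n" using n by simp
  ultimately show ?thesis by (intro syzygy)
qed

text \<open>The first syzygy stays inside \<open>P 0\<close>, so the shortened resolution uses the same type of elements.\<close>

lemma projective_resolution_by_first_syzygy:
  fixes P :: "nat \<Rightarrow> ('a, 'p) module"
  assumes res: "projective_resolution R M n P d e" and M: "module R M" and P0: "module R (P 0)"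
    and D: "dual_basis R (P 0) (resolution_kernel M P d e 0) I b f"
  defines "K \<equiv> resolution_kernel M P d e 0"
  shows "projective_resolution R M 1 (\<lambda>i. if i = 0 then P 0 else (P 0)\<lparr>carrier := K\<rparr>) (\<lambda>i. \<lambda>x\<in>K. x) e"
proof -
  interpret P0: module R "P 0" by fact
  have e: "e \<in> module_hom R (P 0) M" "e ` carrier (P 0) = carrier M" "projective_module R (P 0)"
    using res by (simp_all add: projective_resolution_def)
  have K_eq: "K = {x \<in> carrier (P 0). e x = \<zero>\<^bsub>M\<^esub>}" by (simp add: K_def resolution_kernel_def)
  have K: "submodule K R (P 0)"
    unfolding K_eq by (rule linear_kernel_submodule[OF P0 M module_hom_linear_on[OF e(1)]])
  let ?Q = "(P 0)\<lparr>carrier := K\<rparr>"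
  have Q: "module R ?Q" by (rule submodule.submodule_is_module[OF K P0])
  have "projective_module R ?Q"
    by (rule dual_basis_projective[OF Q]) (use dual_basis_submodule[OF P0 K D[folded K_def]] in simp)
  moreover have "(\<lambda>x\<in>K. x) \<in> module_hom R ?Q (P 0)"
    using submodule_subset[OF K] submodule_add[OF K] submodule_smult[OF K]
    by (auto simp: module_hom_def)
  moreover have "(\<lambda>x\<in>K. x) ` K = K" by simp
  moreover have "{x \<in> K. (\<lambda>x\<in>K. x) x = \<zero>\<^bsub>P 0\<^esub>} = {\<zero>\<^bsub>P 0\<^esub>}"
    using submodule_zero[OF K] by auto
  ultimately show ?thesis
    unfolding projective_resolution_def using e
    by (auto simp: resolution_kernel_def K_eq le_Suc_eq)
qed

lemma strong_Prufer_projective_dimension_le_1: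
  fixes M :: "('a, 'm) module"
  assumes SP: "strong_Prufer_ring R" and fin: "has_finite_projective_resolution R M"
  shows "projective_dimension R M \<le> 1"
proof -
  obtain n and P :: "nat \<Rightarrow> ('a, ('a + 'm) list) module" and d e where M: "module R M"
    and res: "projective_resolution R M n P d e" and fg: "\<And>i. i \<le> n \<Longrightarrow> fg_module R (P i)"
    using fin unfolding has_finite_projective_resolution_def by auto
  have le: "projective_dimension R M \<le> enat k"
    if "projective_resolution R M k Q d' e'" for k and Q :: "nat \<Rightarrow> ('a, ('a + 'm) list) module" and d' e'
    unfolding projective_dimension_def by (rule Inf_lower) (use that in blast)
  show ?thesis
  proof (cases "n = 0")
    case True
    then show ?thesis using le[OF res] by (simp add: zero_enat_def[symmetric])
  next
    case False
    then obtain I :: "('a + 'm) list set" and b f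
      where D: "dual_basis R (P 0) (resolution_kernel M P d e 0) I b f"
      using strong_Prufer_first_syzygy_dual_basis[OF SP res fg] by auto
    have "module R (P 0)" using fg[of 0] by (simp add: fg_module_def)
    then show ?thesis
      using le[OF projective_resolution_by_first_syzygy[OF res M _ D]] by (simp add: one_enat_def)
  qed
qed


section \<open>GV-ideals\<close>

lemma hom_group_simps [simp]:
  "carrier (hom_group R M N) = module_hom R M N"
  "f \<otimes>\<^bsub>hom_group R M N\<^esub> g = (\<lambda>x\<in>carrier M. f x \<oplus>\<^bsub>N\<^esub> g x)"
  "\<one>\<^bsub>hom_group R M N\<^esub> = (\<lambda>x\<in>carrier M. \<zero>\<^bsub>N\<^esub>)"
  by (simp_all add: hom_group_def)

lemma module_hom_extensional: "f \<in> module_hom R M N \<Longrightarrow> f \<in> extensional (carrier M)"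
  by (simp add: module_hom_def PiE_iff)

lemma hom_group_group:
  assumes M: "module R M" and N: "module R N"
  shows "group (hom_group R M N)"
proof -
  interpret M: module R M by fact
  interpret N: module R N by fact
  note lin = module_hom_linear_on and ext = module_hom_extensional
  show ?thesis
  proof (rule groupI)
    fix f g assume "f \<in> carrier (hom_group R M N)" "g \<in> carrier (hom_group R M N)"
    then show "f \<otimes>\<^bsub>hom_group R M N\<^esub> g \<in> carrier (hom_group R M N)"
      using linear_on_module_hom[OF M linear_on_plus[OF N lin lin]] by simp
  next
    show "\<one>\<^bsub>hom_group R M N\<^esub> \<in> carrier (hom_group R M N)"
      using linear_on_module_hom[OF M linear_on_zero_map[OF N]] by simp
  next
    fix f assume "f \<in> carrier (hom_group R M N)"
    then have f: "f \<in> module_hom R M N" by simp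
    have fN: "f x \<in> carrier N" if "x \<in> carrier M" for x by (rule module_hom_closed[OF f that])
    show "\<one>\<^bsub>hom_group R M N\<^esub> \<otimes>\<^bsub>hom_group R M N\<^esub> f = f"
      by (rule extensionalityI[OF _ ext[OF f]]) (use fN in auto)
    let ?g = "restrict (\<lambda>x. (\<ominus>\<^bsub>R\<^esub> \<one>\<^bsub>R\<^esub>) \<odot>\<^bsub>N\<^esub> f x) (carrier M)"
    have "?g \<in> module_hom R M N"
      by (rule linear_on_module_hom[OF M linear_on_scale[OF N lin[OF f]]]) simp
    moreover have "?g \<otimes>\<^bsub>hom_group R M N\<^esub> f = \<one>\<^bsub>hom_group R M N\<^esub>"
      by (rule extensionalityI[of _ "carrier M"])
        (use fN in \<open>auto simp: N.smult_l_minus N.M.l_neg\<close>)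
    ultimately show "\<exists>g\<in>carrier (hom_group R M N). g \<otimes>\<^bsub>hom_group R M N\<^esub> f = \<one>\<^bsub>hom_group R M N\<^esub>"
      by (intro bexI[of _ ?g]) simp_all
  next
    fix f g h
    assume "f \<in> carrier (hom_group R M N)" "g \<in> carrier (hom_group R M N)" "h \<in> carrier (hom_group R M N)"
    then have "f x \<in> carrier N" "g x \<in> carrier N" "h x \<in> carrier N" if "x \<in> carrier M" for x
      using that by (auto intro: module_hom_closed)
    then show "f \<otimes>\<^bsub>hom_group R M N\<^esub> g \<otimes>\<^bsub>hom_group R M N\<^esub> h =
        f \<otimes>\<^bsub>hom_group R M N\<^esub> (g \<otimes>\<^bsub>hom_group R M N\<^esub> h)"
      by (intro extensionalityI[of _ "carrier M"]) (auto simp: N.M.a_assoc)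
  qed
qed

lemma quotient_module_simps [simp]:
  "carrier (quotient_module R J) = carrier (R Quot J)"
  "\<zero>\<^bsub>quotient_module R J\<^esub> = J"
  "B \<oplus>\<^bsub>quotient_module R J\<^esub> C = B \<oplus>\<^bsub>R Quot J\<^esub> C"
  "a \<odot>\<^bsub>quotient_module R J\<^esub> B = rcoset_mult R J (J +>\<^bsub>R\<^esub> a) B"
  by (simp_all add: quotient_module_def ring.defs FactRing_def)

lemma (in ideal) quotient_carrier: "carrier (R Quot I) = (+>) I ` carrier R"
  by (auto simp: FactRing_def A_RCOSETS_defs a_r_coset_def r_coset_def)

lemma (in ideal) quotient_add:
  "x \<in> carrier R \<Longrightarrow> y \<in> carrier R \<Longrightarrow> (I +> x) \<oplus>\<^bsub>R Quot I\<^esub> (I +> y) = I +> (x \<oplus> y)"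
  by (simp add: FactRing_def a_rcos_sum)

lemma (in ideal) quotient_module_module:
  assumes "cring R"
  shows "module R (quotient_module R I)"
proof -
  interpret R: cring R by fact
  interpret Q: ring "R Quot I" by (rule quotient_is_ring)
  have z: "\<zero>\<^bsub>R Quot I\<^esub> = I" by (simp add: FactRing_def)
  have "abelian_group (quotient_module R I)"
  proof (rule abelian_groupI)
    fix B assume "B \<in> carrier (quotient_module R I)"
    then show "\<exists>C\<in>carrier (quotient_module R I). C \<oplus>\<^bsub>quotient_module R I\<^esub> B = \<zero>\<^bsub>quotient_module R I\<^esub>"
      using Q.l_neg z by (intro bexI[of _ "\<ominus>\<^bsub>R Quot I\<^esub> B"]) simp_all
  qed (use Q.zero_closed Q.l_zero z in \<open>auto simp: Q.a_ac\<close>)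
  then show ?thesis
    by (intro moduleI R.is_cring)
      (auto simp: quotient_carrier quotient_add rcoset_mult_add l_distr r_distr m_assoc)
qed

lemma (in ideal) quotient_map_linear:
  "linear_on R (regular_module R) (carrier R) (quotient_module R I) ((+>) I)"
  by (auto simp: linear_on_def quotient_carrier quotient_add rcoset_mult_add)

lemma (in ideal) coset_representatives:
  obtains c where "\<And>B. B \<in> carrier (R Quot I) \<Longrightarrow> c B \<in> carrier R \<and> I +> c B = B"
    and "c (I +> \<one>) = \<one>"
proof -
  have "\<forall>B\<in>carrier (R Quot I). \<exists>x. x \<in> carrier R \<and> I +> x = B"
    by (auto simp: quotient_carrier)
  then obtain c' where c': "\<forall>B\<in>carrier (R Quot I). c' B \<in> carrier R \<and> I +> c' B = B"
    by (rule bchoice[THEN exE])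
  show thesis
    by (rule that[of "c'(I +> \<one> := \<one>)"]) (use c' in auto)
qed

text \<open>The zero element of \<open>Ext\<^sup>1\<close> is the image of the restriction map, so a trivial \<open>Ext\<^sup>1\<close> says that
  this image is everything.\<close>

lemma Ext1_trivial_extension:
  assumes M: "module R M" and N: "module R N"
    and triv: "carrier (Ext1 R M N) = {\<one>\<^bsub>Ext1 R M N\<^esub>}"
    and \<psi>: "\<psi> \<in> module_hom R (presentation_kernel R M) N"
  obtains \<eta> where "\<eta> \<in> module_hom R (free_module R (carrier M)) N"
    and "\<And>u. u \<in> carrier (presentation_kernel R M) \<Longrightarrow> \<psi> u = \<eta> u"
proof -
  interpret M: module R M by fact
  interpret N: module R N by fact
  let ?K = "presentation_kernel R M" and ?F = "free_module R (carrier M)"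
  let ?G = "hom_group R ?K N"
  define S where "S = (\<lambda>f. restrict f (carrier ?K)) ` module_hom R ?F N"
  have F: "module R ?F" by (rule free_module_module[OF M.R.is_cring])
  have KF: "carrier ?K \<subseteq> carrier ?F" by (auto simp: presentation_kernel_def)
  have E: "Ext1 R M N = ?G Mod S" by (simp add: Ext1_def S_def)
  have "S #>\<^bsub>?G\<^esub> \<psi> \<in> carrier (?G Mod S)"
    using \<psi> by (auto simp: FactGroup_def RCOSETS_def)
  then have coset: "S #>\<^bsub>?G\<^esub> \<psi> = S" using triv by (simp add: E FactGroup_def)
  have "restrict (\<lambda>x. \<zero>\<^bsub>N\<^esub>) (carrier ?F) \<in> module_hom R ?F N"
    by (rule linear_on_module_hom[OF F linear_on_zero_map[OF N]])
  moreover have "restrict (restrict (\<lambda>x. \<zero>\<^bsub>N\<^esub>) (carrier ?F)) (carrier ?K) = \<one>\<^bsub>?G\<^esub>"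
    using KF by (auto simp: restrict_def fun_eq_iff)
  ultimately have "\<one>\<^bsub>?G\<^esub> \<in> S" unfolding S_def by (metis imageI)
  then have "\<one>\<^bsub>?G\<^esub> \<otimes>\<^bsub>?G\<^esub> \<psi> \<in> S #>\<^bsub>?G\<^esub> \<psi>" unfolding r_coset_def by blast
  moreover have "\<one>\<^bsub>?G\<^esub> \<otimes>\<^bsub>?G\<^esub> \<psi> = \<psi>"
    by (rule extensionalityI[OF _ module_hom_extensional[OF \<psi>]])
      (use module_hom_closed[OF \<psi>] in auto)
  ultimately have "\<psi> \<in> S" unfolding coset by simp
  then obtain \<eta> where \<eta>: "\<eta> \<in> module_hom R ?F N" "\<psi> = restrict \<eta> (carrier ?K)"
    unfolding S_def by blast
  show thesis by (rule that[OF \<eta>(1)]) (simp add: \<eta>(2))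
qed

text \<open>Choosing a representative \<open>c B\<close> of each coset \<open>B\<close> lifts the presentation \<open>F \<rightarrow> R/J\<close> to a map \<open>F \<rightarrow> R\<close> that
  sends the presentation kernel into \<open>J\<close>. So \<open>h\<close> yields a map on the kernel, which extends to some
  \<open>\<eta>\<close> on \<open>F\<close>. With \<open>\<delta>\<close> the basis vector at the coset of \<open>1\<close>, the multiple \<open>y \<delta>\<close> lies in the kernel for
  \<open>y \<in> J\<close>, and \<open>h y = \<eta> (y \<delta>) = y \<eta> \<delta>\<close>. This needs \<open>1\<close> as the representative of its own coset.\<close>

lemma Ext1_quotient_trivial_multiplication:
  fixes R (structure)
  assumes R: "cring R" and J: "ideal J R"
    and triv: "carrier (Ext1 R (quotient_module R J) (regular_module R)) =
      {\<one>\<^bsub>Ext1 R (quotient_module R J) (regular_module R)\<^esub>}"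
    and h: "functional_on R (regular_module R) J h"
  shows "\<exists>r\<in>carrier R. \<forall>y\<in>J. h y = y \<otimes> r"
proof -
  interpret R: cring R by fact
  interpret J: ideal J R by fact
  let ?Q = "quotient_module R J" and ?R = "regular_module R"
  let ?F = "free_module R (carrier ?Q)" and ?K = "presentation_kernel R ?Q"
  let ?\<pi> = "linear_extension R (carrier ?Q) ?Q (\<lambda>B. B)"
  have Q: "module R ?Q" by (rule J.quotient_module_module[OF R])
  interpret Q: module R ?Q by (rule Q)
  note reg = R.regular_module_module
  interpret S: module R ?R by (rule reg)
  have F: "module R ?F" by (rule free_module_module[OF R])
  interpret F: module R ?F by (rule F)
  obtain c where c: "\<And>B. B \<in> carrier (R Quot J) \<Longrightarrow> c B \<in> carrier R \<and> J +> c B = B"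
    and c1: "c (J +> \<one>) = \<one>" by (rule J.coset_representatives) (rule that)
  let ?L = "linear_extension R (carrier ?Q) ?R c"
  have cR: "c \<in> carrier ?Q \<rightarrow> carrier ?R" using c by simp
  have incl: "(\<lambda>B. B) \<in> carrier ?Q \<rightarrow> carrier ?Q" by simp
  have L: "linear_on R ?F (carrier ?F) ?R ?L"
    by (rule module_hom_linear_on[OF linear_extension_hom[OF reg cR]])
  have \<pi>: "linear_on R ?F (carrier ?F) ?Q ?\<pi>"
    by (rule module_hom_linear_on[OF linear_extension_hom[OF Q incl]])
  have K: "carrier ?K = {u \<in> carrier ?F. ?\<pi> u = J}"
    by (simp add: presentation_kernel_def)
  have \<pi>L: "?\<pi> u = J +> ?L u" if u: "u \<in> carrier ?F" for u
  proof -
    let ?A = "{B. u B \<noteq> \<zero>}"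
    have fin: "finite ?A" and A: "?A \<subseteq> carrier ?Q" using u by (auto simp: free_module_def)
    have uc: "u B \<in> carrier R" for B by (rule R.free_module_closed[OF u])
    have "J +> ?L u = J +> (\<Oplus>\<^bsub>?R\<^esub>B\<in>?A. u B \<odot>\<^bsub>?R\<^esub> c B)"
      by (simp only: linear_extension_finite[OF reg cR u fin order_refl A])
    also have "\<dots> = (\<Oplus>\<^bsub>?Q\<^esub>B\<in>?A. J +> (u B \<odot>\<^bsub>?R\<^esub> c B))"
      by (rule linear_on_finsum[OF reg Q S.carrier_is_submodule _ fin])
        (use J.quotient_map_linear uc c A in auto)
    also have "\<dots> = (\<Oplus>\<^bsub>?Q\<^esub>B\<in>?A. u B \<odot>\<^bsub>?Q\<^esub> B)"
    proof (rule Q.M.finsum_cong')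
      show "J +> (u B \<odot>\<^bsub>?R\<^esub> c B) = u B \<odot>\<^bsub>?Q\<^esub> B" if "B \<in> ?A" for B
      proof -
        have B: "c B \<in> carrier R" "J +> c B = B" using c[of B] A that by auto
        show ?thesis using J.rcoset_mult_add[OF uc B(1), of B] B(2) by simp
      qed
    qed (use A uc Q.smult_closed in blast)+
    also have "\<dots> = ?\<pi> u"
      by (rule linear_extension_finite[OF Q incl u fin order_refl A, symmetric])
    finally show ?thesis by simp
  qed
  have L_J: "?L u \<in> J" if u: "u \<in> carrier ?K" for u
  proof (rule J.rcos_const_imp_mem)
    show "?L u \<in> carrier R" using linear_on_closed[OF L, of u] u K by simp
    show "J +> ?L u = J" using \<pi>L[of u] u K by simp
  qed
  have Ksub: "submodule (carrier ?K) R ?F"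
    using linear_kernel_submodule[OF F Q \<pi>] unfolding K by simp
  have Kmod: "module R ?K"
    using submodule.submodule_is_module[OF Ksub F] by (simp add: presentation_kernel_def)
  have "linear_on R ?F (carrier ?K) ?R (\<lambda>u. h (?L u))"
    by (rule linear_on_comp[OF linear_on_subset[OF L submodule_subset[OF Ksub]] L_J h])
  then have "linear_on R ?K (carrier ?K) ?R (\<lambda>u. h (?L u))"
    by (simp add: linear_on_def presentation_kernel_def)
  from linear_on_module_hom[OF Kmod this]
  obtain \<eta> where \<eta>: "\<eta> \<in> module_hom R ?F ?R"
    and ext: "\<And>u. u \<in> carrier ?K \<Longrightarrow> restrict (\<lambda>u. h (?L u)) (carrier ?K) u = \<eta> u"
    by (rule Ext1_trivial_extension[OF Q reg triv]) (rule that)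
  note \<eta>l = module_hom_linear_on[OF \<eta>]
  let ?\<delta> = "unit_vector R (J +> \<one>)"
  have one: "J +> \<one> \<in> carrier ?Q" using J.quotient_carrier by simp
  have \<delta>: "?\<delta> \<in> carrier ?F" by (rule R.unit_vector_mem[OF one])
  have supp: "{B. ?\<delta> B \<noteq> \<zero>} \<subseteq> {J +> \<one>}" by (auto simp: unit_vector_def)
  have L\<delta>: "?L ?\<delta> = \<one>"
  proof -
    have "?L ?\<delta> = (\<Oplus>\<^bsub>?R\<^esub>B\<in>{J +> \<one>}. ?\<delta> B \<odot>\<^bsub>?R\<^esub> c B)"
      by (rule linear_extension_finite[OF reg cR \<delta> _ supp]) (use one in auto)
    then show ?thesis using c1 by (simp add: unit_vector_def)
  qed
  have "h y = y \<otimes> \<eta> ?\<delta>" if y: "y \<in> J" for y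
  proof -
    have yR: "y \<in> carrier R" by (rule J.Icarr[OF y])
    let ?u = "y \<odot>\<^bsub>?F\<^esub> ?\<delta>"
    have uF: "?u \<in> carrier ?F" by (rule F.smult_closed[OF yR \<delta>])
    have Lu: "?L ?u = y" using linear_on_smult[OF L yR \<delta>] L\<delta> yR by simp
    then have "?\<pi> ?u = J" using \<pi>L[OF uF] R.a_rcos_zero[OF J y] by simp
    then have "?u \<in> carrier ?K" using uF K by simp
    then have "h y = \<eta> ?u" using ext[of ?u] Lu by simp
    then show ?thesis using linear_on_smult[OF \<eta>l yR \<delta>] by simp
  qed
  moreover have "\<eta> ?\<delta> \<in> carrier R" using linear_on_closed[OF \<eta>l \<delta>] by simp
  ultimately show ?thesis by blast
qed

text \<open>An element \<open>r\<close> that annihilates \<open>J\<close> defines the linear map \<open>R/J \<rightarrow> R\<close> sending the coset of \<open>x\<close> to \<open>x r\<close>.\<close>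

lemma Hom_quotient_trivial_dense:
  fixes R (structure)
  assumes R: "cring R" and J: "ideal J R"
    and triv: "module_hom R (quotient_module R J) (regular_module R) =
      {\<lambda>B\<in>carrier (quotient_module R J). \<zero>}"
  shows "dense_ideal R J"
proof -
  interpret R: cring R by fact
  interpret J: ideal J R by fact
  let ?Q = "quotient_module R J" and ?R = "regular_module R"
  have Q: "module R ?Q" by (rule J.quotient_module_module[OF R])
  obtain c where c: "\<And>B. B \<in> carrier (R Quot J) \<Longrightarrow> c B \<in> carrier R \<and> J +> c B = B"
    and c1: "c (J +> \<one>) = \<one>" by (rule J.coset_representatives) (rule that)
  have qQ: "J +> x \<in> carrier (R Quot J)" if "x \<in> carrier R" for x
    using that J.quotient_carrier by simp
  have "r = \<zero>" if r: "r \<in> annihilator R J" for r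
  proof -
    have rR: "r \<in> carrier R" and ann: "\<And>x. x \<in> J \<Longrightarrow> x \<otimes> r = \<zero>"
      using r by (simp_all add: annihilator_def)
    have cq: "c (J +> x) \<otimes> r = x \<otimes> r" if x: "x \<in> carrier R" for x
    proof -
      have cx: "c (J +> x) \<in> carrier R" "J +> c (J +> x) = J +> x" using c[OF qQ[OF x]] by simp_all
      then have "c (J +> x) \<ominus> x \<in> J"
        using R.quotient_eq_iff_same_a_r_cos[OF J cx(1) x] by simp
      then have "(c (J +> x) \<ominus> x) \<otimes> r = \<zero>" by (rule ann)
      then have "r \<otimes> (c (J +> x) \<ominus> x) = \<zero>" using R.m_comm[OF rR] cx(1) x by simp
      then have "r \<otimes> c (J +> x) = r \<otimes> x" by (rule R.mult_minus_eq_zeroD) (use rR cx x in simp_all)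
      then show ?thesis using R.m_comm[OF rR cx(1)] R.m_comm[OF rR x] by simp
    qed
    have "linear_on R ?Q (carrier ?Q) ?R (\<lambda>B. c B \<otimes> r)"
    proof (rule linear_onI)
      show "c B \<otimes> r \<in> carrier ?R" if "B \<in> carrier ?Q" for B using c[of B] that rR by simp
      show "c (B \<oplus>\<^bsub>?Q\<^esub> C) \<otimes> r = c B \<otimes> r \<oplus>\<^bsub>?R\<^esub> c C \<otimes> r"
        if BC: "B \<in> carrier ?Q" "C \<in> carrier ?Q" for B C
      proof -
        obtain x y where xy: "x \<in> carrier R" "B = J +> x" "y \<in> carrier R" "C = J +> y"
          using BC J.quotient_carrier by auto
        show ?thesis
          using cq[of "x \<oplus> y"] cq[OF xy(1)] cq[OF xy(3)] xy rR
          by (simp add: J.quotient_add R.l_distr)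
      qed
      show "c (a \<odot>\<^bsub>?Q\<^esub> B) \<otimes> r = a \<odot>\<^bsub>?R\<^esub> (c B \<otimes> r)"
        if a: "a \<in> carrier R" and B: "B \<in> carrier ?Q" for a B
      proof -
        obtain x where x: "x \<in> carrier R" "B = J +> x" using B J.quotient_carrier by auto
        show ?thesis
          using cq[of "a \<otimes> x"] cq[OF x(1)] x a rR by (simp add: J.rcoset_mult_add R.m_assoc)
      qed
    qed
    from linear_on_module_hom[OF Q this]
    have "restrict (\<lambda>B. c B \<otimes> r) (carrier ?Q) = (\<lambda>B\<in>carrier ?Q. \<zero>)" unfolding triv by simp
    then have "restrict (\<lambda>B. c B \<otimes> r) (carrier ?Q) (J +> \<one>) = (\<lambda>B\<in>carrier ?Q. \<zero>) (J +> \<one>)"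
      by (rule fun_cong)
    then show "r = \<zero>" using qQ[of \<one>] c1 rR by simp
  qed
  moreover have "\<zero> \<in> annihilator R J" using J.Icarr by (simp add: annihilator_def)
  ultimately have "annihilator R J = {\<zero>}" by blast
  then show ?thesis using J by (simp add: dense_ideal_def)
qed

text \<open>If \<open>J \<subseteq> m\<close>, take \<open>a\<close> and \<open>s\<close> as in \<open>strong_Prufer_local_generator\<close> and let \<open>t y\<close> be any solution of
  \<open>t y a = s y\<close>. Two solutions agree after multiplication by \<open>s\<close>, so \<open>y \<mapsto> s (t y)\<close> is linear, and its value
  at \<open>a\<close> is \<open>s\<^sup>2\<close>.\<close>

lemma strong_Prufer_multiplication_trivial:
  fixes R (structure)
  assumes SP: "strong_Prufer_ring R" and fg: "fg_ideal R J" and dense: "dense_ideal R J"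
    and mult: "\<And>h. functional_on R (regular_module R) J h \<Longrightarrow> \<exists>r\<in>carrier R. \<forall>y\<in>J. h y = y \<otimes> r"
  shows "J = carrier R"
proof (rule ccontr)
  assume neq: "J \<noteq> carrier R"
  interpret R: cring R using SP by (simp add: strong_Prufer_ring_def)
  have idJ: "ideal J R" using dense by (simp add: dense_ideal_def)
  interpret J: ideal J R by (rule idJ)
  have "\<one> \<notin> J" using J.one_imp_carrier neq by auto
  then obtain m where m: "maximalideal m R" "J \<subseteq> m"
    using R.exists_maximal_ideal_above[OF idJ] by blast
  interpret m: primeideal m R by (rule R.maximalideal_prime[OF m(1)])
  obtain a s where a: "a \<in> J" and s: "s \<in> carrier R - m"
    and sJ: "\<And>x. x \<in> J \<Longrightarrow> \<exists>t\<in>carrier R. s \<otimes> x = t \<otimes> a"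
    and reg: "\<And>r. r \<in> carrier R \<Longrightarrow> r \<otimes> a = \<zero> \<Longrightarrow> r \<otimes> s = \<zero>"
    by (rule strong_Prufer_local_generator[OF SP fg dense m(1)]) (rule that)
  have aR: "a \<in> carrier R" and sR: "s \<in> carrier R" using J.Icarr[OF a] s by simp_all
  have cancel: "s \<otimes> z = s \<otimes> w"
    if z: "z \<in> carrier R" and w: "w \<in> carrier R" and eq: "z \<otimes> a = w \<otimes> a" for z w
  proof -
    have "(z \<ominus> w) \<otimes> a = \<zero>" using z w aR eq by (simp add: R.minus_eq R.l_distr R.l_minus R.r_neg)
    then have "(z \<ominus> w) \<otimes> s = \<zero>" using reg z w by simp
    then have "s \<otimes> (z \<ominus> w) = \<zero>" using R.m_comm[OF sR] z w by simp
    then show ?thesis by (rule R.mult_minus_eq_zeroD) (use sR z w in simp_all)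
  qed
  have "\<forall>y\<in>J. \<exists>t. t \<in> carrier R \<and> t \<otimes> a = s \<otimes> y" using sJ by force
  then obtain t where t: "\<forall>y\<in>J. t y \<in> carrier R \<and> t y \<otimes> a = s \<otimes> y"
    by (rule bchoice[THEN exE])
  then have tR: "t y \<in> carrier R" and ta: "t y \<otimes> a = s \<otimes> y" if "y \<in> J" for y using that by simp_all
  have "functional_on R (regular_module R) J (\<lambda>y. s \<otimes> t y)"
  proof (rule linear_onI)
    show "s \<otimes> t y \<in> carrier (regular_module R)" if "y \<in> J" for y using sR tR[OF that] by simp
    show "s \<otimes> t (y \<oplus>\<^bsub>regular_module R\<^esub> z) = s \<otimes> t y \<oplus>\<^bsub>regular_module R\<^esub> s \<otimes> t z"
      if y: "y \<in> J" and z: "z \<in> J" for y z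
    proof -
      have yz: "y \<oplus> z \<in> J" by (rule J.a_closed[OF y z])
      have "s \<otimes> t (y \<oplus> z) = s \<otimes> (t y \<oplus> t z)"
        by (rule cancel)
          (use tR[OF y] tR[OF z] tR[OF yz] ta[OF y] ta[OF z] ta[OF yz] aR sR J.Icarr[OF y] J.Icarr[OF z]
            in \<open>simp_all add: R.l_distr R.r_distr\<close>)
      then show ?thesis using sR tR[OF y] tR[OF z] by (simp add: R.r_distr)
    qed
    show "s \<otimes> t (b \<odot>\<^bsub>regular_module R\<^esub> y) = b \<odot>\<^bsub>regular_module R\<^esub> (s \<otimes> t y)"
      if b: "b \<in> carrier R" and y: "y \<in> J" for b y
    proof -
      have yb: "b \<otimes> y \<in> J" by (rule J.I_l_closed[OF y b])
      have "(b \<otimes> t y) \<otimes> a = b \<otimes> (s \<otimes> y)" using R.m_assoc[OF b tR[OF y] aR] ta[OF y] by simp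
      also have "\<dots> = s \<otimes> (b \<otimes> y)" by (rule R.m_lcomm[OF b sR J.Icarr[OF y]])
      finally have "s \<otimes> t (b \<otimes> y) = s \<otimes> (b \<otimes> t y)"
        by (intro cancel) (use tR[OF y] tR[OF yb] ta[OF yb] b in simp_all)
      then show ?thesis using R.m_lcomm[OF sR b tR[OF y]] by simp
    qed
  qed
  from mult[OF this] obtain r where r: "r \<in> carrier R" "s \<otimes> t a = a \<otimes> r" using a by auto
  have "s \<otimes> t a = s \<otimes> s" by (rule cancel[OF tR[OF a] sR ta[OF a]])
  then have "s \<otimes> s = a \<otimes> r" using r(2) by simp
  moreover have "a \<otimes> r \<in> m" using m.I_r_closed[of a r] a m(2) r(1) by blast
  ultimately show False using m.I_prime[OF sR sR] s by simp
qed

text \<open>The module \<open>R/R\<close> is zero, so its presentation kernel is the whole free module and every linear map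
  on it is its own extension.\<close>

lemma carrier_in_GV:
  fixes R (structure)
  assumes R: "cring R"
  shows "carrier R \<in> GV R"
proof -
  interpret R: cring R by fact
  have J: "ideal (carrier R) R" by (rule R.oneideal)
  interpret J: ideal "carrier R" R by (rule J)
  let ?Q = "quotient_module R (carrier R)" and ?R = "regular_module R"
  let ?F = "free_module R (carrier ?Q)" and ?K = "presentation_kernel R ?Q"
  have Q: "module R ?Q" by (rule J.quotient_module_module[OF R])
  note reg = R.regular_module_module
  interpret Q: module R ?Q by (rule Q)
  have F: "module R ?F" by (rule free_module_module[OF R])
  have Q0: "carrier ?Q = {\<zero>\<^bsub>?Q\<^esub>}"
    using R.a_rcos_zero[OF J] by (auto simp: J.quotient_carrier)
  have hom: "carrier (hom_group R ?Q ?R) = {\<one>\<^bsub>hom_group R ?Q ?R\<^esub>}"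
    unfolding hom_group_simps(1)
  proof (intro equalityI subsetI)
    fix f assume f: "f \<in> module_hom R ?Q ?R"
    have "f = \<one>\<^bsub>hom_group R ?Q ?R\<^esub>"
      by (rule extensionalityI[OF module_hom_extensional[OF f]])
        (use module_hom_zero[OF Q reg f] Q0 in \<open>auto simp del: quotient_module_simps\<close>)
    then show "f \<in> {\<one>\<^bsub>hom_group R ?Q ?R\<^esub>}" by (simp only: singleton_iff)
  next
    fix f assume f: "f \<in> {\<one>\<^bsub>hom_group R ?Q ?R\<^esub>}"
    have "\<one>\<^bsub>hom_group R ?Q ?R\<^esub> \<in> module_hom R ?Q ?R"
      using linear_on_module_hom[OF Q linear_on_zero_map[OF reg]] by simp
    then show "f \<in> module_hom R ?Q ?R" using f by (simp only: singleton_iff)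
  qed
  have "linear_extension R (carrier ?Q) ?Q (\<lambda>B. B) u = \<zero>\<^bsub>?Q\<^esub>" if u: "u \<in> carrier ?F" for u
  proof -
    have "linear_extension R (carrier ?Q) ?Q (\<lambda>B. B) \<in> module_hom R ?F ?Q"
      by (rule linear_extension_hom[OF Q]) simp
    from module_hom_closed[OF this u] show ?thesis using Q0 by blast
  qed
  then have K: "?K = ?F" unfolding presentation_kernel_def by (simp add: free_module_def cong: conj_cong)
  let ?G = "hom_group R ?F ?R"
  interpret G: group ?G by (rule hom_group_group[OF F reg])
  have "(\<lambda>f. restrict f (carrier ?F)) ` module_hom R ?F ?R = (\<lambda>f. f) ` module_hom R ?F ?R"
    by (rule image_cong[OF refl]) (rule extensional_restrict[OF module_hom_extensional])
  then have E: "Ext1 R ?Q ?R = ?G Mod carrier ?G" unfolding Ext1_def K by simp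
  have "(\<Union>f\<in>carrier ?G. {carrier ?G #>\<^bsub>?G\<^esub> f}) = (\<Union>f\<in>carrier ?G. {carrier ?G})"
  proof (rule SUP_cong[OF refl])
    fix f assume f: "f \<in> carrier ?G"
    show "{carrier ?G #>\<^bsub>?G\<^esub> f} = {carrier ?G}"
      by (simp only: G.coset_join2[OF f G.subgroup_self f])
  qed
  also have "\<dots> = {carrier ?G}" using G.one_closed by blast
  finally have ext: "carrier (Ext1 R ?Q ?R) = {\<one>\<^bsub>Ext1 R ?Q ?R\<^esub>}"
    unfolding E FactGroup_def RCOSETS_def by (simp del: hom_group_simps)
  have "fg_ideal R (carrier R)"
    unfolding fg_ideal_def using R.genideal_one by (intro exI[of _ "{\<one>}"]) simp
  then show ?thesis unfolding GV_def Let_def using hom ext by (intro CollectI conjI)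
qed

lemma strong_Prufer_DW_ring:
  assumes SP: "strong_Prufer_ring R"
  shows "DW_ring R"
proof -
  have R: "cring R" using SP by (simp add: strong_Prufer_ring_def)
  interpret R: cring R by (rule R)
  have "J = carrier R" if "J \<in> GV R" for J
  proof -
    let ?Q = "quotient_module R J" and ?R = "regular_module R"
    have fg: "fg_ideal R J"
      and hom: "carrier (hom_group R ?Q ?R) = {\<one>\<^bsub>hom_group R ?Q ?R\<^esub>}"
      and ext: "carrier (Ext1 R ?Q ?R) = {\<one>\<^bsub>Ext1 R ?Q ?R\<^esub>}"
      using that unfolding GV_def Let_def by blast+
    have J: "ideal J R" using fg R.genideal_ideal by (auto simp: fg_ideal_def)
    have "dense_ideal R J" by (rule Hom_quotient_trivial_dense[OF R J]) (use hom in simp)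
    then show ?thesis
      by (rule strong_Prufer_multiplication_trivial[OF SP fg])
        (rule Ext1_quotient_trivial_multiplication[OF R J ext])
  qed
  then have "GV R \<subseteq> {carrier R}" by (intro subsetI) (simp only: singleton_iff)
  moreover have "{carrier R} \<subseteq> GV R" using carrier_in_GV[OF R] by simp
  ultimately show ?thesis unfolding DW_ring_def using R by (intro conjI equalityI)
qed

theorem corollary3p8:
  fixes R :: "('a, 'r) ring_scheme"
  assumes "strong_Prufer_ring R"
  shows "DW_ring R \<and> fPD TYPE('m) R \<le> 1"
proof
  show "DW_ring R" by (rule strong_Prufer_DW_ring[OF assms])
  show "fPD TYPE('m) R \<le> 1"
    unfolding fPD_def
    by (intro SUP_least strong_Prufer_projective_dimension_le_1[OF assms]) simp
qed

end
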